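(* Let $\mathcal{H}$ be an infinite dimensional separable complex Hilbert space, let $\mathcal{F}=\{f_i\}_{i\ge1}$ be a frame in a closed subspace $\mathcal{K}\subseteq\mathcal{H}$, and let $\{u_i\}$ be its canonical Parseval frame. Suppose that there exists a Parseval frame (in some closed subspace of $\mathcal{H}$) quadratically close to $\{f_i\}$. Then the estimate $$\sum_{i=1}^\infty\|f_i-u_i\|^2\le\sum_{i=1}^\infty\|f_i-x_i\|^2$$ is valid for all Parseval frames $\{x_i\}\in\mathcal{Q}_{\mathcal{F}}^0$. Furthermore, equality holds if and only if $\{x_i\}=\{u_i\}$.
   Context: A frame in a closed subspace $\mathcal{K}\subseteq\mathcal{H}$ is a sequence $\{f_i\}_{i\ge1}$ in $\mathcal{K}$ for which there are $A,B>0$ with $A\|f\|^2\le\sum_{i=1}^\infty|\langle f,f_i\rangle|^2\le B\|f\|^2$ for all $f\in\mathcal{K}$; it is a Parseval frame if one can take $A=B=1$. Two frames $\{f_i\}$, $\{g_i\}$ in subspaces of $\mathcal{H}$ are quadratically close if $\sum_{i=1}^\infty\|f_i-g_i\|^2<\infty$. The synthesis operator of $\{f_i\}$ is the bounded operator $F:\ell^2\to\mathcal{H}$, $F(e_i)=f_i$, with $\{e_i\}$ the standard basis of $\ell^2$; it has closed range $\mathcal{K}$, and for a Parseval frame it is a partial isometry. Let $F=U|F|$ be the polar decomposition ($U$ the unique partial isometry with $F=U|F|$ and $\ker(U)=\ker(F)$); the canonical Parseval frame of $\{f_i\}$ is $\{u_i\}=\{Ue_i\}$. $\mathcal{Q}_{\mathcal{F}}$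 is the set of all Parseval frames in closed subspaces of $\mathcal{H}$ that are quadratically close to $\{f_i\}$. For orthogonal projections $P,Q$ on a Hilbert space such that $QP|_{\operatorname{ran}(P)}:\operatorname{ran}(P)\to\operatorname{ran}(Q)$ is Fredholm, $j(P,Q)$ denotes the index of this operator, i.e. $j(P,Q)=\dim(\ker(Q)\cap\operatorname{ran}(P))-\dim(\operatorname{ran}(Q)\cap\ker(P))$. For $\{x_i\}\in\mathcal{Q}_{\mathcal{F}}$ with synthesis operator $X$, the index $j(U^*U,X^*X)$ is well defined. For an integer $k$, $\mathcal{Q}_{\mathcal{F}}^k=\{\{x_i\}\in\mathcal{Q}_{\mathcal{F}}: j(U^*U,X^*X)=k\}$. *)

theory Defs
  imports "HOL-Analysis.Analysis"
begin

section \<open>Complex Hilbert spaces\<close>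

text \<open>
  A complex inner product space is presented as a real inner product space with a compatible
  complex structure: the real inner product is the real part of the complex one, so norm, metric
  and topology are those of \<^class>\<open>real_inner\<close>. The complex inner product is linear in its
  first argument.
\<close>

class complex_inner = real_inner +
  fixes scaleC :: "complex \<Rightarrow> 'a \<Rightarrow> 'a" (infixr \<open>*\<^sub>C\<close> 75)
    and cinner :: "'a \<Rightarrow> 'a \<Rightarrow> complex"
  assumes scaleC_add_right: "c *\<^sub>C (x + y) = c *\<^sub>C x + c *\<^sub>C y"
    and scaleC_add_left: "(c + d) *\<^sub>C x = c *\<^sub>C x + d *\<^sub>C x"
    and scaleC_scaleC: "c *\<^sub>C d *\<^sub>C x = (c * d) *\<^sub>C x"
    and scaleC_of_real: "complex_of_real r *\<^sub>C x = r *\<^sub>R x"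
    and cinner_commute: "cinner x y = cnj (cinner y x)"
    and cinner_add_left: "cinner (x + y) z = cinner x z + cinner y z"
    and cinner_scaleC_left: "cinner (c *\<^sub>C x) y = c * cinner x y"
    and inner_eq_Re_cinner: "inner x y = Re (cinner x y)"

class chilbert_space = complex_inner + complete_space

global_interpretation complex_vector:
  vector_space "scaleC :: complex \<Rightarrow> 'a \<Rightarrow> 'a::complex_inner"
  defines csubspace = complex_vector.subspace
    and cspan = complex_vector.span
    and cdim = complex_vector.dim
proof
  fix x :: 'a
  show "1 *\<^sub>C x = x"
    using scaleC_of_real [of 1 x] by simp
qed (simp_all add: scaleC_add_right scaleC_add_left scaleC_scaleC)

definition infinite_cdim :: "'a::complex_inner itself \<Rightarrow> bool" where
  "infinite_cdim _ \<longleftrightarrow> (\<nexists>B :: 'a set. finite B \<and> cspan B = UNIV)"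

definition bounded_clinear :: "('a::complex_inner \<Rightarrow> 'b::complex_inner) \<Rightarrow> bool" where
  "bounded_clinear T \<longleftrightarrow> bounded_linear T \<and> (\<forall>c x. T (c *\<^sub>C x) = c *\<^sub>C T x)"

definition ker :: "('a \<Rightarrow> 'b::zero) \<Rightarrow> 'a set" where
  "ker T = {x. T x = 0}"

definition cadjoint :: "('a::chilbert_space \<Rightarrow> 'b::chilbert_space) \<Rightarrow> 'b \<Rightarrow> 'a" where
  "cadjoint T = (THE S. bounded_clinear S \<and> (\<forall>x y. cinner (T x) y = cinner x (S y)))"

definition positive_op :: "('a::chilbert_space \<Rightarrow> 'a) \<Rightarrow> bool" where
  "positive_op R \<longleftrightarrow> bounded_clinear R \<and> (\<forall>x. cinner (R x) x \<in> \<real>\<^sub>\<ge>\<^sub>0)"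

definition op_abs :: "('a::chilbert_space \<Rightarrow> 'b::chilbert_space) \<Rightarrow> 'a \<Rightarrow> 'a" where
  "op_abs T = (THE R. positive_op R \<and> R \<circ> R = cadjoint T \<circ> T)"

definition partial_isometry :: "('a::chilbert_space \<Rightarrow> 'b::chilbert_space) \<Rightarrow> bool" where
  "partial_isometry U \<longleftrightarrow> bounded_clinear U \<and>
     (\<forall>x. (\<forall>z \<in> ker U. cinner x z = 0) \<longrightarrow> norm (U x) = norm x)"

definition polar_part :: "('a::chilbert_space \<Rightarrow> 'b::chilbert_space) \<Rightarrow> 'a \<Rightarrow> 'b" where
  "polar_part T = (THE U. partial_isometry U \<and> T = U \<circ> op_abs T \<and> ker U = ker T)"

text \<open>
  The index \<open>j(P, Q)\<close> of the Fredholm operator \<open>QP : ran P \<rightarrow> ran Q\<close>, for orthogonal projections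
  \<open>P\<close>, \<open>Q\<close>. Its kernel is \<open>ker Q \<inter> ran P\<close>, and the orthogonal complement of its range in \<open>ran Q\<close>
  is \<open>ran Q \<inter> ker P\<close>. Fredholmness makes both dimensions finite; outside that case the value
  carries no meaning, since \<^const>\<open>cdim\<close> is 0 on infinite dimensional spaces.
\<close>

definition proj_index :: "('a::chilbert_space \<Rightarrow> 'a) \<Rightarrow> ('a \<Rightarrow> 'a) \<Rightarrow> int" where
  "proj_index P Q = int (cdim (ker Q \<inter> range P)) - int (cdim (range Q \<inter> ker P))"


section \<open>The sequence space\<close>

typedef ell2 = "{x :: nat \<Rightarrow> complex. summable (\<lambda>i. (cmod (x i))\<^sup>2)}"
  morphisms ell2_coord Abs_ell2
proof
  show "(\<lambda>_. 0) \<in> {x :: nat \<Rightarrow> complex. summable (\<lambda>i. (cmod (x i))\<^sup>2)}"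
    by simp
qed

lemma summable_ell2_coord: "summable (\<lambda>i. (cmod (ell2_coord x i))\<^sup>2)"
  using ell2_coord [of x] by simp

lemma ell2_coord_Abs:
  "summable (\<lambda>i. (cmod (x i))\<^sup>2) \<Longrightarrow> ell2_coord (Abs_ell2 x) = x"
  by (simp add: Abs_ell2_inverse)

lemma ell2_eqI: "(\<And>i. ell2_coord x i = ell2_coord y i) \<Longrightarrow> x = y"
  by (simp add: ell2_coord_inject [symmetric] ext)

lemma cmod_add_square_le: "(cmod (a + b))\<^sup>2 \<le> 2 * (cmod a)\<^sup>2 + 2 * (cmod b)\<^sup>2"
proof -
  have "(cmod (a + b))\<^sup>2 \<le> (cmod a + cmod b)\<^sup>2"
    by (intro power_mono norm_triangle_ineq) simp
  also have "\<dots> \<le> 2 * (cmod a)\<^sup>2 + 2 * (cmod b)\<^sup>2"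
    using sum_squares_bound [of "cmod a" "cmod b"] by (simp add: power2_sum)
  finally show ?thesis .
qed

lemma summable_ell2_add:
  "summable (\<lambda>i. (cmod (ell2_coord x i + ell2_coord y i))\<^sup>2)"
  by (rule summable_comparison_test' [where N = 0 and
        g = "\<lambda>i. 2 * (cmod (ell2_coord x i))\<^sup>2 + 2 * (cmod (ell2_coord y i))\<^sup>2"])
     (auto intro!: summable_add summable_mult summable_ell2_coord cmod_add_square_le)

lemma summable_ell2_scale: "summable (\<lambda>i. (cmod (c * ell2_coord x i))\<^sup>2)"
  by (simp add: norm_mult power_mult_distrib summable_mult summable_ell2_coord)

lemma summable_ell2_cinner: "summable (\<lambda>i. ell2_coord x i * cnj (ell2_coord y i))"
proof (rule summable_norm_cancel, rule summable_comparison_test' [where N = 0])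
  show "summable (\<lambda>i. (cmod (ell2_coord x i))\<^sup>2 + (cmod (ell2_coord y i))\<^sup>2)"
    by (intro summable_add summable_ell2_coord)
  show "norm (cmod (ell2_coord x i * cnj (ell2_coord y i)))
      \<le> (cmod (ell2_coord x i))\<^sup>2 + (cmod (ell2_coord y i))\<^sup>2" for i
    using sum_squares_bound [of "cmod (ell2_coord x i)" "cmod (ell2_coord y i)"]
      zero_le_power2 [of "cmod (ell2_coord x i)"] zero_le_power2 [of "cmod (ell2_coord y i)"]
    unfolding norm_mult by (simp; linarith)
qed

instantiation ell2 :: complex_inner
begin

definition "0 = Abs_ell2 (\<lambda>_. 0)"
definition "x + y = Abs_ell2 (\<lambda>i. ell2_coord x i + ell2_coord y i)"
definition "c *\<^sub>C x = Abs_ell2 (\<lambda>i. c * ell2_coord x i)"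
definition "r *\<^sub>R x = complex_of_real r *\<^sub>C x" for x :: ell2
definition "- x = (- 1) *\<^sub>C x" for x :: ell2
definition "x - y = x + - y" for x y :: ell2
definition "cinner x y = (\<Sum>i. ell2_coord x i * cnj (ell2_coord y i))"
definition "inner x y = Re (cinner x y)" for x y :: ell2
definition "norm x = sqrt (inner x x)" for x :: ell2
definition "sgn x = inverse (norm x) *\<^sub>R x" for x :: ell2
definition "dist x y = norm (x - y)" for x y :: ell2
definition "uniformity = (INF e\<in>{0<..}. principal {(x :: ell2, y). dist x y < e})"
definition "open U = (\<forall>x\<in>U. eventually (\<lambda>(x', y). x' = x \<longrightarrow> y \<in> U) uniformity)"
  for U :: "ell2 set"

lemma ell2_coord_0: "ell2_coord 0 i = 0"
  by (simp add: zero_ell2_def ell2_coord_Abs)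

lemma ell2_coord_add: "ell2_coord (x + y) i = ell2_coord x i + ell2_coord y i"
  by (simp add: plus_ell2_def ell2_coord_Abs summable_ell2_add)

lemma ell2_coord_scaleC: "ell2_coord (c *\<^sub>C x) i = c * ell2_coord x i"
  by (simp add: scaleC_ell2_def ell2_coord_Abs summable_ell2_scale)

lemma ell2_coord_scaleR: "ell2_coord (r *\<^sub>R x) i = complex_of_real r * ell2_coord x i"
  by (simp add: scaleR_ell2_def ell2_coord_scaleC)

lemma ell2_coord_uminus: "ell2_coord (- x) i = - ell2_coord x i"
  by (simp add: uminus_ell2_def ell2_coord_scaleC)

lemma ell2_coord_diff: "ell2_coord (x - y) i = ell2_coord x i - ell2_coord y i"
  by (simp add: minus_ell2_def ell2_coord_add ell2_coord_uminus)

lemmas ell2_coord_simps = ell2_coord_0 ell2_coord_add ell2_coord_scaleC ell2_coord_scaleR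
  ell2_coord_uminus ell2_coord_diff

lemma ell2_inner_self: "inner x x = (\<Sum>i. (cmod (ell2_coord x i))\<^sup>2)" for x :: ell2
proof -
  have "cinner x x = (\<Sum>i. complex_of_real ((cmod (ell2_coord x i))\<^sup>2))"
    unfolding cinner_ell2_def by (simp only: complex_norm_square)
  also have "\<dots> = complex_of_real (\<Sum>i. (cmod (ell2_coord x i))\<^sup>2)"
    by (rule suminf_of_real [OF summable_ell2_coord, symmetric])
  finally show ?thesis by (simp add: inner_ell2_def)
qed

lemma ell2_cinner_commute: "cinner x y = cnj (cinner y x)" for x y :: ell2
proof -
  have "(\<lambda>i. cnj (ell2_coord y i * cnj (ell2_coord x i))) sums cnj (cinner y x)"
    unfolding cinner_ell2_def using summable_ell2_cinner by (simp only: sums_cnj summable_sums)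
  then show ?thesis
    unfolding cinner_ell2_def by (simp add: sums_iff mult.commute)
qed

lemma ell2_cinner_add_left: "cinner (x + y) z = cinner x z + cinner y z" for x y z :: ell2
  unfolding cinner_ell2_def ell2_coord_add distrib_right
  by (rule suminf_add [OF summable_ell2_cinner summable_ell2_cinner, symmetric])

lemma ell2_cinner_scaleC_left: "cinner (c *\<^sub>C x) y = c * cinner x y" for x y :: ell2
  unfolding cinner_ell2_def ell2_coord_scaleC mult.assoc
  by (rule suminf_mult [OF summable_ell2_cinner])

instance
proof
  fix x y z :: ell2 and c d :: complex and r s :: real
  show "x + y + z = x + (y + z)" "x + y = y + x" "0 + x = x" "- x + x = 0"
    "x - y = x + - y" "r *\<^sub>R (x + y) = r *\<^sub>R x + r *\<^sub>R y" "(r + s) *\<^sub>R x = r *\<^sub>R x + s *\<^sub>R x"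
    "r *\<^sub>R s *\<^sub>R x = (r * s) *\<^sub>R x" "1 *\<^sub>R x = x"
    "c *\<^sub>C (x + y) = c *\<^sub>C x + c *\<^sub>C y" "(c + d) *\<^sub>C x = c *\<^sub>C x + d *\<^sub>C x"
    "c *\<^sub>C d *\<^sub>C x = (c * d) *\<^sub>C x" "complex_of_real r *\<^sub>C x = r *\<^sub>R x"
    by (rule ell2_eqI, simp add: ell2_coord_simps algebra_simps)+
  show comm: "cinner x y = cnj (cinner y x)"
    by (rule ell2_cinner_commute)
  show "cinner (x + y) z = cinner x z + cinner y z" "cinner (c *\<^sub>C x) y = c * cinner x y"
    by (rule ell2_cinner_add_left ell2_cinner_scaleC_left)+
  show "inner (x + y) z = inner x z + inner y z" "inner (r *\<^sub>R x) y = r * inner x y"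
    by (simp_all add: inner_ell2_def scaleR_ell2_def ell2_cinner_add_left ell2_cinner_scaleC_left)
  show "inner x y = inner y x"
    unfolding inner_ell2_def by (subst ell2_cinner_commute) simp
  show "0 \<le> inner x x"
    unfolding ell2_inner_self by (intro suminf_nonneg summable_ell2_coord) simp
  show "inner x x = 0 \<longleftrightarrow> x = 0"
    unfolding ell2_inner_self
    by (subst suminf_eq_zero_iff [OF summable_ell2_coord])
       (auto simp: ell2_coord_0 intro: ell2_eqI)
qed (simp_all add: inner_ell2_def norm_ell2_def sgn_ell2_def dist_ell2_def uniformity_ell2_def
    open_ell2_def)

end

lemma ell2_norm_square: "(norm x)\<^sup>2 = (\<Sum>i. (cmod (ell2_coord x i))\<^sup>2)" for x :: ell2
  by (simp add: power2_norm_eq_inner ell2_inner_self)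

lemma ell2_coord_le_norm: "cmod (ell2_coord x i) \<le> norm x"
proof (rule power2_le_imp_le)
  show "(cmod (ell2_coord x i))\<^sup>2 \<le> (norm x)\<^sup>2"
    unfolding ell2_norm_square
    using sum_le_suminf [OF summable_ell2_coord, of "{i}" x] by simp
qed simp

lemma ell2_partial_sum_le: "(\<Sum>i<n. (cmod (ell2_coord x i))\<^sup>2) \<le> (norm x)\<^sup>2"
  unfolding ell2_norm_square by (rule sum_le_suminf [OF summable_ell2_coord]) auto

instance ell2 :: chilbert_space
proof
  fix X :: "nat \<Rightarrow> ell2"
  assume X: "Cauchy X"
  have "Cauchy (\<lambda>n. ell2_coord (X n) i)" for i
    unfolding Cauchy_def dist_norm
  proof (intro allI impI)
    fix e :: real assume "e > 0"
    then obtain M where M: "\<And>m n. m \<ge> M \<Longrightarrow> n \<ge> M \<Longrightarrow> norm (X m - X n) < e"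
      using X unfolding Cauchy_def dist_norm by blast
    have "cmod (ell2_coord (X m) i - ell2_coord (X n) i) < e" if "m \<ge> M" "n \<ge> M" for m n
      using ell2_coord_le_norm [of "X m - X n" i] M [OF that] by (simp add: ell2_coord_diff)
    then show "\<exists>M. \<forall>m\<ge>M. \<forall>n\<ge>M. cmod (ell2_coord (X m) i - ell2_coord (X n) i) < e"
      by blast
  qed
  then have "\<forall>i. \<exists>l. (\<lambda>n. ell2_coord (X n) i) \<longlonglongrightarrow> l"
    by (simp add: Cauchy_convergent_iff convergent_def)
  then obtain l where l: "\<And>i. (\<lambda>n. ell2_coord (X n) i) \<longlonglongrightarrow> l i"
    by metis
  have tail: "(\<Sum>i<N. (cmod (ell2_coord (X m) i - l i))\<^sup>2) \<le> e\<^sup>2"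
    if M: "\<And>m n. m \<ge> M \<Longrightarrow> n \<ge> M \<Longrightarrow> norm (X m - X n) < e" and "m \<ge> M" for m M e N
  proof (rule Lim_bounded)
    show "(\<lambda>n. \<Sum>i<N. (cmod (ell2_coord (X m) i - ell2_coord (X n) i))\<^sup>2)
        \<longlonglongrightarrow> (\<Sum>i<N. (cmod (ell2_coord (X m) i - l i))\<^sup>2)"
      by (intro tendsto_intros l)
    have "(\<Sum>i<N. (cmod (ell2_coord (X m) i - ell2_coord (X n) i))\<^sup>2) \<le> e\<^sup>2" if "n \<ge> M" for n
    proof -
      have "(\<Sum>i<N. (cmod (ell2_coord (X m) i - ell2_coord (X n) i))\<^sup>2) \<le> (norm (X m - X n))\<^sup>2"
        using ell2_partial_sum_le [of "X m - X n" N] by (simp add: ell2_coord_diff)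
      also have "\<dots> \<le> e\<^sup>2"
        using M [OF \<open>m \<ge> M\<close> that] by (intro power_mono) auto
      finally show ?thesis .
    qed
    then show "\<forall>n\<ge>M. (\<Sum>i<N. (cmod (ell2_coord (X m) i - ell2_coord (X n) i))\<^sup>2) \<le> e\<^sup>2"
      by blast
  qed
  have bound: "summable (\<lambda>i. (cmod (ell2_coord (X m) i - l i))\<^sup>2) \<and>
      (\<Sum>i. (cmod (ell2_coord (X m) i - l i))\<^sup>2) \<le> e\<^sup>2"
    if "\<And>m n. m \<ge> M \<Longrightarrow> n \<ge> M \<Longrightarrow> norm (X m - X n) < e" and "m \<ge> M" for m M e
  proof -
    have "summable (\<lambda>i. (cmod (ell2_coord (X m) i - l i))\<^sup>2)"
      by (rule bounded_imp_summable [where B = "e\<^sup>2"])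
         (use tail [OF that, of "Suc _"] in \<open>auto simp: lessThan_Suc_atMost\<close>)
    then show ?thesis
      using tail [OF that] by (auto intro: suminf_le_const)
  qed
  obtain M1 where M1: "\<And>m n. m \<ge> M1 \<Longrightarrow> n \<ge> M1 \<Longrightarrow> norm (X m - X n) < 1"
    using X unfolding Cauchy_def dist_norm by (meson zero_less_one)
  define d where "d = Abs_ell2 (\<lambda>i. ell2_coord (X M1) i - l i)"
  have d: "ell2_coord d i = ell2_coord (X M1) i - l i" for i
    unfolding d_def using bound [OF M1, of M1] by (simp add: ell2_coord_Abs)
  define L where "L = X M1 - d"
  have L: "ell2_coord L i = l i" for i
    by (simp add: L_def ell2_coord_diff d)
  have "X \<longlonglongrightarrow> L"
  proof (rule LIMSEQ_I)
    fix e :: real assume "e > 0"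
    then have "e / 2 > 0" by simp
    then obtain M where M: "\<And>m n. m \<ge> M \<Longrightarrow> n \<ge> M \<Longrightarrow> norm (X m - X n) < e / 2"
      using X unfolding Cauchy_def dist_norm by blast
    have "norm (X m - L) < e" if "m \<ge> M" for m
    proof -
      have "(norm (X m - L))\<^sup>2 \<le> (e / 2)\<^sup>2"
        using bound [OF M that] by (simp add: ell2_norm_square ell2_coord_diff L)
      then have "norm (X m - L) \<le> e / 2"
        by (rule power2_le_imp_le) (use \<open>e > 0\<close> in auto)
      then show ?thesis using \<open>e > 0\<close> by linarith
    qed
    then show "\<exists>M. \<forall>m\<ge>M. norm (X m - L) < e" by blast
  qed
  then show "convergent X" by (auto simp: convergent_def)
qed

definition ell2_basis :: "nat \<Rightarrow> ell2" where
  "ell2_basis i = Abs_ell2 (\<lambda>j. if j = i then 1 else 0)"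

lemma ell2_coord_basis: "ell2_coord (ell2_basis i) j = (if j = i then 1 else 0)"
proof -
  have "(\<lambda>j. (cmod (if j = i then 1 else 0))\<^sup>2) = (\<lambda>j. if j = i then 1 else 0)"
    by auto
  then have "summable (\<lambda>j. (cmod (if j = i then 1 else 0))\<^sup>2)"
    using summable_single [of i "\<lambda>_. 1 :: real"] by simp
  then show ?thesis by (simp add: ell2_basis_def ell2_coord_Abs)
qed


section \<open>Frames\<close>

text \<open>Sequences are indexed from 0 instead of 1.\<close>

definition frame_with_bounds ::
    "real \<Rightarrow> real \<Rightarrow> 'h::chilbert_space set \<Rightarrow> (nat \<Rightarrow> 'h) \<Rightarrow> bool" where
  "frame_with_bounds A B K f \<longleftrightarrow> csubspace K \<and> closed K \<and> range f \<subseteq> K \<and>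
     (\<forall>x\<in>K. summable (\<lambda>i. (cmod (cinner x (f i)))\<^sup>2) \<and>
        A * (norm x)\<^sup>2 \<le> (\<Sum>i. (cmod (cinner x (f i)))\<^sup>2) \<and>
        (\<Sum>i. (cmod (cinner x (f i)))\<^sup>2) \<le> B * (norm x)\<^sup>2)"

definition frame_in :: "'h::chilbert_space set \<Rightarrow> (nat \<Rightarrow> 'h) \<Rightarrow> bool" where
  "frame_in K f \<longleftrightarrow> (\<exists>A>0. \<exists>B>0. frame_with_bounds A B K f)"

definition parseval_frame_in :: "'h::chilbert_space set \<Rightarrow> (nat \<Rightarrow> 'h) \<Rightarrow> bool" where
  "parseval_frame_in K f \<longleftrightarrow> frame_with_bounds 1 1 K f"

definition quadratically_close :: "(nat \<Rightarrow> 'h::chilbert_space) \<Rightarrow> (nat \<Rightarrow> 'h) \<Rightarrow> bool" where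
  "quadratically_close f g \<longleftrightarrow> summable (\<lambda>i. (norm (f i - g i))\<^sup>2)"

definition synthesis :: "(nat \<Rightarrow> 'h::chilbert_space) \<Rightarrow> ell2 \<Rightarrow> 'h" where
  "synthesis f = (THE F. bounded_clinear F \<and> (\<forall>i. F (ell2_basis i) = f i))"

definition canonical_parseval :: "(nat \<Rightarrow> 'h::chilbert_space) \<Rightarrow> nat \<Rightarrow> 'h" where
  "canonical_parseval f i = polar_part (synthesis f) (ell2_basis i)"

definition close_parseval_frames :: "(nat \<Rightarrow> 'h::chilbert_space) \<Rightarrow> (nat \<Rightarrow> 'h) set" where
  "close_parseval_frames f = {x. (\<exists>L. parseval_frame_in L x) \<and> quadratically_close f x}"

definition close_parseval_frames_index ::
    "int \<Rightarrow> (nat \<Rightarrow> 'h::chilbert_space) \<Rightarrow> (nat \<Rightarrow> 'h) set" where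
  "close_parseval_frames_index k f =
     {x \<in> close_parseval_frames f.
        (let U = polar_part (synthesis f); X = synthesis x
         in proj_index (cadjoint U \<circ> U) (cadjoint X \<circ> X) = k)}"

end

theory Submission
  imports Defs
begin

text \<open>
  Let \<open>F\<close> be the synthesis operator of the frame, \<open>U\<close> its polar part, and \<open>X\<close> the synthesis
  operator of a quadratically close Parseval frame. The two sums are the squared
  Hilbert--Schmidt norms of \<open>F - U\<close> and of \<open>F - X\<close>. These norms can be computed in any orthonormal
  basis of the sequence space, and the proof consists in computing them in a basis of eigenvectors
  of \<open>F\<^sup>* F\<close>. Let \<open>P\<close> be the projection onto the orthogonal complement of the kernel of \<open>F\<close>, so that
  \<open>P = U\<^sup>* U\<close>, and let \<open>Q = X\<^sup>* X\<close>.

  Such a basis exists although \<open>F\<^sup>* F\<close> is in general not compact. Since \<open>F - X\<close> is Hilbert--Schmidt and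
  \<open>F\<close> is bounded below on the range of \<open>P\<close>, both \<open>Q (1 - P)\<close> and \<open>P (1 - Q)\<close> are
  Hilbert--Schmidt, and then so is \<open>F\<^sup>* F - P\<close>. The spectral theorem for symmetric Hilbert--Schmidt
  operators diagonalises it on the range of \<open>P\<close> (\<open>spectral_theorem\<close>, \<open>ex_frame_eigenbasis\<close>). The same
  basis determines the positive square root of \<open>F\<^sup>* F\<close> and hence the polar part: \<open>U e = F e / \<parallel>F e\<parallel>\<close>
  (\<open>polar_part_eigenbasis\<close>).

  For an eigenvector \<open>e\<close> in the range of \<open>P\<close>, with \<open>r = \<parallel>F e\<parallel>\<close>, expanding squares yields
  \<open>\<parallel>F e - X e\<parallel>\<^sup>2 + \<parallel>e - Q e\<parallel>\<^sup>2 = \<parallel>F e - U e\<parallel>\<^sup>2 + r (\<parallel>U e - X e\<parallel>\<^sup>2 + \<parallel>e - Q e\<parallel>\<^sup>2)\<close>, while a basis vector \<open>e\<close>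
  of the kernel of \<open>F\<close> contributes \<open>\<parallel>Q e\<parallel>\<^sup>2\<close> to the norm of \<open>F - X\<close> and nothing to that of \<open>F - U\<close>.
  Summing up, the two squared norms differ by the sum of the nonnegative remainders
  \<open>r (\<parallel>U e - X e\<parallel>\<^sup>2 + \<parallel>e - Q e\<parallel>\<^sup>2)\<close>, up to the correction \<open>\<Sum> \<parallel>e - Q e\<parallel>\<^sup>2\<close> over the range of \<open>P\<close>
  minus \<open>\<Sum> \<parallel>Q e\<parallel>\<^sup>2\<close> over its complement. This correction is the index of the pair \<open>P\<close>, \<open>Q\<close>
  (\<open>projection_pair_trace_identity\<close>) and vanishes by assumption (\<open>distance_identity\<close>). Vanishing of
  all remainders leaves only \<open>X = U\<close> (\<open>polar_part_closest\<close>).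

  All sums are taken in the extended nonnegative reals over arbitrary orthonormal bases, so the
  identity also shows that \<open>F - U\<close> is Hilbert--Schmidt.
\<close>

section \<open>Inner products and bounded operators\<close>

lemma cinner_add_right: "cinner x (y + z) = cinner x y + cinner x z"
  for x y z :: "'a::complex_inner"
  by (metis cinner_add_left cinner_commute complex_cnj_add)

lemma cinner_scaleC_right: "cinner x (c *\<^sub>C y) = cnj c * cinner x y"
  for x y :: "'a::complex_inner"
  by (metis cinner_commute cinner_scaleC_left complex_cnj_mult)

lemma cinner_zero_left [simp]: "cinner 0 x = 0" for x :: "'a::complex_inner"
  using cinner_add_left [of 0 0 x] by simp

lemma cinner_zero_right [simp]: "cinner x 0 = 0" for x :: "'a::complex_inner"
  using cinner_add_right [of x 0 0] by simp

lemma cinner_diff_left: "cinner (x - y) z = cinner x z - cinner y z"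
  for x y z :: "'a::complex_inner"
  using cinner_add_left [of "x - y" y z] by simp

lemma cinner_diff_right: "cinner x (y - z) = cinner x y - cinner x z"
  for x y z :: "'a::complex_inner"
  using cinner_add_right [of x "y - z" z] by simp

lemma cinner_sum_left: "cinner (sum f A) y = (\<Sum>a\<in>A. cinner (f a) y)"
  for y :: "'a::complex_inner"
  by (induction A rule: infinite_finite_induct) (auto simp: cinner_add_left)

lemma cinner_sum_right: "cinner y (sum f A) = (\<Sum>a\<in>A. cinner y (f a))"
  for y :: "'a::complex_inner"
  by (induction A rule: infinite_finite_induct) (auto simp: cinner_add_right)

lemma cinner_self: "cinner x x = complex_of_real ((norm x)\<^sup>2)" for x :: "'a::complex_inner"
proof (rule complex_eqI)
  show "Re (cinner x x) = Re (complex_of_real ((norm x)\<^sup>2))"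
    by (simp add: inner_eq_Re_cinner [symmetric] power2_norm_eq_inner)
  have "cinner x x = cnj (cinner x x)"
    by (rule cinner_commute)
  then show "Im (cinner x x) = Im (complex_of_real ((norm x)\<^sup>2))"
    by (metis Im_complex_of_real Reals_cnj_iff complex_is_Real_iff)
qed

lemma cinner_self_eq_0: "cinner x x = 0 \<longleftrightarrow> x = 0" for x :: "'a::complex_inner"
  by (simp add: cinner_self)

lemma norm_scaleC: "norm (c *\<^sub>C x) = cmod c * norm x" for x :: "'a::complex_inner"
proof -
  have "complex_of_real ((norm (c *\<^sub>C x))\<^sup>2) = (c * cnj c) * cinner x x"
    by (simp only: cinner_self [symmetric] cinner_scaleC_left cinner_scaleC_right ac_simps)
  also have "\<dots> = complex_of_real ((cmod c)\<^sup>2 * (norm x)\<^sup>2)"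
    unfolding cinner_self complex_norm_square [symmetric] by simp
  finally have "(norm (c *\<^sub>C x))\<^sup>2 = (cmod c * norm x)\<^sup>2"
    unfolding of_real_eq_iff power_mult_distrib .
  then show ?thesis
    by simp
qed

lemma cmod_cinner_le: "cmod (cinner x y) \<le> norm x * norm y" for x y :: "'a::complex_inner"
proof (cases "cinner x y = 0")
  case False
  define u where "u = cnj (cinner x y) / cmod (cinner x y)"
  have u: "cmod u = 1"
    using False by (simp add: u_def norm_divide)
  have "u * cinner x y = cmod (cinner x y)"
    using False complex_norm_square [of "cinner x y"]
    by (simp add: u_def field_simps power2_eq_square)
  then have "cmod (cinner x y) = inner (u *\<^sub>C x) y"
    by (simp add: inner_eq_Re_cinner cinner_scaleC_left)
  also have "\<dots> \<le> norm (u *\<^sub>C x) * norm y"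
    by (rule norm_cauchy_schwarz)
  finally show ?thesis
    by (simp add: norm_scaleC u)
qed simp

lemma cinner_ext:
  fixes x y :: "'a::complex_inner"
  assumes "\<And>z. cinner x z = cinner y z"
  shows "x = y"
proof -
  have "cinner (x - y) (x - y) = 0"
    by (metis assms cinner_diff_left eq_iff_diff_eq_0)
  then show ?thesis
    by (simp add: cinner_self_eq_0)
qed

lemma cinner_eq_0_commute: "cinner x y = 0 \<longleftrightarrow> cinner y x = 0" for x y :: "'a::complex_inner"
  by (metis cinner_commute complex_cnj_zero)

lemma cmod_cinner_commute: "cmod (cinner x y) = cmod (cinner y x)" for x y :: "'a::complex_inner"
  by (metis cinner_commute complex_mod_cnj)

lemma norm_add_orthogonal:
  fixes x y :: "'a::complex_inner"
  assumes "cinner x y = 0"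
  shows "(norm (x + y))\<^sup>2 = (norm x)\<^sup>2 + (norm y)\<^sup>2"
  using assms norm_add_Pythagorean [of x y] by (simp add: orthogonal_def inner_eq_Re_cinner)

lemma norm_diff_square:
  "(norm (x - y))\<^sup>2 = (norm x)\<^sup>2 + (norm y)\<^sup>2 - 2 * Re (cinner x y)" for x y :: "'a::complex_inner"
  by (simp add: power2_norm_eq_inner inner_diff_left inner_diff_right inner_commute
      flip: inner_eq_Re_cinner)

lemma scaleC_scaleR: "c *\<^sub>C r *\<^sub>R x = r *\<^sub>R c *\<^sub>C x" for x :: "'a::complex_inner"
  by (metis complex_vector.scale_left_commute scaleC_of_real)

lemma bounded_linear_scaleC: "bounded_linear (\<lambda>x. c *\<^sub>C x :: 'a::complex_inner)"
  by (rule bounded_linear_intro [where K = "cmod c"])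
     (simp_all add: scaleC_add_right scaleC_scaleR norm_scaleC mult.commute)

lemma bounded_linear_cinner_left: "bounded_linear (\<lambda>x. cinner x y)" for y :: "'a::complex_inner"
proof (rule bounded_linear_intro [where K = "norm y"])
  show "cinner (r *\<^sub>R x) y = r *\<^sub>R cinner x y" for r and x :: 'a
    by (metis cinner_scaleC_left scaleC_of_real scaleR_conv_of_real)
qed (simp_all add: cinner_add_left cmod_cinner_le)

lemma bounded_linear_cinner_right: "bounded_linear (\<lambda>x. cinner y x)" for y :: "'a::complex_inner"
proof -
  have "(\<lambda>x. cinner y x) = (\<lambda>x. cnj (cinner x y))"
    by (metis cinner_commute)
  then show ?thesis
    using bounded_linear_compose [OF bounded_linear_cnj bounded_linear_cinner_left] by auto
qed

lemma bounded_clinearI: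
  assumes "\<And>x y. T (x + y) = T x + T y" "\<And>c x. T (c *\<^sub>C x) = c *\<^sub>C T x"
    and "\<And>x. norm (T x) \<le> norm x * C"
  shows "bounded_clinear T"
  unfolding bounded_clinear_def
proof (intro conjI allI)
  show "bounded_linear T"
  proof (rule bounded_linear_intro)
    show "T (r *\<^sub>R x) = r *\<^sub>R T x" for r x
      by (metis assms(2) scaleC_of_real)
  qed (rule assms)+
qed (rule assms(2))

lemma bounded_clinear_bounded_linear: "bounded_clinear T \<Longrightarrow> bounded_linear T"
  by (simp add: bounded_clinear_def)

context
  fixes T :: "'a::complex_inner \<Rightarrow> 'b::complex_inner"
  assumes T: "bounded_clinear T"
begin

lemma bounded_clinear_scaleC: "T (c *\<^sub>C x) = c *\<^sub>C T x"
  using T by (simp add: bounded_clinear_def)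

lemma bounded_clinear_add: "T (x + y) = T x + T y"
  using T by (simp add: bounded_clinear_def linear_simps)

lemma bounded_clinear_diff: "T (x - y) = T x - T y"
  using T by (simp add: bounded_clinear_def linear_simps)

lemma bounded_clinear_zero: "T 0 = 0"
  using T by (simp add: bounded_clinear_def linear_simps)

lemma bounded_clinear_sum: "T (sum f A) = (\<Sum>a\<in>A. T (f a))"
  using T by (simp add: bounded_clinear_def bounded_linear.linear linear_sum)

lemma bounded_clinear_bound: "\<exists>B\<ge>0. \<forall>x. norm (T x) \<le> B * norm x"
  using T by (metis bounded_clinear_def bounded_linear.nonneg_bounded mult.commute)

lemma bounded_clinear_continuous: "continuous_on A T"
  using T by (simp add: bounded_clinear_def linear_continuous_on)

lemma csubspace_ker: "csubspace (ker T)"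
  by (auto simp: complex_vector.subspace_def ker_def bounded_clinear_zero bounded_clinear_add
      bounded_clinear_scaleC)

lemma closed_ker: "closed (ker T)"
proof -
  have "ker T = T -` {0}"
    by (auto simp: ker_def)
  then show ?thesis
    using bounded_clinear_continuous [of UNIV] by (simp add: closed_vimage)
qed

end

lemma bounded_clinear_comp:
  "bounded_clinear S \<Longrightarrow> bounded_clinear T \<Longrightarrow> bounded_clinear (\<lambda>x. S (T x))"
  by (simp add: bounded_clinear_def bounded_linear_compose)

lemma bounded_clinear_diff_op:
  "bounded_clinear S \<Longrightarrow> bounded_clinear T \<Longrightarrow> bounded_clinear (\<lambda>x. S x - T x)"
  by (simp add: bounded_clinear_def bounded_linear_sub complex_vector.scale_right_diff_distrib)

lemma bounded_clinear_ident: "bounded_clinear (\<lambda>x :: 'a::complex_inner. x)"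
  by (simp add: bounded_clinear_def)


section \<open>Orthonormal bases\<close>

definition orthonormal :: "'a::complex_inner set \<Rightarrow> bool" where
  "orthonormal E \<longleftrightarrow> (\<forall>x\<in>E. \<forall>y\<in>E. cinner x y = (if x = y then 1 else 0))"

definition orthonormal_basis :: "'a::complex_inner set \<Rightarrow> 'a set \<Rightarrow> bool" where
  "orthonormal_basis M E \<longleftrightarrow>
     E \<subseteq> M \<and> orthonormal E \<and> (\<forall>v\<in>M. (\<forall>e\<in>E. cinner v e = 0) \<longrightarrow> v = 0)"

lemma orthonormal_subset: "orthonormal E \<Longrightarrow> F \<subseteq> E \<Longrightarrow> orthonormal F"
  unfolding orthonormal_def by blast

lemma orthonormal_norm:
  assumes "orthonormal E" "e \<in> E"
  shows "norm e = 1"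
proof -
  have "complex_of_real ((norm e)\<^sup>2) = 1"
    unfolding cinner_self [symmetric] using assms by (simp add: orthonormal_def)
  then show ?thesis
    unfolding of_real_eq_1_iff using norm_ge_zero [of e] by (simp add: power2_eq_1_iff)
qed

lemma cinner_orthonormal_sum:
  assumes "orthonormal E" "finite F" "F \<subseteq> E" "e \<in> E"
  shows "cinner (\<Sum>x\<in>F. c x *\<^sub>C x) e = (if e \<in> F then c e else 0)"
proof -
  have "cinner (\<Sum>x\<in>F. c x *\<^sub>C x) e = (\<Sum>x\<in>F. if x = e then c x else 0)"
    unfolding cinner_sum_left cinner_scaleC_left
    using assms by (intro sum.cong) (auto simp: orthonormal_def)
  then show ?thesis
    using assms(2) by simp
qed

lemma norm_sum_scaleC:
  fixes g :: "'i \<Rightarrow> 'a::complex_inner"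
  assumes "finite F" "\<And>i j. i \<in> F \<Longrightarrow> j \<in> F \<Longrightarrow> cinner (g i) (g j) = (if i = j then 1 else 0)"
  shows "(norm (\<Sum>i\<in>F. c i *\<^sub>C g i))\<^sup>2 = (\<Sum>i\<in>F. (cmod (c i))\<^sup>2)"
proof -
  have "cinner (\<Sum>i\<in>F. c i *\<^sub>C g i) (\<Sum>i\<in>F. c i *\<^sub>C g i) =
      (\<Sum>i\<in>F. \<Sum>j\<in>F. if i = j then c i * cnj (c j) else 0)"
    unfolding cinner_sum_left cinner_scaleC_left
    unfolding cinner_sum_right cinner_scaleC_right sum_distrib_left
    using assms(2) by (intro sum.cong) auto
  also have "\<dots> = (\<Sum>i\<in>F. c i * cnj (c i))"
    using assms(1) by simp
  also have "\<dots> = complex_of_real (\<Sum>i\<in>F. (cmod (c i))\<^sup>2)"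
    unfolding of_real_sum complex_norm_square ..
  finally show ?thesis
    unfolding cinner_self of_real_eq_iff .
qed

lemma norm_orthonormal_sum:
  assumes "orthonormal F" "finite F"
  shows "(norm (\<Sum>x\<in>F. c x *\<^sub>C x))\<^sup>2 = (\<Sum>x\<in>F. (cmod (c x))\<^sup>2)"
  using assms by (intro norm_sum_scaleC) (auto simp: orthonormal_def)

lemma bessel_finite:
  assumes "orthonormal F" "finite F"
  shows "(\<Sum>e\<in>F. (cmod (cinner v e))\<^sup>2) \<le> (norm v)\<^sup>2"
proof -
  let ?p = "\<Sum>e\<in>F. cinner v e *\<^sub>C e"
  have "cinner (v - ?p) e = 0" if "e \<in> F" for e
    using cinner_orthonormal_sum [OF assms subset_refl that] that by (simp add: cinner_diff_left)
  then have "cinner (v - ?p) ?p = 0"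
    by (simp add: cinner_sum_right cinner_scaleC_right)
  from norm_add_orthogonal [OF this] show ?thesis
    using norm_orthonormal_sum [OF assms] by simp
qed

lemma summable_on_cinner_square:
  assumes "orthonormal E"
  shows "(\<lambda>e. (cmod (cinner v e))\<^sup>2) summable_on E"
  by (rule nonneg_bdd_above_summable_on)
     (auto intro!: bdd_aboveI [where M = "(norm v)\<^sup>2"] bessel_finite orthonormal_subset [OF assms])

text \<open>A Bessel bound on finite combinations and completeness suffice: the tails of the coefficient
  series bound the differences of partial sums, which therefore form a Cauchy filter. Synthesis
  operators, orthogonal projections, adjoints and the polar part are all obtained from this fact.\<close>

lemma square_summable_combination:
  fixes g :: "'i \<Rightarrow> 'a::chilbert_space"
  assumes B: "B \<ge> 0"
    and bound: "\<And>F c. finite F \<Longrightarrow> F \<subseteq> I \<Longrightarrow>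
       (norm (\<Sum>i\<in>F. c i *\<^sub>C g i))\<^sup>2 \<le> B * (\<Sum>i\<in>F. (cmod (c i))\<^sup>2)"
    and c: "(\<lambda>i. (cmod (c i))\<^sup>2) summable_on I"
  shows "(\<lambda>i. c i *\<^sub>C g i) summable_on I"
    and "(norm (\<Sum>\<^sub>\<infinity>i\<in>I. c i *\<^sub>C g i))\<^sup>2 \<le> B * (\<Sum>\<^sub>\<infinity>i\<in>I. (cmod (c i))\<^sup>2)"
proof -
  define s where "s = (\<Sum>\<^sub>\<infinity>i\<in>I. (cmod (c i))\<^sup>2)"
  let ?S = "\<lambda>F. \<Sum>i\<in>F. c i *\<^sub>C g i"
  let ?q = "\<lambda>F. \<Sum>i\<in>F. (cmod (c i))\<^sup>2"
  have lim: "(?q \<longlongrightarrow> s) (finite_subsets_at_top I)"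
    using has_sum_infsum [OF c] unfolding s_def has_sum_def .
  have q_le: "?q F \<le> s" if "finite F" "F \<subseteq> I" for F
    unfolding s_def using that c by (intro finite_sum_le_infsum) auto
  have "cauchy_filter (filtermap ?S (finite_subsets_at_top I))"
    unfolding cauchy_filter_metric_filtermap
  proof (intro allI impI)
    fix e :: real assume "e > 0"
    define d where "d = (e / 2)\<^sup>2 / (B + 1)"
    have "d > 0"
      using \<open>e > 0\<close> B by (simp add: d_def)
    moreover have "(B + 1) * d = (e / 2)\<^sup>2"
      using B by (simp add: d_def)
    ultimately have d: "d > 0" "B * d < (e / 2)\<^sup>2"
      by (simp_all add: distrib_right)
    have "\<exists>F0. finite F0 \<and> F0 \<subseteq> I \<and>
        (\<forall>F. finite F \<and> F0 \<subseteq> F \<and> F \<subseteq> I \<longrightarrow> dist (?q F) s < d)"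
      using tendstoD [OF lim d(1)] unfolding eventually_finite_subsets_at_top .
    then obtain F0 where F0: "finite F0" "F0 \<subseteq> I"
      "\<And>F. finite F \<Longrightarrow> F0 \<subseteq> F \<Longrightarrow> F \<subseteq> I \<Longrightarrow> dist (?q F) s < d"
      by metis
    have small: "norm (?S F - ?S F0) < e / 2" if F: "finite F" "F0 \<subseteq> F" "F \<subseteq> I" for F
    proof -
      have "?S F - ?S F0 = ?S (F - F0)"
        using F by (simp add: sum_diff)
      then have "(norm (?S F - ?S F0))\<^sup>2 \<le> B * ?q (F - F0)"
        using bound [of "F - F0" c] F by auto
      also have "?q (F - F0) = ?q F - ?q F0"
        using F by (simp add: sum_diff)
      also have "B * (?q F - ?q F0) \<le> B * d"
        using F0(3) [of F0] F0(1,2) F q_le [of F] B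
        by (intro mult_left_mono) (auto simp: dist_real_def)
      also have "\<dots> < (e / 2)\<^sup>2"
        by (rule d(2))
      finally show ?thesis
        by (rule power_less_imp_less_base) (use \<open>e > 0\<close> in simp)
    qed
    have "eventually (\<lambda>F. finite F \<and> F0 \<subseteq> F \<and> F \<subseteq> I) (finite_subsets_at_top I)"
      unfolding eventually_finite_subsets_at_top using F0(1,2) by blast
    moreover have "dist (?S F) (?S F') < e"
      if "finite F \<and> F0 \<subseteq> F \<and> F \<subseteq> I" "finite F' \<and> F0 \<subseteq> F' \<and> F' \<subseteq> I" for F F'
    proof -
      have "dist (?S F) (?S F') \<le> dist (?S F) (?S F0) + dist (?S F') (?S F0)"
        by (rule dist_triangle2)
      also have "\<dots> < e / 2 + e / 2"
        unfolding dist_norm using small that by (intro add_strict_mono) auto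
      finally show ?thesis by simp
    qed
    ultimately show "\<exists>P. eventually P (finite_subsets_at_top I) \<and>
        (\<forall>F F'. P F \<and> P F' \<longrightarrow> dist (?S F) (?S F') < e)"
      by (intro exI [of _ "\<lambda>F. finite F \<and> F0 \<subseteq> F \<and> F \<subseteq> I"]) blast
  qed
  moreover have "complete (UNIV :: 'a set)"
    by (meson Cauchy_convergent UNIV_I complete_def convergent_def)
  ultimately obtain l where l: "(?S \<longlongrightarrow> l) (finite_subsets_at_top I)"
    using complete_uniform [where S = UNIV] by (force simp add: filterlim_def)
  then have hs: "((\<lambda>i. c i *\<^sub>C g i) has_sum l) I"
    by (simp add: has_sum_def)
  then show "(\<lambda>i. c i *\<^sub>C g i) summable_on I"
    by (rule has_sum_imp_summable)
  have "(norm l)\<^sup>2 \<le> B * s"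
  proof (rule tendsto_upperbound)
    show "((\<lambda>F. (norm (?S F))\<^sup>2) \<longlongrightarrow> (norm l)\<^sup>2) (finite_subsets_at_top I)"
      by (intro tendsto_intros l)
    have "(norm (?S F))\<^sup>2 \<le> B * s" if "finite F" "F \<subseteq> I" for F
      using bound [OF that, of c] mult_left_mono [OF q_le [OF that] B] by linarith
    then show "eventually (\<lambda>F. (norm (?S F))\<^sup>2 \<le> B * s) (finite_subsets_at_top I)"
      by (intro eventually_finite_subsets_at_top_weakI) auto
  qed simp
  then show "(norm (\<Sum>\<^sub>\<infinity>i\<in>I. c i *\<^sub>C g i))\<^sup>2 \<le> B * (\<Sum>\<^sub>\<infinity>i\<in>I. (cmod (c i))\<^sup>2)"
    using infsumI [OF hs] by (simp add: s_def)
qed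

definition orth_proj :: "'a::chilbert_space set \<Rightarrow> 'a \<Rightarrow> 'a" where
  "orth_proj E v = (\<Sum>\<^sub>\<infinity>e\<in>E. cinner v e *\<^sub>C e)"

context
  fixes E :: "'a::chilbert_space set"
  assumes E: "orthonormal E"
begin

lemma has_sum_orth_proj: "((\<lambda>e. cinner v e *\<^sub>C e) has_sum orth_proj E v) E"
proof -
  have "(\<lambda>e. cinner v e *\<^sub>C e) summable_on E"
  proof (rule square_summable_combination(1) [where B = 1])
    show "(norm (\<Sum>i\<in>F. c i *\<^sub>C i))\<^sup>2 \<le> 1 * (\<Sum>i\<in>F. (cmod (c i))\<^sup>2)"
      if "finite F" "F \<subseteq> E" for F and c :: "'a \<Rightarrow> complex"
      using norm_orthonormal_sum [OF orthonormal_subset [OF E that(2)] that(1), of c] by simp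
    show "(\<lambda>e. (cmod (cinner v e))\<^sup>2) summable_on E"
      using E by (rule summable_on_cinner_square)
  qed simp
  then show ?thesis
    unfolding orth_proj_def by (rule has_sum_infsum)
qed

lemma has_sum_cinner_orth_proj:
  "((\<lambda>e. cinner v e * cinner e w) has_sum cinner (orth_proj E v) w) E"
  using has_sum_bounded_linear [OF bounded_linear_cinner_left [of w] has_sum_orth_proj [of v]]
  by (simp add: cinner_scaleC_left o_def)

lemma cinner_orth_proj_basis:
  assumes "e \<in> E"
  shows "cinner (orth_proj E v) e = cinner v e"
proof -
  have e: "cinner e e = 1" "\<And>x. x \<in> E \<Longrightarrow> x \<noteq> e \<Longrightarrow> cinner x e = 0"
    using E assms by (simp_all add: orthonormal_def)
  have "((\<lambda>x. cinner v x * cinner x e) has_sum cinner v e) {e}"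
    by (rule has_sum_finiteI) (simp_all add: e)
  moreover have "((\<lambda>x. cinner v x * cinner x e) has_sum cinner v e) {e} \<longleftrightarrow>
      ((\<lambda>x. cinner v x * cinner x e) has_sum cinner v e) E"
    using assms by (rule_tac has_sum_cong_neutral) (auto simp: e)
  ultimately show ?thesis
    using has_sum_unique [OF has_sum_cinner_orth_proj [of v e]] by blast
qed

lemma cinner_orth_proj_orthogonal:
  assumes "\<And>e. e \<in> E \<Longrightarrow> cinner w e = 0"
  shows "cinner (orth_proj E v) w = 0"
proof -
  have "((\<lambda>e. cinner v e * cinner e w) has_sum 0) E"
    by (rule has_sum_0) (metis assms cinner_eq_0_commute mult_zero_right)
  then show ?thesis
    by (rule has_sum_unique [OF has_sum_cinner_orth_proj])
qed

lemma cinner_orth_proj_residual: "cinner (orth_proj E v) (w - orth_proj E w) = 0"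
  by (rule cinner_orth_proj_orthogonal) (simp add: cinner_diff_left cinner_orth_proj_basis)

lemma orth_proj_symmetric: "cinner (orth_proj E v) w = cinner v (orth_proj E w)"
proof -
  have "cinner (orth_proj E v) w = cinner (orth_proj E v) (orth_proj E w)"
    using cinner_orth_proj_residual [of v w] by (simp add: cinner_diff_right)
  also have "\<dots> = cinner v (orth_proj E w)"
    using cinner_orth_proj_residual [of w v]
    by (metis cinner_commute cinner_diff_right eq_iff_diff_eq_0)
  finally show ?thesis .
qed

lemma orth_proj_eqI:
  assumes "\<And>e. e \<in> E \<Longrightarrow> cinner w e = cinner v e"
  shows "orth_proj E w = orth_proj E v"
  unfolding orth_proj_def using assms by (intro infsum_cong) simp

lemma orth_proj_idem: "orth_proj E (orth_proj E v) = orth_proj E v"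
  by (intro orth_proj_eqI cinner_orth_proj_basis)

lemma norm_orth_proj_le: "norm (orth_proj E v) \<le> norm v"
proof -
  have "(norm v)\<^sup>2 = (norm (orth_proj E v))\<^sup>2 + (norm (v - orth_proj E v))\<^sup>2"
    using norm_add_orthogonal [OF cinner_orth_proj_residual [of v v]] by simp
  then have "(norm (orth_proj E v))\<^sup>2 \<le> (norm v)\<^sup>2"
    by simp
  then show ?thesis
    by (rule power2_le_imp_le) simp
qed

lemma bounded_clinear_orth_proj: "bounded_clinear (orth_proj E)"
proof (rule bounded_clinearI [where C = 1])
  fix v w :: 'a and c
  have "((\<lambda>e. cinner (v + w) e *\<^sub>C e) has_sum (orth_proj E v + orth_proj E w)) E"
    using has_sum_add [OF has_sum_orth_proj has_sum_orth_proj, of v w]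
    by (simp add: cinner_add_left scaleC_add_left)
  then show "orth_proj E (v + w) = orth_proj E v + orth_proj E w"
    unfolding orth_proj_def [of E "v + w"] by (rule infsumI)
  have "((\<lambda>e. cinner (c *\<^sub>C v) e *\<^sub>C e) has_sum (c *\<^sub>C orth_proj E v)) E"
    using has_sum_bounded_linear [OF bounded_linear_scaleC has_sum_orth_proj, of c v]
    by (simp add: cinner_scaleC_left scaleC_scaleC o_def)
  then show "orth_proj E (c *\<^sub>C v) = c *\<^sub>C orth_proj E v"
    unfolding orth_proj_def [of E "c *\<^sub>C v"] by (rule infsumI)
qed (simp add: norm_orth_proj_le)

lemma orth_proj_in_closed:
  assumes "csubspace M" "closed M" "E \<subseteq> M"
  shows "orth_proj E v \<in> M"
proof (rule Lim_in_closed_set [OF assms(2)])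
  show "((\<lambda>F. \<Sum>e\<in>F. cinner v e *\<^sub>C e) \<longlongrightarrow> orth_proj E v) (finite_subsets_at_top E)"
    using has_sum_orth_proj [of v] unfolding has_sum_def .
  show "eventually (\<lambda>F. (\<Sum>e\<in>F. cinner v e *\<^sub>C e) \<in> M) (finite_subsets_at_top E)"
  proof (rule eventually_finite_subsets_at_top_weakI)
    show "(\<Sum>e\<in>F. cinner v e *\<^sub>C e) \<in> M" if "F \<subseteq> E" for F
      using that assms(3)
      by (intro complex_vector.subspace_sum [OF assms(1)] complex_vector.subspace_scale [OF assms(1)])
         auto
  qed
qed simp

end

lemma orth_proj_fixes:
  assumes "csubspace M" "closed M" "orthonormal_basis M E" "v \<in> M"
  shows "orth_proj E v = v"
proof -
  have E: "orthonormal E" "E \<subseteq> M"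
    using assms(3) by (auto simp: orthonormal_basis_def)
  have "v - orth_proj E v \<in> M"
    using assms(1,2,4) orth_proj_in_closed [OF E(1) assms(1,2) E(2)]
    by (simp add: complex_vector.subspace_diff)
  moreover have "cinner (v - orth_proj E v) e = 0" if "e \<in> E" for e
    using that E(1) by (simp add: cinner_diff_left cinner_orth_proj_basis)
  ultimately have "v - orth_proj E v = 0"
    using assms(3) by (auto simp: orthonormal_basis_def)
  then show ?thesis by simp
qed

lemma nn_integral_count_space_has_sum:
  fixes f :: "'i \<Rightarrow> real"
  assumes "(f has_sum s) A" "\<And>i. i \<in> A \<Longrightarrow> f i \<ge> 0"
  shows "(\<integral>\<^sup>+i. ennreal (f i) \<partial>count_space A) = ennreal s"
proof -
  have "f summable_on A"
    using assms(1) by (rule has_sum_imp_summable)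
  then have "(\<lambda>i. norm (f i)) summable_on A"
    using assms(2) by (simp cong: summable_on_cong)
  then have abs: "Infinite_Set_Sum.abs_summable_on f A"
    unfolding abs_summable_equivalent .
  then have "(\<integral>\<^sup>+i. ennreal (f i) \<partial>count_space A) = ennreal (infsetsum f A)"
    using assms(2) by (intro nn_integral_conv_infsetsum) auto
  also have "infsetsum f A = s"
    using infsetsum_infsum [OF abs] infsumI [OF assms(1)] by simp
  finally show ?thesis .
qed

theorem parseval:
  fixes M :: "'a::chilbert_space set"
  assumes "csubspace M" "closed M" "orthonormal_basis M E" "v \<in> M"
  shows "(\<integral>\<^sup>+e. ennreal ((cmod (cinner v e))\<^sup>2) \<partial>count_space E) = ennreal ((norm v)\<^sup>2)"
proof (rule nn_integral_count_space_has_sum)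
  have E: "orthonormal E"
    using assms(3) by (simp add: orthonormal_basis_def)
  have "((\<lambda>e. Re (cinner v e * cinner e v)) has_sum Re (cinner (orth_proj E v) v)) E"
    using has_sum_bounded_linear [OF bounded_linear_Re has_sum_cinner_orth_proj [OF E]]
    by (simp add: o_def)
  moreover have "cinner v e * cinner e v = complex_of_real ((cmod (cinner v e))\<^sup>2)" for e
    by (metis cinner_commute complex_norm_square)
  ultimately show "((\<lambda>e. (cmod (cinner v e))\<^sup>2) has_sum (norm v)\<^sup>2) E"
    by (simp add: orth_proj_fixes [OF assms] cinner_self)
qed simp

text \<open>Zorn's lemma: a maximal orthonormal set of vectors with property \<open>G\<close> is a basis as soon as
  every nonzero orthogonal complement of such a set contains another vector with property \<open>G\<close>.
  A trivial \<open>G\<close> gives orthonormal bases; the property of being an eigenvector gives the spectral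
  theorem.\<close>

lemma orthonormal_basis_exhaustion:
  fixes M :: "'a::complex_inner set"
  assumes step: "\<And>E v. E \<subseteq> M \<Longrightarrow> orthonormal E \<Longrightarrow> \<forall>e\<in>E. G e \<Longrightarrow> v \<in> M \<Longrightarrow> v \<noteq> 0 \<Longrightarrow>
      \<forall>e\<in>E. cinner v e = 0 \<Longrightarrow> \<exists>u\<in>M. norm u = 1 \<and> G u \<and> (\<forall>e\<in>E. cinner u e = 0)"
  shows "\<exists>E. orthonormal_basis M E \<and> (\<forall>e\<in>E. G e)"
proof -
  define A where "A = {E. E \<subseteq> M \<and> orthonormal E \<and> (\<forall>e\<in>E. G e)}"
  have chain: "\<Union>\<C> \<in> A" if "subset.chain A \<C>" for \<C>
  proof -
    have sub: "\<And>E. E \<in> \<C> \<Longrightarrow> E \<in> A" and cmp: "\<And>E F. E \<in> \<C> \<Longrightarrow> F \<in> \<C> \<Longrightarrow> E \<subseteq> F \<or> F \<subseteq> E"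
      using that by (auto simp: subset.chain_def)
    have "cinner x y = (if x = y then 1 else 0)" if xy: "x \<in> E" "E \<in> \<C>" "y \<in> F" "F \<in> \<C>" for x y E F
    proof -
      have "\<exists>D\<in>\<C>. x \<in> D \<and> y \<in> D"
        using cmp [OF xy(2,4)] xy by blast
      then show ?thesis
        using sub by (auto simp: A_def orthonormal_def)
    qed
    then have "orthonormal (\<Union>\<C>)"
      unfolding orthonormal_def by (meson UnionE)
    then show ?thesis
      using sub by (auto simp: A_def)
  qed
  obtain E where E: "E \<in> A" and max: "\<And>X. X \<in> A \<Longrightarrow> E \<subseteq> X \<Longrightarrow> X = E"
    using subset_Zorn' [OF chain] by blast
  have "v = 0" if v: "v \<in> M" "\<forall>e\<in>E. cinner v e = 0" for v
  proof (rule ccontr)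
    assume "v \<noteq> 0"
    then obtain u where u: "u \<in> M" "norm u = 1" "G u" "\<forall>e\<in>E. cinner u e = 0"
      using step [of E v] E v by (auto simp: A_def)
    have uu: "cinner u u = 1"
      by (simp add: cinner_self u(2))
    have "\<forall>e\<in>E. cinner e u = 0"
      using u(4) cinner_eq_0_commute by blast
    then have "orthonormal (insert u E)"
      using u(4) uu E by (auto simp: A_def orthonormal_def)
    then have "insert u E \<in> A"
      using u(1,3) E by (auto simp: A_def)
    then have "insert u E = E"
      using max by blast
    then have "cinner u u = 0"
      using u(4) by blast
    then show False
      using uu by simp
  qed
  then have "orthonormal_basis M E"
    using E by (auto simp: A_def orthonormal_basis_def)
  then show ?thesis
    using E by (auto simp: A_def)
qed

lemma csubspace_scaleR: "csubspace M \<Longrightarrow> v \<in> M \<Longrightarrow> r *\<^sub>R v \<in> M"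
  by (metis complex_vector.subspace_scale scaleC_of_real)

lemma cinner_scaleR_left: "cinner (r *\<^sub>R x) y = of_real r * cinner x y" for x :: "'a::complex_inner"
  by (metis cinner_scaleC_left scaleC_of_real)

lemma cinner_scaleR_right: "cinner x (r *\<^sub>R y) = of_real r * cinner x y" for x :: "'a::complex_inner"
  by (metis cinner_scaleC_right complex_cnj_complex_of_real scaleC_of_real)

lemma ex_orthonormal_basis:
  fixes M :: "'a::complex_inner set"
  assumes "csubspace M"
  shows "\<exists>E. orthonormal_basis M E"
proof -
  have "\<exists>E. orthonormal_basis M E \<and> (\<forall>e\<in>E. True)"
  proof (rule orthonormal_basis_exhaustion)
    fix E and v :: 'a
    assume "v \<in> M" "v \<noteq> 0" "\<forall>e\<in>E. cinner v e = 0"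
    then show "\<exists>u\<in>M. norm u = 1 \<and> True \<and> (\<forall>e\<in>E. cinner u e = 0)"
      using assms
      by (intro bexI [of _ "inverse (norm v) *\<^sub>R v"]) (auto simp: cinner_scaleR_left csubspace_scaleR)
  qed
  then show ?thesis by blast
qed


section \<open>Adjoints\<close>

context
  fixes T :: "'a::chilbert_space \<Rightarrow> 'b::chilbert_space"
  assumes T: "bounded_clinear T"
begin

text \<open>The vector representing the functional \<open>x \<mapsto> \<langle>T x, y\<rangle>\<close> has the coordinates \<open>\<langle>y, T e\<rangle>\<close>; testing
  the functional on its own partial sums shows that they are square summable.\<close>

lemma ex_adjoint_vector: "\<exists>s. \<forall>x. cinner (T x) y = cinner x s"
proof -
  obtain E :: "'a set" where E: "orthonormal_basis UNIV E"
    using ex_orthonormal_basis [OF complex_vector.subspace_UNIV] by blast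
  then have on: "orthonormal E"
    by (simp add: orthonormal_basis_def)
  obtain B where B: "B \<ge> 0" "\<And>x. norm (T x) \<le> B * norm x"
    using bounded_clinear_bound [OF T] by blast
  define c where "c e = cinner y (T e)" for e
  have bound: "(\<Sum>e\<in>F. (cmod (c e))\<^sup>2) \<le> (norm y * B)\<^sup>2" if F: "finite F" "F \<subseteq> E" for F
  proof -
    define w where "w = (\<Sum>e\<in>F. c e *\<^sub>C e)"
    define q where "q = (\<Sum>e\<in>F. (cmod (c e))\<^sup>2)"
    have w: "(norm w)\<^sup>2 = q"
      unfolding w_def q_def using norm_orthonormal_sum [OF orthonormal_subset [OF on F(2)] F(1)] .
    have "cinner y (T w) = (\<Sum>e\<in>F. c e * cnj (c e))"
      unfolding w_def bounded_clinear_sum [OF T] bounded_clinear_scaleC [OF T] cinner_sum_right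
        cinner_scaleC_right c_def by (simp add: mult.commute)
    also have "\<dots> = complex_of_real q"
      unfolding q_def of_real_sum complex_norm_square ..
    finally have "q = cmod (cinner y (T w))"
      using w by (metis abs_of_nonneg norm_of_real zero_le_power2)
    also have "\<dots> \<le> norm y * norm (T w)"
      by (rule cmod_cinner_le)
    also have "\<dots> \<le> norm y * (B * norm w)"
      by (intro mult_left_mono B) simp
    finally have "norm w * norm w \<le> (norm y * B) * norm w"
      by (simp add: w [symmetric] power2_eq_square)
    then have "norm w \<le> norm y * B"
      using B(1) by (cases "norm w = 0") (auto dest: mult_right_le_imp_le)
    then show ?thesis
      unfolding q_def [symmetric] w [symmetric] by (intro power_mono) auto
  qed
  have "(\<lambda>e. (cmod (c e))\<^sup>2) summable_on E"
    by (rule nonneg_bdd_above_summable_on)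
       (auto intro!: bdd_aboveI [where M = "(norm y * B)\<^sup>2"] bound)
  then have "(\<lambda>e. c e *\<^sub>C e) summable_on E"
  proof (rule square_summable_combination(1) [where B = 1, rotated 2])
    show "(norm (\<Sum>i\<in>F. c i *\<^sub>C i))\<^sup>2 \<le> 1 * (\<Sum>i\<in>F. (cmod (c i))\<^sup>2)"
      if "finite F" "F \<subseteq> E" for F and c :: "'a \<Rightarrow> complex"
      using norm_orthonormal_sum [OF orthonormal_subset [OF on that(2)] that(1), of c] by simp
  qed simp
  then obtain s where s: "((\<lambda>e. c e *\<^sub>C e) has_sum s) E"
    by (auto simp: summable_on_def)
  have "cinner (T x) y = cinner x s" for x
  proof -
    have "((\<lambda>e. cinner x e *\<^sub>C e) has_sum x) E"
      using has_sum_orth_proj [OF on, of x] orth_proj_fixes [OF complex_vector.subspace_UNIV _ E]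
      by simp
    from has_sum_bounded_linear [OF bounded_linear_cinner_left
        has_sum_bounded_linear [OF bounded_clinear_bounded_linear [OF T] this], of y]
    have "((\<lambda>e. cinner x e * cinner (T e) y) has_sum cinner (T x) y) E"
      by (simp add: bounded_clinear_scaleC [OF T] cinner_scaleC_left)
    moreover have "((\<lambda>e. cinner x e * cinner (T e) y) has_sum cinner x s) E"
    proof -
      have "cinner x (c e *\<^sub>C e) = cinner x e * cinner (T e) y" for e
        unfolding cinner_scaleC_right c_def by (metis cinner_commute mult.commute)
      then show ?thesis
        using has_sum_bounded_linear [OF bounded_linear_cinner_right s, of x] by simp
    qed
    ultimately show ?thesis
      by (rule has_sum_unique)
  qed
  then show ?thesis by blast
qed

text \<open>Linearity and boundedness of the map \<open>y \<mapsto> s\<close> follow from the adjoint identity alone, because vectors are determined by their inner products.\<close>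

lemma ex_adjoint: "\<exists>S. bounded_clinear S \<and> (\<forall>x y. cinner (T x) y = cinner x (S y))"
proof -
  obtain S where S: "\<And>x y. cinner (T x) y = cinner x (S y)"
    using ex_adjoint_vector by metis
  have S': "cinner (S y) x = cinner y (T x)" for x y
    by (metis S cinner_commute)
  obtain B where B: "B \<ge> 0" "\<And>x. norm (T x) \<le> B * norm x"
    using bounded_clinear_bound [OF T] by blast
  have "bounded_clinear S"
  proof (rule bounded_clinearI)
    show "S (x + y) = S x + S y" for x y
      by (rule cinner_ext) (simp add: S' cinner_add_left)
    show "S (c *\<^sub>C x) = c *\<^sub>C S x" for c x
      by (rule cinner_ext) (simp add: S' cinner_scaleC_left)
    show "norm (S y) \<le> norm y * B" for y
    proof -
      have "(norm (S y))\<^sup>2 = cmod (cinner (S y) (S y))"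
        by (simp only: cinner_self norm_of_real) simp
      also have "\<dots> \<le> norm y * norm (T (S y))"
        unfolding S' by (rule cmod_cinner_le)
      also have "\<dots> \<le> norm y * (B * norm (S y))"
        by (intro mult_left_mono B) simp
      finally have "norm (S y) * norm (S y) \<le> (norm y * B) * norm (S y)"
        by (simp add: power2_eq_square)
      then show ?thesis
        using B(1) by (cases "norm (S y) = 0") (auto dest: mult_right_le_imp_le)
    qed
  qed
  with S show ?thesis by blast
qed

lemma cadjoint_eqI:
  assumes "bounded_clinear S" "\<And>x y. cinner (T x) y = cinner x (S y)"
  shows "cadjoint T = S"
  unfolding cadjoint_def
proof (rule the_equality)
  fix R assume R: "bounded_clinear R \<and> (\<forall>x y. cinner (T x) y = cinner x (R y))"
  show "R = S"
  proof
    show "R y = S y" for y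
      by (rule cinner_ext) (metis R assms(2) cinner_commute)
  qed
qed (use assms in auto)

lemma bounded_clinear_cadjoint: "bounded_clinear (cadjoint T)"
  and cinner_cadjoint: "cinner (T x) y = cinner x (cadjoint T y)"
proof -
  obtain S where "bounded_clinear S" "\<And>x y. cinner (T x) y = cinner x (S y)"
    using ex_adjoint by blast
  with cadjoint_eqI [OF this] show "bounded_clinear (cadjoint T)"
    and "cinner (T x) y = cinner x (cadjoint T y)" by auto
qed

lemma cinner_cadjoint_left: "cinner (cadjoint T y) x = cinner y (T x)"
  by (metis cinner_cadjoint cinner_commute)

end


section \<open>Hilbert--Schmidt operators\<close>

lemma nn_integral_count_space_swap:
  fixes f :: "'i \<Rightarrow> 'j \<Rightarrow> ennreal"
  shows "(\<integral>\<^sup>+x. \<integral>\<^sup>+y. f x y \<partial>count_space B \<partial>count_space A) =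
    (\<integral>\<^sup>+y. \<integral>\<^sup>+x. f x y \<partial>count_space A \<partial>count_space B)"
proof -
  let ?g = "\<lambda>(x, y). f x y * indicator A x * indicator B y"
  have 1: "(\<integral>\<^sup>+y. f x y \<partial>count_space B) * indicator A x = (\<integral>\<^sup>+y. ?g (x, y) \<partial>count_space UNIV)" for x
    by (cases "x \<in> A") (simp_all add: nn_integral_count_space_indicator [of B])
  have 2: "(\<integral>\<^sup>+x. f x y \<partial>count_space A) * indicator B y = (\<integral>\<^sup>+x. ?g (x, y) \<partial>count_space UNIV)" for y
    by (cases "y \<in> B") (simp_all add: nn_integral_count_space_indicator [of A])
  show ?thesis
    unfolding nn_integral_count_space_indicator [of A "\<lambda>x. \<integral>\<^sup>+y. f x y \<partial>count_space B", simplified]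
      nn_integral_count_space_indicator [of B "\<lambda>y. \<integral>\<^sup>+x. f x y \<partial>count_space A", simplified] 1 2
      nn_integral_fst_count_space nn_integral_snd_count_space ..
qed

lemma nn_integral_count_space_subset:
  "A \<subseteq> B \<Longrightarrow> (\<integral>\<^sup>+x. f x \<partial>count_space A) \<le> (\<integral>\<^sup>+x. f x \<partial>count_space B)"
  by (auto simp: nn_integral_count_space_indicator [of A] nn_integral_count_space_indicator [of B]
      intro!: nn_integral_mono split: split_indicator)

lemma nn_integral_count_space_Un:
  assumes "A \<inter> B = {}"
  shows "(\<integral>\<^sup>+x. f x \<partial>count_space (A \<union> B)) =
    (\<integral>\<^sup>+x. f x \<partial>count_space A) + (\<integral>\<^sup>+x. f x \<partial>count_space B)"
proof -
  have "(\<integral>\<^sup>+x. f x \<partial>count_space (A \<union> B)) =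
      (\<integral>\<^sup>+x. f x * indicator A x + f x * indicator B x \<partial>count_space UNIV)"
    unfolding nn_integral_count_space_indicator [of "A \<union> B", simplified]
    using assms by (intro nn_integral_cong) (auto split: split_indicator)
  also have "\<dots> = (\<integral>\<^sup>+x. f x \<partial>count_space A) + (\<integral>\<^sup>+x. f x \<partial>count_space B)"
    by (simp add: nn_integral_add nn_integral_count_space_indicator [of A]
        nn_integral_count_space_indicator [of B])
  finally show ?thesis .
qed

text \<open>The squared Hilbert--Schmidt norm. The chosen basis does not matter, by
  \<open>sum_norm_square_cadjoint\<close> below.\<close>

definition hs :: "('a::chilbert_space \<Rightarrow> 'b::chilbert_space) \<Rightarrow> ennreal" where
  "hs T = (\<integral>\<^sup>+e. ennreal ((norm (T e))\<^sup>2) \<partial>count_space (SOME E. orthonormal_basis UNIV E))"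

lemma parseval_UNIV:
  fixes v :: "'a::chilbert_space"
  assumes "orthonormal_basis UNIV E"
  shows "ennreal ((norm v)\<^sup>2) = (\<integral>\<^sup>+e. ennreal ((cmod (cinner v e))\<^sup>2) \<partial>count_space E)"
  using parseval [OF complex_vector.subspace_UNIV closed_UNIV assms, of v] by simp

text \<open>Both sides are the sum of all \<open>\<bar>\<langle>T e, g\<rangle>\<bar>\<^sup>2\<close>. Since \<open>E\<close> occurs on the left only and \<open>G\<close> on the right
  only, this also makes the Hilbert--Schmidt norm independent of the basis.\<close>

lemma sum_norm_square_cadjoint:
  fixes T :: "'a::chilbert_space \<Rightarrow> 'b::chilbert_space"
  assumes T: "bounded_clinear T" and E: "orthonormal_basis UNIV E" and G: "orthonormal_basis UNIV G"
  shows "(\<integral>\<^sup>+e. ennreal ((norm (T e))\<^sup>2) \<partial>count_space E) =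
    (\<integral>\<^sup>+g. ennreal ((norm (cadjoint T g))\<^sup>2) \<partial>count_space G)"
  unfolding parseval_UNIV [OF G, of "T _"] parseval_UNIV [OF E, of "cadjoint T _"]
  by (subst nn_integral_count_space_swap)
     (simp only: cinner_cadjoint [OF T] cmod_cinner_commute [of "cadjoint T _"])

lemma some_orthonormal_basis:
  "orthonormal_basis UNIV (SOME E :: 'a::chilbert_space set. orthonormal_basis UNIV E)"
  using ex_orthonormal_basis [OF complex_vector.subspace_UNIV] by (rule someI_ex)

lemma hs_cadjoint: "bounded_clinear T \<Longrightarrow> hs (cadjoint T) = hs T"
  unfolding hs_def using sum_norm_square_cadjoint some_orthonormal_basis by metis

lemma hs_eq:
  assumes "bounded_clinear T" "orthonormal_basis UNIV E"
  shows "hs T = (\<integral>\<^sup>+e. ennreal ((norm (T e))\<^sup>2) \<partial>count_space E)"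
  unfolding hs_def using sum_norm_square_cadjoint [OF assms(1)] some_orthonormal_basis assms(2)
  by metis

lemma hs_mono:
  assumes "\<And>v. norm (S v) \<le> b * norm (T v)"
  shows "hs S \<le> ennreal (b\<^sup>2) * hs T"
proof -
  have "ennreal ((norm (S v))\<^sup>2) \<le> ennreal (b\<^sup>2) * ennreal ((norm (T v))\<^sup>2)" for v
    unfolding ennreal_mult [symmetric, OF zero_le_power2 zero_le_power2] power_mult_distrib [symmetric]
    by (intro ennreal_leI power_mono assms) simp
  then show ?thesis
    unfolding hs_def by (simp add: nn_integral_cmult [symmetric] nn_integral_mono)
qed

lemma hs_finite_mono:
  assumes "hs T < \<infinity>" "\<And>v. norm (S v) \<le> b * norm (T v)"
  shows "hs S < \<infinity>"
  using le_less_trans [OF hs_mono [of S b T, OF assms(2)]] assms(1)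
  by (simp add: ennreal_mult_less_top)

lemma hs_finite_left:
  assumes "bounded_clinear B" "hs T < \<infinity>"
  shows "hs (\<lambda>x. B (T x)) < \<infinity>"
  using bounded_clinear_bound [OF assms(1)] hs_finite_mono [OF assms(2), of "\<lambda>x. B (T x)"] by blast

lemma cadjoint_comp:
  assumes S: "bounded_clinear S" and T: "bounded_clinear T"
  shows "cadjoint (\<lambda>x. S (T x)) = (\<lambda>x. cadjoint T (cadjoint S x))"
  by (rule cadjoint_eqI [OF bounded_clinear_comp [OF S T]
        bounded_clinear_comp [OF bounded_clinear_cadjoint [OF T] bounded_clinear_cadjoint [OF S]]])
     (simp only: cinner_cadjoint [OF S] cinner_cadjoint [OF T])

text \<open>The left ideal property becomes the right one under adjoints.\<close>

lemma hs_finite_right: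
  assumes B: "bounded_clinear B" and T: "bounded_clinear T" and "hs T < \<infinity>"
  shows "hs (\<lambda>x. T (B x)) < \<infinity>"
proof -
  have "hs (\<lambda>x. cadjoint B (cadjoint T x)) < \<infinity>"
    by (rule hs_finite_left [OF bounded_clinear_cadjoint [OF B]])
       (use assms(3) hs_cadjoint [OF T] in simp)
  then show ?thesis
    using hs_cadjoint [OF bounded_clinear_comp [OF T B]] by (simp add: cadjoint_comp [OF T B])
qed

lemma hs_finite_add:
  assumes "hs S < \<infinity>" "hs T < \<infinity>"
  shows "hs (\<lambda>x. S x + T x) < \<infinity>"
proof -
  have "(norm (S v + T v))\<^sup>2 \<le> 2 * (norm (S v))\<^sup>2 + 2 * (norm (T v))\<^sup>2" for v
  proof -
    have "(norm (S v + T v))\<^sup>2 \<le> (norm (S v) + norm (T v))\<^sup>2"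
      by (intro power_mono norm_triangle_ineq) simp
    then show ?thesis
      using sum_squares_bound [of "norm (S v)" "norm (T v)"] by (simp add: power2_sum)
  qed
  then have "ennreal ((norm (S v + T v))\<^sup>2) \<le>
      ennreal (2 * (norm (S v))\<^sup>2 + 2 * (norm (T v))\<^sup>2)" for v
    by (rule ennreal_leI)
  then have "ennreal ((norm (S v + T v))\<^sup>2) \<le>
      2 * ennreal ((norm (S v))\<^sup>2) + 2 * ennreal ((norm (T v))\<^sup>2)" for v
    by (simp add: ennreal_mult)
  then have "hs (\<lambda>x. S x + T x) \<le> 2 * hs S + 2 * hs T"
    unfolding hs_def
    by (simp add: nn_integral_cmult [symmetric] nn_integral_add [symmetric] nn_integral_mono)
  also have "\<dots> < \<infinity>"
    using assms by (simp add: ennreal_mult_less_top)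
  finally show ?thesis .
qed

lemma hs_finite_diff:
  assumes "hs S < \<infinity>" "hs T < \<infinity>"
  shows "hs (\<lambda>x. S x - T x) < \<infinity>"
  using hs_finite_add [OF assms(1), of "\<lambda>x. - T x"] hs_finite_mono [OF assms(2), of "\<lambda>x. - T x" 1]
  by simp

text \<open>The coordinates of \<open>T w\<close> are \<open>\<langle>w, T\<^sup>* g\<rangle>\<close>, so the Cauchy--Schwarz inequality bounds each of them,
  and the bounds sum up to the Hilbert--Schmidt norm of \<open>T\<^sup>*\<close>.\<close>

lemma norm_le_hs:
  fixes T :: "'a::chilbert_space \<Rightarrow> 'b::chilbert_space"
  assumes T: "bounded_clinear T"
  shows "ennreal ((norm (T w))\<^sup>2) \<le> ennreal ((norm w)\<^sup>2) * hs T"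
proof -
  obtain G :: "'b set" where G: "orthonormal_basis UNIV G"
    using ex_orthonormal_basis [OF complex_vector.subspace_UNIV] by blast
  have "ennreal ((norm (T w))\<^sup>2) =
      (\<integral>\<^sup>+g. ennreal ((cmod (cinner w (cadjoint T g)))\<^sup>2) \<partial>count_space G)"
    unfolding parseval_UNIV [OF G] cinner_cadjoint [OF T] ..
  also have "\<dots> \<le> (\<integral>\<^sup>+g. ennreal ((norm w)\<^sup>2) * ennreal ((norm (cadjoint T g))\<^sup>2) \<partial>count_space G)"
  proof (rule nn_integral_mono)
    fix g
    show "ennreal ((cmod (cinner w (cadjoint T g)))\<^sup>2) \<le>
        ennreal ((norm w)\<^sup>2) * ennreal ((norm (cadjoint T g))\<^sup>2)"
      unfolding ennreal_mult [symmetric, OF zero_le_power2 zero_le_power2]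
        power_mult_distrib [symmetric]
      by (intro ennreal_leI power_mono cmod_cinner_le) simp
  qed
  also have "\<dots> = ennreal ((norm w)\<^sup>2) * hs T"
    using hs_eq [OF bounded_clinear_cadjoint [OF T] G] hs_cadjoint [OF T]
    by (simp add: nn_integral_cmult)
  finally show ?thesis .
qed

lemma summable_on_of_finite_nn_integral:
  fixes f :: "'i \<Rightarrow> real"
  assumes "(\<integral>\<^sup>+i. ennreal (f i) \<partial>count_space A) < \<infinity>" "\<And>i. f i \<ge> 0"
  shows "f summable_on A"
proof (rule nonneg_bdd_above_summable_on)
  have "sum f F \<le> enn2real (\<integral>\<^sup>+i. ennreal (f i) \<partial>count_space A)" if "finite F" "F \<subseteq> A" for F
  proof -
    have "ennreal (sum f F) = (\<integral>\<^sup>+i. ennreal (f i) \<partial>count_space F)"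
      using that(1) assms(2) by (simp add: nn_integral_count_space_finite)
    also have "\<dots> \<le> (\<integral>\<^sup>+i. ennreal (f i) \<partial>count_space A)"
      by (rule nn_integral_count_space_subset [OF that(2)])
    finally show ?thesis
      using assms by (metis enn2real_ennreal enn2real_mono infinity_ennreal_def sum_nonneg)
  qed
  then show "bdd_above (sum f ` {F. F \<subseteq> A \<and> finite F})"
    by (auto intro!: bdd_aboveI)
qed (rule assms(2))

section \<open>The spectral theorem for Hilbert--Schmidt operators\<close>

lemma bounded_combinations_in_compact:
  fixes g :: "'i \<Rightarrow> 'a::chilbert_space"
  assumes "finite F"
  shows "\<exists>K. compact K \<and> (\<forall>c. (\<forall>i\<in>F. cmod (c i) \<le> 1) \<longrightarrow> (\<Sum>i\<in>F. c i *\<^sub>C g i) \<in> K)"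
  using assms
proof (induction F)
  case empty
  then show ?case by (intro exI [of _ "{0}"]) auto
next
  case (insert a F)
  then obtain K where K: "compact K"
    "\<And>c. (\<forall>i\<in>F. cmod (c i) \<le> 1) \<Longrightarrow> (\<Sum>i\<in>F. c i *\<^sub>C g i) \<in> K" by blast
  let ?S = "(\<lambda>c. c *\<^sub>C g a) ` cball 0 1"
  have "bounded_linear (\<lambda>c. c *\<^sub>C g a)"
  proof (rule bounded_linear_intro [where K = "norm (g a)"])
    show "(r *\<^sub>R c) *\<^sub>C g a = r *\<^sub>R c *\<^sub>C g a" for r c
      by (metis scaleC_of_real scaleC_scaleC scaleR_conv_of_real)
  qed (simp_all add: scaleC_add_left norm_scaleC)
  then have S: "compact ?S"
    by (intro compact_continuous_image linear_continuous_on) auto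
  have "(\<Sum>i\<in>insert a F. c i *\<^sub>C g i) \<in> {x + y |x y. x \<in> ?S \<and> y \<in> K}"
    if "\<forall>i\<in>insert a F. cmod (c i) \<le> 1" for c
  proof -
    have "c a *\<^sub>C g a \<in> ?S" "(\<Sum>i\<in>F. c i *\<^sub>C g i) \<in> K"
      using that K(2) [of c] by auto
    then show ?thesis
      using insert.hyps by auto
  qed
  then show ?case
    using compact_sums [OF S K(1)] by blast
qed

lemma finite_orth_proj:
  assumes "finite F"
  shows "orth_proj F v = (\<Sum>e\<in>F. cinner v e *\<^sub>C e)"
  using assms by (simp add: orth_proj_def)

text \<open>Off a finite part \<open>F\<close> of the basis, the norm of \<open>C\<close> is at most the Hilbert--Schmidt norm of
  \<open>C (1 - orth_proj F)\<close>, whose square is the tail over \<open>E - F\<close> of a convergent series.\<close>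

lemma hs_tail_small:
  fixes C :: "'a::chilbert_space \<Rightarrow> 'b::chilbert_space"
  assumes C: "bounded_clinear C" and "hs C < \<infinity>" and E: "orthonormal_basis UNIV E" and "\<epsilon> > 0"
  shows "\<exists>F. finite F \<and> F \<subseteq> E \<and> (\<forall>v. norm v \<le> 1 \<longrightarrow> norm (C (v - orth_proj F v)) < \<epsilon>)"
proof -
  define f where "f e = (norm (C e))\<^sup>2" for e
  have on: "orthonormal E"
    using E by (simp add: orthonormal_basis_def)
  have "f summable_on E"
    using assms(2) unfolding hs_eq [OF C E] by (intro summable_on_of_finite_nn_integral) (auto simp: f_def)
  then have s: "(f has_sum infsum f E) E"
    by (rule has_sum_infsum)
  then have "eventually (\<lambda>F. dist (sum f F) (infsum f E) < \<epsilon>\<^sup>2) (finite_subsets_at_top E)"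
    unfolding has_sum_def using \<open>\<epsilon> > 0\<close> by (intro tendstoD) auto
  then obtain F where F: "finite F" "F \<subseteq> E" "dist (sum f F) (infsum f E) < \<epsilon>\<^sup>2"
    unfolding eventually_finite_subsets_at_top by blast
  have onF: "orthonormal F"
    using on F(2) by (rule orthonormal_subset)
  have R: "bounded_clinear (\<lambda>v. C (v - orth_proj F v))"
    by (rule bounded_clinear_comp [OF C bounded_clinear_diff_op [OF bounded_clinear_ident
          bounded_clinear_orth_proj [OF onF]]])
  have "hs (\<lambda>v. C (v - orth_proj F v)) =
      (\<integral>\<^sup>+e. ennreal ((norm (C (e - orth_proj F e)))\<^sup>2) \<partial>count_space E)"
    by (rule hs_eq [OF R E])
  also have "\<dots> = (\<integral>\<^sup>+e. ennreal ((norm (C (e - orth_proj F e)))\<^sup>2) \<partial>count_space (F \<union> (E - F)))"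
    using F(2) by (simp add: Un_absorb1)
  also have "\<dots> = (\<integral>\<^sup>+e. ennreal ((norm (C (e - orth_proj F e)))\<^sup>2) \<partial>count_space F) +
      (\<integral>\<^sup>+e. ennreal ((norm (C (e - orth_proj F e)))\<^sup>2) \<partial>count_space (E - F))"
    by (rule nn_integral_count_space_Un) auto
  also have "(\<integral>\<^sup>+e. ennreal ((norm (C (e - orth_proj F e)))\<^sup>2) \<partial>count_space F) = 0"
  proof -
    have "orth_proj F e = e" if "e \<in> F" for e
    proof -
      have "(\<Sum>x\<in>F. cinner e x *\<^sub>C x) = (\<Sum>x\<in>F. if x = e then x else 0)"
        using onF that by (intro sum.cong) (auto simp: orthonormal_def)
      then show ?thesis
        using that F(1) by (simp add: finite_orth_proj)
    qed
    then have "(\<integral>\<^sup>+e. ennreal ((norm (C (e - orth_proj F e)))\<^sup>2) \<partial>count_space F) =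
        (\<integral>\<^sup>+e. 0 \<partial>count_space F)"
      by (intro nn_integral_cong) (simp add: bounded_clinear_zero [OF C])
    then show ?thesis by simp
  qed
  also have "(\<integral>\<^sup>+e. ennreal ((norm (C (e - orth_proj F e)))\<^sup>2) \<partial>count_space (E - F)) =
      (\<integral>\<^sup>+e. ennreal (f e) \<partial>count_space (E - F))"
  proof (rule nn_integral_cong)
    fix e assume e: "e \<in> space (count_space (E - F))"
    then have "orth_proj F e = 0"
      using on F(2) by (auto simp: finite_orth_proj [OF F(1)] orthonormal_def intro!: sum.neutral)
    then show "ennreal ((norm (C (e - orth_proj F e)))\<^sup>2) = ennreal (f e)"
      by (simp add: f_def)
  qed
  also have "\<dots> = ennreal (infsum f E - sum f F)"
    by (rule nn_integral_count_space_has_sum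
        [OF has_sum_Diff [OF s has_sum_finite [OF F(1)] F(2)]]) (simp add: f_def)
  finally have hs: "hs (\<lambda>v. C (v - orth_proj F v)) = ennreal (infsum f E - sum f F)"
    by simp
  have "norm (C (v - orth_proj F v)) < \<epsilon>" if v: "norm v \<le> 1" for v
  proof -
    have "ennreal ((norm (C (v - orth_proj F v)))\<^sup>2) \<le> ennreal ((norm v)\<^sup>2) * ennreal (infsum f E - sum f F)"
      using norm_le_hs [OF R, of v] unfolding hs .
    also have "\<dots> \<le> 1 * ennreal (infsum f E - sum f F)"
    proof (rule mult_right_mono)
      show "ennreal ((norm v)\<^sup>2) \<le> 1"
        using v by (simp add: power_le_one)
    qed simp
    also have "\<dots> < ennreal (\<epsilon>\<^sup>2)"
      using F(3) \<open>\<epsilon> > 0\<close> by (auto simp: dist_real_def intro!: ennreal_lessI)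
    finally have "(norm (C (v - orth_proj F v)))\<^sup>2 < \<epsilon>\<^sup>2"
      by (simp add: ennreal_less_iff)
    then show ?thesis
      by (rule power_less_imp_less_base) (use \<open>\<epsilon> > 0\<close> in simp)
  qed
  with F(1,2) show ?thesis by blast
qed

text \<open>Hilbert--Schmidt operators are compact: up to a small error \<open>C\<close> only sees finitely many
  coordinates, and on those the unit ball has its image in a compact set. So the image of the
  unit ball is totally bounded.\<close>

lemma hs_compact:
  fixes C :: "'a::chilbert_space \<Rightarrow> 'b::chilbert_space"
  assumes C: "bounded_clinear C" and fin: "hs C < \<infinity>"
  shows "compact (closure (C ` cball 0 1))"
  unfolding compact_eq_totally_bounded
proof (intro conjI allI impI)
  have "complete (UNIV :: 'b set)"
    by (meson Cauchy_convergent UNIV_I complete_def convergent_def)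
  then show "complete (closure (C ` cball 0 1))"
    using complete_Int_closed [of UNIV "closure (C ` cball 0 1)"] by simp
  fix \<epsilon> :: real assume "\<epsilon> > 0"
  then have \<epsilon>: "\<epsilon> / 4 > 0" by simp
  obtain E :: "'a set" where E: "orthonormal_basis UNIV E"
    using ex_orthonormal_basis [OF complex_vector.subspace_UNIV] by blast
  obtain F where F: "finite F" "F \<subseteq> E"
    "\<And>v. norm v \<le> 1 \<Longrightarrow> norm (C (v - orth_proj F v)) < \<epsilon> / 4"
    using hs_tail_small [OF C fin E \<epsilon>] by blast
  obtain K where K: "compact K"
    "\<And>c. (\<forall>e\<in>F. cmod (c e) \<le> 1) \<Longrightarrow> (\<Sum>e\<in>F. c e *\<^sub>C C e) \<in> K"
    using bounded_combinations_in_compact [OF F(1), of C] by blast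
  obtain k where k: "finite k" "K \<subseteq> (\<Union>x\<in>k. ball x (\<epsilon> / 4))"
    using K(1) \<epsilon> unfolding compact_eq_totally_bounded by blast
  have "C ` cball 0 1 \<subseteq> (\<Union>x\<in>k. cball x (\<epsilon> / 2))"
  proof
    fix y assume "y \<in> C ` cball 0 1"
    then obtain v where v: "norm v \<le> 1" "y = C v" by auto
    have "cmod (cinner v e) \<le> 1" if "e \<in> F" for e
    proof -
      have "norm e = 1"
        using E F(2) that by (auto simp: orthonormal_basis_def intro: orthonormal_norm)
      then show ?thesis
        using cmod_cinner_le [of v e] v(1) by simp
    qed
    then have "(\<Sum>e\<in>F. cinner v e *\<^sub>C C e) \<in> K"
      by (intro K(2)) blast
    then obtain x where x: "x \<in> k" "dist x (\<Sum>e\<in>F. cinner v e *\<^sub>C C e) < \<epsilon> / 4"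
      using k(2) by auto
    have "(\<Sum>e\<in>F. cinner v e *\<^sub>C C e) = C (orth_proj F v)"
      by (simp add: finite_orth_proj [OF F(1)] bounded_clinear_sum [OF C] bounded_clinear_scaleC [OF C])
    then have "dist y (\<Sum>e\<in>F. cinner v e *\<^sub>C C e) < \<epsilon> / 4"
      using F(3) [OF v(1)] by (simp add: dist_norm v(2) bounded_clinear_diff [OF C])
    then have "dist x y \<le> \<epsilon> / 2"
      using x(2) dist_triangle2 [of x y "\<Sum>e\<in>F. cinner v e *\<^sub>C C e"] by simp
    then show "y \<in> (\<Union>x\<in>k. cball x (\<epsilon> / 2))"
      using x(1) by auto
  qed
  then have "closure (C ` cball 0 1) \<subseteq> (\<Union>x\<in>k. cball x (\<epsilon> / 2))"
    using k(1) by (intro closure_minimal closed_UN) auto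
  also have "\<dots> \<subseteq> (\<Union>x\<in>k. ball x \<epsilon>)"
    using \<open>\<epsilon> > 0\<close> by fastforce
  finally show "\<exists>k. finite k \<and> closure (C ` cball 0 1) \<subseteq> (\<Union>x\<in>k. ball x \<epsilon>)"
    using k(1) by blast
qed

text \<open>A symmetric compact operator attains its norm \<open>m\<close> on the unit sphere of an invariant
  subspace: for a maximising sequence \<open>v\<close> the vectors \<open>C\<^sup>2 v - m\<^sup>2 v\<close> tend to \<open>0\<close>, and compactness
  makes \<open>C\<^sup>2 v\<close>, hence \<open>v\<close>, converge along a subsequence. The limit satisfies \<open>C\<^sup>2 w = m\<^sup>2 w\<close>, and
  either \<open>w\<close> or \<open>C w + m w\<close> is an eigenvector.\<close>

lemma ex_eigenvector:
  fixes C :: "'a::chilbert_space \<Rightarrow> 'a"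
  assumes C: "bounded_clinear C" and fin: "hs C < \<infinity>"
    and sym: "\<And>x y. cinner (C x) y = cinner x (C y)"
    and M: "csubspace M" "closed M" and inv: "\<And>x. x \<in> M \<Longrightarrow> C x \<in> M"
    and nz: "z \<in> M" "z \<noteq> 0"
  shows "\<exists>e\<in>M. norm e = 1 \<and> (\<exists>\<mu>::real. C e = \<mu> *\<^sub>R e)"
proof -
  have normalise: ?thesis if u: "u \<in> M" "u \<noteq> 0" "C u = \<mu> *\<^sub>R u" for u and \<mu> :: real
  proof (intro bexI conjI exI)
    show "C (inverse (norm u) *\<^sub>R u) = \<mu> *\<^sub>R inverse (norm u) *\<^sub>R u"
      using bounded_clinear_scaleC [OF C, of "complex_of_real (inverse (norm u))" u] u(3)
      by (simp only: scaleC_of_real scaleR_left_commute)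
  qed (use u M(1) in \<open>simp_all add: csubspace_scaleR\<close>)
  define m where "m = (SUP v\<in>{v \<in> M. norm v = 1}. norm (C v))"
  let ?z = "inverse (norm z) *\<^sub>R z"
  have z: "?z \<in> M" "norm ?z = 1"
    using nz M(1) by (simp_all add: csubspace_scaleR)
  obtain B where B: "B \<ge> 0" "\<And>x. norm (C x) \<le> B * norm x"
    using bounded_clinear_bound [OF C] by blast
  have bdd: "bdd_above ((\<lambda>v. norm (C v)) ` {v \<in> M. norm v = 1})"
    using B(2) by (intro bdd_aboveI [where M = B]) (auto, metis mult.right_neutral)
  have unit_le: "norm (C v) \<le> m" if "v \<in> M" "norm v = 1" for v
    unfolding m_def using that by (intro cSUP_upper bdd) auto
  have m0: "m \<ge> 0"
    using unit_le [OF z] norm_ge_zero order_trans by blast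
  have le: "norm (C v) \<le> m * norm v" if v: "v \<in> M" for v
  proof (cases "v = 0")
    case False
    have "C (inverse (norm v) *\<^sub>R v) = inverse (norm v) *\<^sub>R C v"
      by (metis bounded_clinear_scaleC [OF C] scaleC_of_real)
    then have "inverse (norm v) * norm (C v) \<le> m"
      using unit_le [of "inverse (norm v) *\<^sub>R v"] False v M(1) by (simp add: csubspace_scaleR)
    then show ?thesis
      using False by (simp add: field_simps)
  qed (simp add: bounded_clinear_zero [OF C])
  show ?thesis
  proof (cases "m = 0")
    case True
    then have "C ?z = 0 *\<^sub>R ?z"
      using le [OF z(1)] by simp
    then show ?thesis
      using z by blast
  next
    case False
    with m0 have "m > 0" by simp
    have "\<exists>v. v \<in> M \<and> norm v = 1 \<and> m - 1 / real (Suc n) < norm (C v)" for n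
    proof -
      have "m - 1 / real (Suc n) < m" by simp
      then have "\<exists>v\<in>{v \<in> M. norm v = 1}. m - 1 / real (Suc n) < norm (C v)"
        unfolding m_def using z by (subst (asm) less_cSUP_iff [OF _ bdd]) auto
      then show ?thesis by blast
    qed
    then obtain v where v: "\<And>n. v n \<in> M" "\<And>n. norm (v n) = 1"
      "\<And>n. m - 1 / real (Suc n) < norm (C (v n))"
      by metis
    have lim_m: "(\<lambda>n. norm (C (v n))) \<longlonglongrightarrow> m"
    proof (rule tendsto_sandwich)
      show "(\<lambda>n. m - 1 / real (Suc n)) \<longlonglongrightarrow> m"
        using tendsto_diff [OF tendsto_const LIMSEQ_inverse_real_of_nat, of m]
        by (simp add: inverse_eq_divide)
      show "\<forall>\<^sub>F n in sequentially. m - 1 / real (Suc n) \<le> norm (C (v n))"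
        using v(3) by (intro always_eventually allI less_imp_le)
      show "\<forall>\<^sub>F n in sequentially. norm (C (v n)) \<le> m"
        by (intro always_eventually allI unit_le v)
    qed simp
    have "\<forall>n. C (v n) \<in> closure (C ` cball 0 1)"
      by (intro allI closure_subset [THEN subsetD] imageI) (simp add: v(2))
    then obtain y r where r: "strict_mono r" and y: "((\<lambda>n. C (v n)) \<circ> r) \<longlonglongrightarrow> y"
      using hs_compact [OF C fin] unfolding compact_def by meson
    define w where "w n = v (r n)" for n
    have w: "w n \<in> M" "norm (w n) = 1" for n
      using v by (simp_all add: w_def)
    have Cw: "(\<lambda>n. C (w n)) \<longlonglongrightarrow> y"
      using y by (simp add: w_def o_def)
    have Cw_norm: "(\<lambda>n. norm (C (w n))) \<longlonglongrightarrow> m"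
      using LIMSEQ_subseq_LIMSEQ [OF lim_m r] by (simp add: w_def o_def)
    have CCw: "(\<lambda>n. C (C (w n))) \<longlonglongrightarrow> C y"
      by (rule bounded_linear.tendsto [OF bounded_clinear_bounded_linear [OF C] Cw])
    define d where "d n = C (C (w n)) - m\<^sup>2 *\<^sub>R w n" for n
    have d_le: "(norm (d n))\<^sup>2 \<le> 2 * m ^ 4 - 2 * m\<^sup>2 * (norm (C (w n)))\<^sup>2" for n
    proof -
      have "norm (C (C (w n))) \<le> m * (m * 1)"
        by (rule order_trans [OF le [OF inv [OF w(1)]]]) (use unit_le [OF w] m0 in \<open>simp add: mult_left_mono\<close>)
      then have "(norm (C (C (w n))))\<^sup>2 \<le> (m * (m * 1))\<^sup>2"
        by (intro power_mono) auto
      then have "(norm (C (C (w n))))\<^sup>2 \<le> m ^ 4"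
        by (simp add: power2_eq_square power4_eq_xxxx mult.assoc)
      moreover have "Re (cinner (C (C (w n))) (m\<^sup>2 *\<^sub>R w n)) = m\<^sup>2 * (norm (C (w n)))\<^sup>2"
        unfolding cinner_scaleR_right sym [of "C (w n)"] cinner_self by simp
      moreover have "(norm (m\<^sup>2 *\<^sub>R w n))\<^sup>2 = m ^ 4"
        by (simp add: w(2))
      ultimately show ?thesis
        unfolding d_def norm_diff_square by linarith
    qed
    have "(\<lambda>n. 2 * m ^ 4 - 2 * m\<^sup>2 * (norm (C (w n)))\<^sup>2) \<longlonglongrightarrow> 2 * m ^ 4 - 2 * m\<^sup>2 * m\<^sup>2"
      by (intro tendsto_intros Cw_norm)
    then have "(\<lambda>n. 2 * m ^ 4 - 2 * m\<^sup>2 * (norm (C (w n)))\<^sup>2) \<longlonglongrightarrow> 0"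
      by (simp add: power2_eq_square power4_eq_xxxx)
    then have "(\<lambda>n. (norm (d n))\<^sup>2) \<longlonglongrightarrow> 0"
      by (rule tendsto_sandwich [rotated 3, OF _ , where f = "\<lambda>_. 0"])
         (use d_le in \<open>auto intro!: always_eventually\<close>)
    then have "(\<lambda>n. norm (d n)) \<longlonglongrightarrow> 0"
      by (drule_tac tendsto_real_sqrt) simp
    then have d: "d \<longlonglongrightarrow> 0"
      by (rule tendsto_norm_zero_cancel)
    define u where "u = inverse (m\<^sup>2) *\<^sub>R C y"
    have "(\<lambda>n. inverse (m\<^sup>2) *\<^sub>R (C (C (w n)) - d n)) \<longlonglongrightarrow> inverse (m\<^sup>2) *\<^sub>R (C y - 0)"
      by (intro tendsto_intros CCw d)
    moreover have "inverse (m\<^sup>2) *\<^sub>R (C (C (w n)) - d n) = w n" for n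
      using False by (simp add: d_def)
    ultimately have wu: "w \<longlonglongrightarrow> u"
      by (simp add: u_def)
    have uM: "u \<in> M"
      using M(2) w(1) wu by (metis closed_sequentially)
    have "(\<lambda>n. norm (w n)) \<longlonglongrightarrow> norm u"
      by (intro tendsto_norm wu)
    then have u1: "norm u = 1"
      using w(2) by (simp add: LIMSEQ_const_iff)
    have "(\<lambda>n. C (w n)) \<longlonglongrightarrow> C u"
      by (rule bounded_linear.tendsto [OF bounded_clinear_bounded_linear [OF C] wu])
    then have "y = C u"
      using Cw LIMSEQ_unique by blast
    then have CCu: "C (C u) = m\<^sup>2 *\<^sub>R u"
      using False by (simp add: u_def)
    show ?thesis
    proof (cases "C u + m *\<^sub>R u = 0")
      case True
      then have "C u = (- m) *\<^sub>R u"
        by (simp add: eq_neg_iff_add_eq_0)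
      then show ?thesis
        using uM u1 by blast
    next
      case nonzero: False
      have "C (m *\<^sub>R u) = m *\<^sub>R C u"
        by (metis bounded_clinear_scaleC [OF C] scaleC_of_real)
      then have "C (C u + m *\<^sub>R u) = m *\<^sub>R (C u + m *\<^sub>R u)"
        by (simp add: bounded_clinear_add [OF C] CCu power2_eq_square scaleR_add_right add.commute)
      moreover have "C u + m *\<^sub>R u \<in> M"
        using uM inv M(1) by (simp add: complex_vector.subspace_add csubspace_scaleR)
      ultimately show ?thesis
        using normalise nonzero by blast
    qed
  qed
qed

text \<open>By symmetry, the orthogonal complement of eigenvectors inside \<open>M\<close> is invariant again, so it contains
  a further eigenvector unless it is zero.\<close>

theorem spectral_theorem:
  fixes C :: "'a::chilbert_space \<Rightarrow> 'a"
  assumes C: "bounded_clinear C" and fin: "hs C < \<infinity>"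
    and sym: "\<And>x y. cinner (C x) y = cinner x (C y)"
    and M: "csubspace M" "closed M" and inv: "\<And>x. x \<in> M \<Longrightarrow> C x \<in> M"
  shows "\<exists>E. orthonormal_basis M E \<and> (\<forall>e\<in>E. \<exists>\<mu>::real. C e = \<mu> *\<^sub>R e)"
proof (rule orthonormal_basis_exhaustion)
  fix E v
  assume E: "\<forall>e\<in>E. \<exists>\<mu>::real. C e = \<mu> *\<^sub>R e" and v: "v \<in> M" "v \<noteq> 0" "\<forall>e\<in>E. cinner v e = 0"
  define N where "N = {x \<in> M. \<forall>e\<in>E. cinner x e = 0}"
  have "csubspace N"
    using M(1) unfolding complex_vector.subspace_def N_def
    by (auto simp: cinner_add_left cinner_scaleC_left)
  moreover have "closed N"
  proof -
    have "N = M \<inter> (\<Inter>e\<in>E. (\<lambda>x. cinner x e) -` {0})"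
      by (auto simp: N_def)
    moreover have "closed ((\<lambda>x. cinner x e) -` {0})" for e :: 'a
      by (intro closed_vimage closed_singleton linear_continuous_on bounded_linear_cinner_left)
    ultimately show ?thesis
      using M(2) by auto
  qed
  moreover have "C x \<in> N" if x: "x \<in> N" for x
  proof -
    have "cinner (C x) e = 0" if e: "e \<in> E" for e
    proof -
      obtain \<mu> :: real where \<mu>: "C e = \<mu> *\<^sub>R e"
        using bspec [OF E e] by blast
      have "cinner x e = 0"
        using x e by (simp add: N_def)
      then show ?thesis
        unfolding sym \<mu> cinner_scaleR_right by simp
    qed
    then show ?thesis
      using x inv by (simp add: N_def)
  qed
  moreover have "v \<in> N"
    using v by (simp add: N_def)
  ultimately obtain e where "e \<in> N" "norm e = 1" "\<exists>\<mu>::real. C e = \<mu> *\<^sub>R e"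
    using ex_eigenvector [OF C fin sym] v(2) by metis
  then show "\<exists>u\<in>M. norm u = 1 \<and> (\<exists>\<mu>::real. C u = \<mu> *\<^sub>R u) \<and> (\<forall>e\<in>E. cinner u e = 0)"
    by (auto simp: N_def)
qed

section \<open>The index of a pair of projections\<close>

definition orthogonal_projection :: "('a::complex_inner \<Rightarrow> 'a) \<Rightarrow> bool" where
  "orthogonal_projection P \<longleftrightarrow> bounded_clinear P \<and> (\<forall>x. P (P x) = P x) \<and>
     (\<forall>x y. cinner (P x) y = cinner x (P y))"

context
  fixes P :: "'a::chilbert_space \<Rightarrow> 'a"
  assumes P: "orthogonal_projection P"
begin

lemma projection_linear: "bounded_clinear P"
  and projection_idem: "P (P x) = P x"
  and projection_symmetric: "cinner (P x) y = cinner x (P y)"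
  using P by (auto simp: orthogonal_projection_def)

lemma projection_range_iff: "x \<in> range P \<longleftrightarrow> P x = x"
  using projection_idem by (metis rangeE rangeI)

lemma projection_range_ker: "range P = ker (\<lambda>x. x - P x)"
  by (auto simp: ker_def projection_range_iff projection_idem)

lemma csubspace_projection_range: "csubspace (range P)"
  and closed_projection_range: "closed (range P)"
  unfolding projection_range_ker
  by (intro csubspace_ker closed_ker bounded_clinear_diff_op bounded_clinear_ident projection_linear)+

lemma norm_projection_square: "(norm (P x))\<^sup>2 = Re (cinner (P x) x)"
proof -
  have "cinner (P x) (P x) = cinner (P x) x"
    by (metis projection_idem projection_symmetric)
  then show ?thesis
    by (metis Re_complex_of_real cinner_self)
qed

lemma norm_projection_residual: "(norm (x - P x))\<^sup>2 = (norm x)\<^sup>2 - (norm (P x))\<^sup>2"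
  unfolding norm_diff_square
  using norm_projection_square [of x] by (simp add: projection_symmetric [symmetric])

lemma projection_fixes_basis: "orthonormal_basis (range P) E \<Longrightarrow> e \<in> E \<Longrightarrow> P e = e"
  unfolding orthonormal_basis_def using projection_range_iff by blast

lemma projection_orthogonal_ker: "P x = 0 \<Longrightarrow> y \<in> range P \<Longrightarrow> cinner x y = 0"
  by (metis cinner_zero_left projection_range_iff projection_symmetric)

text \<open>Bases of the range and of the kernel together form a basis of the whole space.\<close>

lemma orthonormal_basis_projection_Un:
  assumes E1: "orthonormal_basis (range P) E1" and E2: "orthonormal_basis (ker P) E2"
  shows "orthonormal_basis UNIV (E1 \<union> E2)" and "E1 \<inter> E2 = {}"
proof -
  have cross: "cinner b a = 0" "cinner a b = 0" if "a \<in> E1" "b \<in> E2" for a b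
    using that assms projection_orthogonal_ker [of b a]
    by (auto simp: orthonormal_basis_def ker_def cinner_eq_0_commute [of a b])
  have norm1: "cinner a a = 1" if "a \<in> E1" for a
    using that E1 by (auto simp: orthonormal_basis_def orthonormal_def)
  show disj: "E1 \<inter> E2 = {}"
    using cross norm1 by fastforce
  have on: "orthonormal E1" "orthonormal E2"
    using E1 E2 by (simp_all add: orthonormal_basis_def)
  have "orthonormal (E1 \<union> E2)"
    unfolding orthonormal_def
  proof (intro ballI)
    fix x y assume "x \<in> E1 \<union> E2" "y \<in> E1 \<union> E2"
    then consider "x \<in> E1 \<and> y \<in> E1 \<or> x \<in> E2 \<and> y \<in> E2" | "x \<in> E1" "y \<in> E2" | "x \<in> E2" "y \<in> E1"
      by blast
    then show "cinner x y = (if x = y then 1 else 0)"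
    proof cases
      case 1
      then show ?thesis
        using on by (auto simp: orthonormal_def)
    next
      case 2
      then show ?thesis
        using cross disj by auto
    next
      case 3
      then show ?thesis
        using cross disj by auto
    qed
  qed
  moreover have "v = 0" if v: "\<forall>e\<in>E1 \<union> E2. cinner v e = 0" for v
  proof -
    have "cinner (P v) e = 0" if "e \<in> E1" for e
    proof -
      have "P e = e"
        by (rule projection_fixes_basis [OF E1 that])
      then show ?thesis
        using that v by (simp add: projection_symmetric)
    qed
    then have "P v = 0"
      using E1 by (auto simp: orthonormal_basis_def)
    then have "v \<in> ker P"
      by (simp add: ker_def)
    then show ?thesis
      using E2 v unfolding orthonormal_basis_def by blast
  qed
  ultimately show "orthonormal_basis UNIV (E1 \<union> E2)"
    by (simp add: orthonormal_basis_def)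
qed

lemma hs_projection:
  fixes T :: "'a \<Rightarrow> 'b::chilbert_space"
  assumes T: "bounded_clinear T" and E1: "orthonormal_basis (range P) E1"
  shows "hs (\<lambda>x. T (P x)) = (\<integral>\<^sup>+e. ennreal ((norm (T e))\<^sup>2) \<partial>count_space E1)"
proof -
  obtain E2 where E2: "orthonormal_basis (ker P) E2"
    using ex_orthonormal_basis [OF csubspace_ker [OF projection_linear]] by blast
  have "hs (\<lambda>x. T (P x)) = (\<integral>\<^sup>+e. ennreal ((norm (T (P e)))\<^sup>2) \<partial>count_space (E1 \<union> E2))"
    by (rule hs_eq [OF bounded_clinear_comp [OF T projection_linear]
          orthonormal_basis_projection_Un(1) [OF E1 E2]])
  also have "\<dots> = (\<integral>\<^sup>+e. ennreal ((norm (T (P e)))\<^sup>2) \<partial>count_space E1) +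
      (\<integral>\<^sup>+e. ennreal ((norm (T (P e)))\<^sup>2) \<partial>count_space E2)"
    by (rule nn_integral_count_space_Un [OF orthonormal_basis_projection_Un(2) [OF E1 E2]])
  also have "(\<integral>\<^sup>+e. ennreal ((norm (T (P e)))\<^sup>2) \<partial>count_space E2) = (\<integral>\<^sup>+e. 0 \<partial>count_space E2)"
    using E2 by (intro nn_integral_cong)
      (auto simp: orthonormal_basis_def ker_def bounded_clinear_zero [OF T])
  also have "(\<integral>\<^sup>+e. ennreal ((norm (T (P e)))\<^sup>2) \<partial>count_space E1) =
      (\<integral>\<^sup>+e. ennreal ((norm (T e))\<^sup>2) \<partial>count_space E1)"
    by (intro nn_integral_cong) (simp add: projection_fixes_basis [OF E1])
  finally show ?thesis by simp
qed

end

lemma cdim_eq_card_orthonormal_basis: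
  fixes N :: "'a::complex_inner set"
  assumes "csubspace N" "orthonormal_basis N G" "finite G"
  shows "cdim N = card G"
proof (rule complex_vector.dim_unique [OF _ _ _ refl])
  have G: "G \<subseteq> N" "orthonormal G"
    using assms(2) by (auto simp: orthonormal_basis_def)
  show "G \<subseteq> N" by (rule G)
  show "N \<subseteq> cspan G"
  proof
    fix v assume v: "v \<in> N"
    let ?p = "\<Sum>g\<in>G. cinner v g *\<^sub>C g"
    have "v - ?p \<in> N"
      using v G(1) assms(1)
      by (intro complex_vector.subspace_diff complex_vector.subspace_sum
          complex_vector.subspace_scale) auto
    moreover have "cinner (v - ?p) g = 0" if "g \<in> G" for g
      using cinner_orthonormal_sum [OF G(2) assms(3) subset_refl that] that
      by (simp add: cinner_diff_left)
    ultimately have "v - ?p = 0"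
      using assms(2) unfolding orthonormal_basis_def by blast
    moreover have "?p \<in> cspan G"
      by (intro complex_vector.span_sum complex_vector.span_scale complex_vector.span_base)
    ultimately show "v \<in> cspan G" by simp
  qed
  show "complex_vector.independent G"
  proof (rule complex_vector.independent_if_scalars_zero [OF assms(3)])
    fix c x assume "(\<Sum>g\<in>G. c g *\<^sub>C g) = 0" "x \<in> G"
    then show "c x = 0"
      using cinner_orthonormal_sum [OF G(2) assms(3) subset_refl, of x c] by simp
  qed
qed

text \<open>Finiteness of the sum forces \<open>G\<close> to be finite. This is what keeps \<^const>\<open>cdim\<close> away from its
  default value \<open>0\<close> on infinite dimensional spaces.\<close>

lemma nn_integral_orthonormal_basis_cdim:
  fixes N :: "'a::complex_inner set"
  assumes "csubspace N" "orthonormal_basis N G" "\<And>g. g \<in> G \<Longrightarrow> f g = 1"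
    and "(\<integral>\<^sup>+g. f g \<partial>count_space G) < \<infinity>"
  shows "(\<integral>\<^sup>+g. f g \<partial>count_space G) = of_nat (cdim N)"
proof -
  have eq: "(\<integral>\<^sup>+g. f g \<partial>count_space G) = emeasure (count_space G) G"
    using nn_integral_cong [of "count_space G" f "\<lambda>_. 1"] assms(3) by simp
  then have "finite G"
    using assms(4) by (cases "finite G") (auto simp: emeasure_count_space)
  then show ?thesis
    using cdim_eq_card_orthonormal_basis [OF assms(1,2)] eq by (simp add: emeasure_count_space)
qed

text \<open>Write \<open>P\<^sup>\<bottom> = 1 - P\<close> and \<open>Q\<^sup>\<bottom> = 1 - Q\<close>. The trace of \<open>P Q\<^sup>\<bottom> P\<close> and that of \<open>Q P\<^sup>\<bottom> Q\<close> differ exactly by the dimensions that define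
  the index. Diagonalise \<open>P Q\<^sup>\<bottom> P\<close> on the range of \<open>P\<close> with eigenvectors \<open>e\<close> and eigenvalues \<open>\<mu>\<close>.
  If \<open>Q e \<noteq> 0\<close>, then the normalised \<open>Q e\<close> is an eigenvector of \<open>Q P\<^sup>\<bottom> Q\<close> for the same \<open>\<mu>\<close>; these
  vectors exhaust the range of \<open>Q\<close> up to its part in the kernel of \<open>P\<close>, where the eigenvalue
  is \<open>1\<close>. The remaining \<open>e\<close> have \<open>Q e = 0\<close> and eigenvalue \<open>1\<close> as well.\<close>

theorem projection_pair_trace_identity:
  fixes P Q :: "'a::chilbert_space \<Rightarrow> 'a"
  assumes P: "orthogonal_projection P" and Q: "orthogonal_projection Q"
    and finP: "hs (\<lambda>x. P x - Q (P x)) < \<infinity>" and finQ: "hs (\<lambda>x. Q x - P (Q x)) < \<infinity>"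
  shows "hs (\<lambda>x. P x - Q (P x)) + of_nat (cdim (range Q \<inter> ker P)) =
    hs (\<lambda>x. Q x - P (Q x)) + of_nat (cdim (ker Q \<inter> range P))"
proof -
  note linP = projection_linear [OF P] and linQ = projection_linear [OF Q]
  have QPd: "bounded_clinear (\<lambda>x. x - Q x)" and PQd: "bounded_clinear (\<lambda>x. x - P x)"
    by (intro bounded_clinear_diff_op bounded_clinear_ident linP linQ)+
  define C where "C x = P (P x - Q (P x))" for x
  have C: "bounded_clinear C"
    unfolding C_def
    by (rule bounded_clinear_comp [OF linP bounded_clinear_comp [OF QPd linP]])
  have "hs C < \<infinity>"
    unfolding C_def by (rule hs_finite_left [OF linP finP])
  moreover have "cinner (C x) y = cinner x (C y)" for x y
    by (simp add: C_def projection_symmetric [OF P] projection_symmetric [OF Q] cinner_diff_left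
        cinner_diff_right bounded_clinear_diff [OF linP] projection_idem [OF P])
  moreover have "C x \<in> range P" for x
    by (simp add: C_def)
  ultimately obtain E where E: "orthonormal_basis (range P) E"
    and eig: "\<forall>e\<in>E. \<exists>\<mu>::real. C e = \<mu> *\<^sub>R e"
    using spectral_theorem [OF C _ _ csubspace_projection_range [OF P] closed_projection_range [OF P]]
    by meson
  then obtain \<mu> :: "'a \<Rightarrow> real" where \<mu>: "\<And>e. e \<in> E \<Longrightarrow> C e = \<mu> e *\<^sub>R e"
    by metis
  have onE: "orthonormal E" and EP: "\<And>e. e \<in> E \<Longrightarrow> P e = e"
    using E projection_fixes_basis [OF P E] by (auto simp: orthonormal_basis_def)
  have PQ: "P (Q e) = (1 - \<mu> e) *\<^sub>R e" if "e \<in> E" for e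
    using \<mu> [OF that] EP [OF that]
    by (simp add: C_def bounded_clinear_diff [OF linP] algebra_simps)
  have QQ: "cinner (Q e) (Q e') = complex_of_real (1 - \<mu> e) * (if e = e' then 1 else 0)"
    if "e \<in> E" "e' \<in> E" for e e'
  proof -
    have "cinner (Q e) (Q e') = cinner (Q e) e'"
      by (metis projection_idem [OF Q] projection_symmetric [OF Q])
    also have "\<dots> = cinner (P (Q e)) e'"
      using EP [OF that(2)] by (metis projection_symmetric [OF P])
    finally show ?thesis
      using onE that unfolding PQ [OF that(1)] cinner_scaleR_left orthonormal_def by simp
  qed
  have normQ: "(norm (Q e))\<^sup>2 = 1 - \<mu> e" if "e \<in> E" for e
  proof -
    have "complex_of_real ((norm (Q e))\<^sup>2) = complex_of_real (1 - \<mu> e)"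
      using QQ [OF that that] by (simp only: cinner_self [symmetric]) simp
    then show ?thesis
      unfolding of_real_eq_iff .
  qed
  have norm_residual: "(norm (e - Q e))\<^sup>2 = \<mu> e" if "e \<in> E" for e
    using norm_projection_residual [OF Q, of e] normQ [OF that] orthonormal_norm [OF onE that]
    by simp
  define E0 where "E0 = {e \<in> E. Q e = 0}"
  define E1 where "E1 = {e \<in> E. Q e \<noteq> 0}"
  have split: "E = E0 \<union> E1" "E0 \<inter> E1 = {}"
    by (auto simp: E0_def E1_def)
  define \<phi> where "\<phi> e = inverse (norm (Q e)) *\<^sub>R Q e" for e
  have \<phi>: "cinner (\<phi> e) (\<phi> e') = (if e = e' then 1 else 0)" if "e \<in> E1" "e' \<in> E1" for e e'
  proof -
    have "Q e \<noteq> 0" "e \<in> E" "e' \<in> E"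
      using that by (auto simp: E1_def)
    then show ?thesis
      by (cases "e = e'") (simp_all add: \<phi>_def cinner_self cinner_scaleR_left cinner_scaleR_right QQ)
  qed
  have Q\<phi>: "Q (\<phi> e) = \<phi> e" for e
    by (metis \<phi>_def bounded_clinear_scaleC [OF linQ] projection_idem [OF Q] scaleC_of_real)
  have norm_\<phi>: "(norm (\<phi> e - P (\<phi> e)))\<^sup>2 = \<mu> e" if "e \<in> E1" for e
  proof -
    have e: "Q e \<noteq> 0" "e \<in> E"
      using that by (auto simp: E1_def)
    have nz: "1 - \<mu> e \<noteq> 0"
      using normQ [OF e(2)] e(1) by auto
    have "P (\<phi> e) = inverse (norm (Q e)) *\<^sub>R (1 - \<mu> e) *\<^sub>R e"
      unfolding PQ [OF e(2), symmetric]
      by (metis \<phi>_def bounded_clinear_scaleC [OF linP] scaleC_of_real)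
    then have "(norm (P (\<phi> e)))\<^sup>2 = inverse ((norm (Q e))\<^sup>2) * (1 - \<mu> e)\<^sup>2"
      using orthonormal_norm [OF onE e(2)]
      by (simp add: power_mult_distrib power_inverse)
    then have "(norm (P (\<phi> e)))\<^sup>2 = 1 - \<mu> e"
      using nz unfolding normQ [OF e(2)] by (simp add: power2_eq_square)
    moreover have "(norm (\<phi> e))\<^sup>2 = 1"
      using e(1) by (simp add: \<phi>_def)
    ultimately show ?thesis
      using norm_projection_residual [OF P, of "\<phi> e"] by simp
  qed

  \<comment> \<open>The vectors \<open>e\<close> killed by \<open>Q\<close> span the kernel of \<open>Q P\<close> on the range of \<open>P\<close>.\<close>
  have subP: "csubspace (ker Q \<inter> range P)"
    by (intro complex_vector.subspace_inter csubspace_ker linQ csubspace_projection_range P)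
  have E0: "orthonormal_basis (ker Q \<inter> range P) E0"
    unfolding orthonormal_basis_def
  proof (intro conjI ballI impI)
    show "E0 \<subseteq> ker Q \<inter> range P"
      using E by (auto simp: E0_def ker_def orthonormal_basis_def)
    show "orthonormal E0"
      using onE by (rule orthonormal_subset) (auto simp: E0_def)
    fix v assume v: "v \<in> ker Q \<inter> range P" "\<forall>e\<in>E0. cinner v e = 0"
    have "cinner v e = 0" if e: "e \<in> E" for e
    proof (cases "Q e = 0")
      case True
      then show ?thesis
        using v(2) e by (simp add: E0_def)
    next
      case False
      have "cinner v (P (Q e)) = cinner (Q (P v)) e"
        by (simp add: projection_symmetric [OF P] projection_symmetric [OF Q])
      also have "\<dots> = 0"
        using v(1) by (auto simp: projection_range_iff [OF P] ker_def)
      finally have "complex_of_real (1 - \<mu> e) * cinner v e = 0"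
        by (simp only: PQ [OF e] cinner_scaleR_right)
      then show ?thesis
        using normQ [OF e] False by auto
    qed
    then show "v = 0"
      using v(1) E unfolding orthonormal_basis_def by blast
  qed
  have "(\<integral>\<^sup>+e. ennreal ((norm (e - Q e))\<^sup>2) \<partial>count_space E) = hs (\<lambda>x. P x - Q (P x))"
    by (rule hs_projection [OF P QPd E, symmetric])
  then have hsP: "hs (\<lambda>x. P x - Q (P x)) = (\<integral>\<^sup>+e. ennreal ((norm (e - Q e))\<^sup>2) \<partial>count_space E0) +
      (\<integral>\<^sup>+e. ennreal ((norm (e - Q e))\<^sup>2) \<partial>count_space E1)"
    unfolding split(1) using nn_integral_count_space_Un [OF split(2)] by simp
  have hsP0: "(\<integral>\<^sup>+e. ennreal ((norm (e - Q e))\<^sup>2) \<partial>count_space E0) = of_nat (cdim (ker Q \<inter> range P))"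
  proof (rule nn_integral_orthonormal_basis_cdim [OF subP E0])
    show "ennreal ((norm (e - Q e))\<^sup>2) = 1" if "e \<in> E0" for e
      using that orthonormal_norm [OF onE] by (simp add: E0_def)
    show "(\<integral>\<^sup>+e. ennreal ((norm (e - Q e))\<^sup>2) \<partial>count_space E0) < \<infinity>"
      using finP unfolding hsP by simp
  qed
  have hsP1: "(\<integral>\<^sup>+e. ennreal ((norm (e - Q e))\<^sup>2) \<partial>count_space E1) =
      (\<integral>\<^sup>+e. ennreal (\<mu> e) \<partial>count_space E1)"
    using norm_residual by (intro nn_integral_cong) (simp add: E1_def)

  have subQ: "csubspace (range Q \<inter> ker P)"
    by (intro complex_vector.subspace_inter csubspace_ker linP csubspace_projection_range Q)
  obtain G where G: "orthonormal_basis (range Q \<inter> ker P) G"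
    using ex_orthonormal_basis [OF subQ] by blast
  have onG: "orthonormal G" and GQ: "\<And>g. g \<in> G \<Longrightarrow> Q g = g" and GP: "\<And>g. g \<in> G \<Longrightarrow> P g = 0"
    using G unfolding orthonormal_basis_def ker_def by (blast, metis Int_iff projection_range_iff [OF Q] subsetD, blast)
  have cross: "cinner g (\<phi> e) = 0" if "g \<in> G" "e \<in> E1" for g e
  proof -
    have "cinner g (Q e) = cinner g (P e)"
      using GQ [OF that(1)] EP that(2) by (simp add: E1_def projection_symmetric [OF Q, symmetric])
    also have "\<dots> = 0"
      using GP [OF that(1)] by (simp add: projection_symmetric [OF P, symmetric])
    finally show ?thesis
      by (simp add: \<phi>_def cinner_scaleR_right)
  qed
  have disj: "G \<inter> \<phi> ` E1 = {}"
    using cross \<phi> by fastforce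
  have inj: "inj_on \<phi> E1"
  proof (rule inj_onI)
    fix e e' assume "e \<in> E1" "e' \<in> E1" "\<phi> e = \<phi> e'"
    then show "e = e'"
      using \<phi> [of e e] \<phi> [of e e'] by (simp split: if_splits)
  qed
  have B: "orthonormal_basis (range Q) (G \<union> \<phi> ` E1)"
    unfolding orthonormal_basis_def
  proof (intro conjI ballI impI)
    show "G \<union> \<phi> ` E1 \<subseteq> range Q"
      using GQ Q\<phi> by (auto simp: projection_range_iff [OF Q])
    show "orthonormal (G \<union> \<phi> ` E1)"
      unfolding orthonormal_def
    proof (intro ballI)
      fix x y assume "x \<in> G \<union> \<phi> ` E1" "y \<in> G \<union> \<phi> ` E1"
      then consider "x \<in> G" "y \<in> G" | e where "x \<in> G" "e \<in> E1" "y = \<phi> e"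
        | e where "y \<in> G" "e \<in> E1" "x = \<phi> e" | e e' where "e \<in> E1" "e' \<in> E1" "x = \<phi> e" "y = \<phi> e'"
        by blast
      then show "cinner x y = (if x = y then 1 else 0)"
      proof cases
        case 1
        then show ?thesis
          using onG by (simp add: orthonormal_def)
      next
        case 2
        then show ?thesis
          using disj cross by auto
      next
        case 3
        then have "cinner y x = 0"
          using cross by simp
        then have "cinner x y = 0"
          by (simp add: cinner_eq_0_commute [of x y])
        then show ?thesis
          using 3 disj by auto
      next
        case 4
        then show ?thesis
          using \<phi> inj_onD [OF inj] by auto
      qed
    qed
    fix v assume v: "v \<in> range Q" "\<forall>b\<in>G \<union> \<phi> ` E1. cinner v b = 0"
    have "cinner (P v) e = 0" if e: "e \<in> E" for e
    proof -
      have "cinner v (Q e) = 0"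
      proof (cases "Q e = 0")
        case False
        then have "cinner v (\<phi> e) = 0"
          using v(2) e by (auto simp: E1_def)
        then show ?thesis
          using False by (simp add: \<phi>_def cinner_scaleR_right)
      qed simp
      then have "cinner v e = 0"
        using v(1) by (metis projection_range_iff [OF Q] projection_symmetric [OF Q])
      then show ?thesis
        using EP [OF e] by (simp add: projection_symmetric [OF P])
    qed
    then have "P v = 0"
      using E by (auto simp: orthonormal_basis_def)
    then have "v \<in> range Q \<inter> ker P"
      using v(1) by (simp add: ker_def)
    then show "v = 0"
      using G v(2) unfolding orthonormal_basis_def by blast
  qed
  have "(\<integral>\<^sup>+b. ennreal ((norm (b - P b))\<^sup>2) \<partial>count_space (G \<union> \<phi> ` E1)) = hs (\<lambda>x. Q x - P (Q x))"
    by (rule hs_projection [OF Q PQd B, symmetric])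
  then have hsQ: "hs (\<lambda>x. Q x - P (Q x)) = (\<integral>\<^sup>+b. ennreal ((norm (b - P b))\<^sup>2) \<partial>count_space G) +
      (\<integral>\<^sup>+b. ennreal ((norm (b - P b))\<^sup>2) \<partial>count_space (\<phi> ` E1))"
    using nn_integral_count_space_Un [OF disj] by simp
  have hsQ0: "(\<integral>\<^sup>+b. ennreal ((norm (b - P b))\<^sup>2) \<partial>count_space G) = of_nat (cdim (range Q \<inter> ker P))"
  proof (rule nn_integral_orthonormal_basis_cdim [OF subQ G])
    show "ennreal ((norm (b - P b))\<^sup>2) = 1" if "b \<in> G" for b
      using that orthonormal_norm [OF onG] GP by simp
    show "(\<integral>\<^sup>+b. ennreal ((norm (b - P b))\<^sup>2) \<partial>count_space G) < \<infinity>"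
      using finQ unfolding hsQ by simp
  qed
  have "(\<integral>\<^sup>+b. ennreal ((norm (b - P b))\<^sup>2) \<partial>count_space (\<phi> ` E1)) =
      (\<integral>\<^sup>+e. ennreal ((norm (\<phi> e - P (\<phi> e)))\<^sup>2) \<partial>count_space E1)"
    by (rule nn_integral_bij_count_space [OF inj_on_imp_bij_betw [OF inj], symmetric])
  also have "\<dots> = (\<integral>\<^sup>+e. ennreal (\<mu> e) \<partial>count_space E1)"
    using norm_\<phi> by (intro nn_integral_cong) simp
  finally show ?thesis
    unfolding hsP hsQ hsP0 hsQ0 hsP1 by (simp add: ac_simps)
qed

section \<open>Operators determined on a basis\<close>

lemma bounded_clinear_eqI:
  fixes S T :: "'a::chilbert_space \<Rightarrow> 'b::chilbert_space"
  assumes S: "bounded_clinear S" and T: "bounded_clinear T" and E: "orthonormal_basis UNIV E"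
    and eq: "\<And>e. e \<in> E \<Longrightarrow> S e = T e"
  shows "S = T"
proof
  fix v
  have on: "orthonormal E"
    using E by (simp add: orthonormal_basis_def)
  have v: "((\<lambda>e. cinner v e *\<^sub>C e) has_sum v) E"
    using has_sum_orth_proj [OF on, of v] orth_proj_fixes [OF complex_vector.subspace_UNIV _ E]
    by simp
  have "((\<lambda>e. S (cinner v e *\<^sub>C e)) has_sum S v) E"
    by (rule has_sum_bounded_linear [OF bounded_clinear_bounded_linear [OF S] v])
  moreover have "((\<lambda>e. T (cinner v e *\<^sub>C e)) has_sum T v) E"
    by (rule has_sum_bounded_linear [OF bounded_clinear_bounded_linear [OF T] v])
  moreover have "((\<lambda>e. S (cinner v e *\<^sub>C e)) has_sum T v) E \<longleftrightarrow>
      ((\<lambda>e. T (cinner v e *\<^sub>C e)) has_sum T v) E"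
    by (rule has_sum_cong) (simp add: bounded_clinear_scaleC [OF S] bounded_clinear_scaleC [OF T] eq)
  ultimately show "S v = T v"
    using has_sum_unique by blast
qed

text \<open>Two instances matter: \<open>E\<close> the standard basis of the sequence space with \<open>g\<close> a frame, and \<open>E\<close> an
  eigenbasis with \<open>g\<close> its normalised image under a synthesis operator.\<close>

lemma ex_combination_operator:
  fixes g :: "'a::chilbert_space \<Rightarrow> 'b::chilbert_space"
  assumes E: "orthonormal E" and B: "B \<ge> 0"
    and bound: "\<And>F c. finite F \<Longrightarrow> F \<subseteq> E \<Longrightarrow>
       (norm (\<Sum>e\<in>F. c e *\<^sub>C g e))\<^sup>2 \<le> B * (\<Sum>e\<in>F. (cmod (c e))\<^sup>2)"
  shows "\<exists>T. bounded_clinear T \<and> (\<forall>v. ((\<lambda>e. cinner v e *\<^sub>C g e) has_sum T v) E) \<and>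
     (\<forall>e\<in>E. T e = g e) \<and> (\<forall>v. (norm (T v))\<^sup>2 \<le> B * (norm v)\<^sup>2)"
proof -
  define T where "T v = (\<Sum>\<^sub>\<infinity>e\<in>E. cinner v e *\<^sub>C g e)" for v
  have T: "((\<lambda>e. cinner v e *\<^sub>C g e) has_sum T v) E" for v
    unfolding T_def
    by (rule has_sum_infsum)
       (rule square_summable_combination(1) [OF B bound summable_on_cinner_square [OF E]])
  have norm: "(norm (T v))\<^sup>2 \<le> B * (norm v)\<^sup>2" for v
  proof -
    have "(\<Sum>\<^sub>\<infinity>e\<in>E. (cmod (cinner v e))\<^sup>2) \<le> (norm v)\<^sup>2"
      by (rule infsum_le_finite_sums [OF summable_on_cinner_square [OF E]])
         (blast intro: bessel_finite orthonormal_subset [OF E])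
    then have "B * (\<Sum>\<^sub>\<infinity>e\<in>E. (cmod (cinner v e))\<^sup>2) \<le> B * (norm v)\<^sup>2"
      using B by (rule mult_left_mono)
    moreover have "(norm (T v))\<^sup>2 \<le> B * (\<Sum>\<^sub>\<infinity>e\<in>E. (cmod (cinner v e))\<^sup>2)"
      unfolding T_def
      by (rule square_summable_combination(2) [OF B bound summable_on_cinner_square [OF E]])
    ultimately show ?thesis by linarith
  qed
  have "bounded_clinear T"
  proof (rule bounded_clinearI [where C = "sqrt B"])
    fix v w :: 'a and c
    have "((\<lambda>e. cinner (v + w) e *\<^sub>C g e) has_sum (T v + T w)) E"
      using has_sum_add [OF T [of v] T [of w]] by (simp add: cinner_add_left scaleC_add_left)
    then show "T (v + w) = T v + T w"
      using has_sum_unique [OF T [of "v + w"]] by blast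
    have "((\<lambda>e. cinner (c *\<^sub>C v) e *\<^sub>C g e) has_sum (c *\<^sub>C T v)) E"
      using has_sum_bounded_linear [OF bounded_linear_scaleC T [of v], of c]
      by (simp add: cinner_scaleC_left scaleC_scaleC)
    then show "T (c *\<^sub>C v) = c *\<^sub>C T v"
      using has_sum_unique [OF T [of "c *\<^sub>C v"]] by blast
    have "(norm (T v))\<^sup>2 \<le> (norm v * sqrt B)\<^sup>2"
      using norm [of v] B by (simp add: power_mult_distrib mult.commute)
    then show "norm (T v) \<le> norm v * sqrt B"
      by (rule power2_le_imp_le) (simp add: B)
  qed
  moreover have "T e = g e" if e: "e \<in> E" for e
  proof -
    have e': "cinner e e = 1" "\<And>x. x \<in> E \<Longrightarrow> x \<noteq> e \<Longrightarrow> cinner e x = 0"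
      using E e by (auto simp: orthonormal_def)
    have "((\<lambda>x. cinner e x *\<^sub>C g x) has_sum g e) {e}"
      by (rule has_sum_finiteI) (simp_all add: e')
    moreover have "((\<lambda>x. cinner e x *\<^sub>C g x) has_sum g e) {e} \<longleftrightarrow>
        ((\<lambda>x. cinner e x *\<^sub>C g x) has_sum g e) E"
      using e by (rule_tac has_sum_cong_neutral) (auto simp: e')
    ultimately show ?thesis
      using has_sum_unique [OF T [of e]] by blast
  qed
  ultimately show ?thesis
    using T norm by blast
qed

lemma ex_orthogonal_projection:
  fixes N :: "'a::chilbert_space set"
  assumes N: "csubspace N" "closed N"
  shows "\<exists>P. orthogonal_projection P \<and> ker P = N"
proof -
  obtain G where G: "orthonormal_basis N G"
    using ex_orthonormal_basis [OF N(1)] by blast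
  then have on: "orthonormal G" and sub: "G \<subseteq> N"
    by (auto simp: orthonormal_basis_def)
  define P where "P v = v - orth_proj G v" for v
  have lin: "bounded_clinear P"
    unfolding P_def
    by (intro bounded_clinear_diff_op bounded_clinear_ident bounded_clinear_orth_proj on)
  have "orthogonal_projection P"
    unfolding orthogonal_projection_def
    by (simp add: lin) (simp add: P_def bounded_clinear_diff [OF bounded_clinear_orth_proj [OF on]]
        orth_proj_idem [OF on] cinner_diff_left cinner_diff_right orth_proj_symmetric [OF on])
  moreover have "ker P = N"
  proof (intro equalityI subsetI)
    fix v assume "v \<in> ker P"
    then have "v = orth_proj G v"
      by (simp add: ker_def P_def)
    then show "v \<in> N"
      using orth_proj_in_closed [OF on N sub] by metis
  next
    fix v assume "v \<in> N"
    then show "v \<in> ker P"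
      using orth_proj_fixes [OF N G] by (simp add: ker_def P_def)
  qed
  ultimately show ?thesis by blast
qed

lemma orthogonal_projection_complement:
  fixes P :: "'a::chilbert_space \<Rightarrow> 'a"
  assumes P: "orthogonal_projection P"
  shows "orthogonal_projection (\<lambda>x. x - P x)" and "range (\<lambda>x. x - P x) = ker P"
proof -
  note lin = projection_linear [OF P]
  have "bounded_clinear (\<lambda>x. x - P x)"
    by (intro bounded_clinear_diff_op bounded_clinear_ident lin)
  then show "orthogonal_projection (\<lambda>x. x - P x)"
    unfolding orthogonal_projection_def
    by (simp add: bounded_clinear_diff [OF lin] projection_idem [OF P] cinner_diff_left
        cinner_diff_right projection_symmetric [OF P])
  show "range (\<lambda>x. x - P x) = ker P"
  proof (intro equalityI subsetI)
    fix x assume "x \<in> ker P"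
    then have "x = x - P x"
      by (simp add: ker_def)
    then show "x \<in> range (\<lambda>x. x - P x)"
      by (rule range_eqI)
  qed (auto simp: ker_def bounded_clinear_diff [OF lin] projection_idem [OF P])
qed

lemma orth_proj_eq_projection:
  fixes P :: "'a::chilbert_space \<Rightarrow> 'a"
  assumes P: "orthogonal_projection P" and E: "orthonormal_basis (range P) E"
  shows "orth_proj E v = P v"
proof -
  have on: "orthonormal E"
    using E by (simp add: orthonormal_basis_def)
  have "orth_proj E v = orth_proj E (P v)"
  proof (rule orth_proj_eqI [OF on])
    show "cinner v e = cinner (P v) e" if "e \<in> E" for e
      using projection_fixes_basis [OF P E that] by (simp add: projection_symmetric [OF P])
  qed
  also have "\<dots> = P v"
    by (rule orth_proj_fixes [OF csubspace_projection_range [OF P] closed_projection_range [OF P] E])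
       simp
  finally show ?thesis .
qed


section \<open>The polar decomposition in an eigenbasis\<close>

text \<open>Polarisation: \<open>\<langle>R v, v\<rangle>\<close> is real at \<open>v = x + y\<close> and at \<open>v = x + \<i> y\<close>.\<close>

lemma positive_op_symmetric:
  assumes "positive_op R"
  shows "cinner (R x) y = cinner x (R y)"
proof -
  have lin: "bounded_clinear R" and real: "\<And>v. Im (cinner (R v) v) = 0"
    using assms by (simp_all add: positive_op_def complex_nonneg_Reals_iff)
  have "Im (cinner (R (x + y)) (x + y)) = Im (cinner (R x) y) + Im (cinner (R y) x)"
    by (simp add: bounded_clinear_add [OF lin] cinner_add_left cinner_add_right real)
  moreover have "Im (cinner (R (x + \<i> *\<^sub>C y)) (x + \<i> *\<^sub>C y)) =
      Re (cinner (R y) x) - Re (cinner (R x) y)"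
    by (simp add: bounded_clinear_add [OF lin] bounded_clinear_scaleC [OF lin] cinner_add_left
        cinner_add_right cinner_scaleC_left cinner_scaleC_right real)
  ultimately have "cinner (R x) y = cnj (cinner (R y) x)"
    unfolding real by (intro complex_eqI) simp_all
  then show ?thesis
    by (metis cinner_commute)
qed

text \<open>A positive square root of \<open>S\<close> is forced on eigenvectors: if \<open>S e = r\<^sup>2 e\<close> with \<open>r > 0\<close>, then
  \<open>w = R e - r e\<close> satisfies \<open>R w = - r w\<close>, which positivity allows only for \<open>w = 0\<close>.\<close>

lemma positive_sqrt_eigenvector:
  assumes R: "positive_op R" and "R (R e) = (r\<^sup>2) *\<^sub>R e" and "r > 0"
  shows "R e = r *\<^sub>R e"
proof -
  have lin: "bounded_clinear R"
    using R by (simp add: positive_op_def)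
  define w where "w = R e - r *\<^sub>R e"
  have "R (r *\<^sub>R e) = r *\<^sub>R R e"
    by (metis bounded_clinear_scaleC [OF lin] scaleC_of_real)
  then have "R w = (- r) *\<^sub>R w"
    using assms(2) by (simp add: w_def bounded_clinear_diff [OF lin] power2_eq_square
        scaleR_diff_right)
  then have "cinner (R w) w = complex_of_real (- r * (norm w)\<^sup>2)"
    by (simp only: cinner_scaleR_left cinner_self of_real_mult)
  moreover have "cinner (R w) w \<in> \<real>\<^sub>\<ge>\<^sub>0"
    using R by (simp add: positive_op_def)
  ultimately have "- r * (norm w)\<^sup>2 \<ge> 0"
    by (simp only: nonneg_Reals_of_real_iff)
  then have "w = 0"
    using \<open>r > 0\<close> by (simp add: mult_le_0_iff)
  then show ?thesis
    by (simp add: w_def)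
qed

context
  fixes F :: "'a::chilbert_space \<Rightarrow> 'b::chilbert_space" and P E
  assumes F: "bounded_clinear F"
    and P: "orthogonal_projection P" and kerP: "ker P = ker F"
    and E: "orthonormal_basis (range P) E"
    and eig: "\<And>e. e \<in> E \<Longrightarrow> cadjoint F (F e) = ((norm (F e))\<^sup>2) *\<^sub>R e"
    and nz: "\<And>e. e \<in> E \<Longrightarrow> F e \<noteq> 0"
begin

text \<open>The polar part sends the eigenvector \<open>e\<close> to the normalised \<open>F e\<close>. Both factors of the polar
  decomposition are given by definite descriptions, so this identification includes the existence
  and uniqueness of the square root of \<open>F\<^sup>* F\<close> and of the partial isometry.\<close>

lemma polar_part_eigenbasis:
  shows "bounded_clinear (polar_part F)"
    and "e \<in> E \<Longrightarrow> polar_part F e = inverse (norm (F e)) *\<^sub>R F e"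
    and "cadjoint (polar_part F) \<circ> polar_part F = P"
    and "norm (polar_part F v) = norm (P v)"
proof -
  note linP = projection_linear [OF P]
  have onE: "orthonormal E"
    using E by (simp add: orthonormal_basis_def)
  obtain E' where E': "orthonormal_basis (ker P) E'"
    using ex_orthonormal_basis [OF csubspace_ker [OF linP]] by blast
  have basis: "orthonormal_basis UNIV (E \<union> E')"
    by (rule orthonormal_basis_projection_Un(1) [OF P E E'])
  have E'F: "F e = 0" and E'P: "P e = 0" if "e \<in> E'" for e
    using that E' kerP by (auto simp: orthonormal_basis_def ker_def)
  define u where "u e = inverse (norm (F e)) *\<^sub>R F e" for e
  have u: "cinner (u e) (u e') = (if e = e' then 1 else 0)" if "e \<in> E" "e' \<in> E" for e e'
  proof (cases "e = e'")
    case True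
    then show ?thesis
      using nz [OF that(1)] by (simp add: u_def cinner_self)
  next
    case False
    then have "cinner (F e) (F e') = 0"
      using that onE
      by (simp add: cinner_cadjoint_left [OF F, symmetric] eig cinner_scaleR_left orthonormal_def)
    then show ?thesis
      using False by (simp add: u_def cinner_scaleR_left cinner_scaleR_right)
  qed
  have "(norm (\<Sum>e\<in>A. c e *\<^sub>C u e))\<^sup>2 \<le> 1 * (\<Sum>e\<in>A. (cmod (c e))\<^sup>2)"
    if "finite A" "A \<subseteq> E" for A c
    using norm_sum_scaleC [OF that(1), of u c] u that(2) by (simp add: subset_iff)
  from ex_combination_operator [OF onE _ this]
  obtain U where U: "bounded_clinear U" and U_sum: "\<And>v. ((\<lambda>e. cinner v e *\<^sub>C u e) has_sum U v) E"
    and Ue: "\<And>e. e \<in> E \<Longrightarrow> U e = u e"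
    by auto
  have U_coord: "cinner (U v) (u e) = cinner v e" if e: "e \<in> E" for v e
  proof -
    have "((\<lambda>x. cinner v x * cinner (u x) (u e)) has_sum cinner (U v) (u e)) E"
      using has_sum_bounded_linear [OF bounded_linear_cinner_left U_sum [of v], of "u e"]
      by (simp add: cinner_scaleC_left)
    moreover have "((\<lambda>x. cinner v x * cinner (u x) (u e)) has_sum cinner v e) E \<longleftrightarrow>
        ((\<lambda>x. cinner v x * cinner x e) has_sum cinner v e) E"
      using u e onE by (intro has_sum_cong) (simp add: orthonormal_def)
    moreover have "((\<lambda>x. cinner v x * cinner x e) has_sum cinner v e) E"
      using has_sum_cinner_orth_proj [OF onE, of v e] cinner_orth_proj_basis [OF onE e, of v]
      by simp
    ultimately show ?thesis
      using has_sum_unique by blast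
  qed
  have UU: "cinner (U v) (U w) = cinner (P v) w" for v w
  proof -
    have "((\<lambda>x. cinner v x * cinner (u x) (U w)) has_sum cinner (U v) (U w)) E"
      using has_sum_bounded_linear [OF bounded_linear_cinner_left U_sum [of v], of "U w"]
      by (simp add: cinner_scaleC_left)
    moreover have "((\<lambda>x. cinner v x * cinner (u x) (U w)) has_sum cinner (P v) w) E \<longleftrightarrow>
        ((\<lambda>x. cinner v x * cinner x w) has_sum cinner (P v) w) E"
    proof (rule has_sum_cong)
      show "cinner v x * cinner (u x) (U w) = cinner v x * cinner x w" if "x \<in> E" for x
        using U_coord [OF that, of w] by (metis cinner_commute)
    qed
    moreover have "((\<lambda>x. cinner v x * cinner x w) has_sum cinner (P v) w) E"
      using has_sum_cinner_orth_proj [OF onE, of v w] unfolding orth_proj_eq_projection [OF P E] .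
    ultimately show ?thesis
      using has_sum_unique by blast
  qed
  have UstarU: "cadjoint U (U v) = P v" for v
    by (rule cinner_ext) (simp add: cinner_cadjoint_left [OF U] UU)
  have normU: "norm (U v) = norm (P v)" for v
  proof -
    have "complex_of_real ((norm (U v))\<^sup>2) = cinner (P v) (P v)"
      unfolding cinner_self [symmetric] UU by (metis projection_idem [OF P] projection_symmetric [OF P])
    then have "(norm (U v))\<^sup>2 = (norm (P v))\<^sup>2"
      unfolding cinner_self of_real_eq_iff .
    then show ?thesis by simp
  qed
  have kerU: "ker U = ker P"
    using normU by (auto simp: ker_def) (metis norm_eq_zero)+
  have E'U: "U e = 0" if "e \<in> E'" for e
    using kerU E'P [OF that] by (auto simp: ker_def)
  have isoU: "partial_isometry U"
    unfolding partial_isometry_def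
  proof (intro conjI allI impI U)
    fix x assume "\<forall>z\<in>ker U. cinner x z = 0"
    moreover have "x - P x \<in> ker U"
      unfolding kerU by (simp add: ker_def bounded_clinear_diff [OF linP] projection_idem [OF P])
    ultimately have "cinner x (x - P x) = 0" by blast
    then have "cinner (x - P x) (x - P x) = 0"
      by (simp add: cinner_diff_left cinner_diff_right projection_symmetric [OF P]
          projection_idem [OF P])
    then show "norm (U x) = norm x"
      unfolding normU cinner_self_eq_0 by simp
  qed

  define R where "R v = cadjoint U (F v)" for v
  have R: "bounded_clinear R"
    unfolding R_def by (rule bounded_clinear_comp [OF bounded_clinear_cadjoint [OF U] F])
  have Re: "R e = norm (F e) *\<^sub>R e" if e: "e \<in> E" for e
  proof -
    have "F e = complex_of_real (norm (F e)) *\<^sub>C U e"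
      using nz [OF e] by (simp add: Ue [OF e] u_def scaleC_of_real)
    then have "R e = complex_of_real (norm (F e)) *\<^sub>C cadjoint U (U e)"
      unfolding R_def by (metis bounded_clinear_scaleC [OF bounded_clinear_cadjoint [OF U]])
    then show ?thesis
      using projection_fixes_basis [OF P E e] by (simp add: UstarU scaleC_of_real)
  qed
  have E'R: "R e = 0" if "e \<in> E'" for e
    unfolding R_def E'F [OF that] by (rule bounded_clinear_zero [OF bounded_clinear_cadjoint [OF U]])
  have "cinner (R v) v \<in> \<real>\<^sub>\<ge>\<^sub>0" for v
  proof -
    have "F v = F (P v)"
    proof -
      have "v - P v \<in> ker F"
        unfolding kerP [symmetric]
        by (simp add: ker_def bounded_clinear_diff [OF linP] projection_idem [OF P])
      then show ?thesis
        by (simp add: ker_def bounded_clinear_diff [OF F])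
    qed
    then have RP: "R v = R (P v)"
      by (simp add: R_def)
    have "((\<lambda>e. cinner v e *\<^sub>C e) has_sum P v) E"
      using has_sum_orth_proj [OF onE, of v] unfolding orth_proj_eq_projection [OF P E] .
    from has_sum_bounded_linear [OF bounded_linear_cinner_left
        has_sum_bounded_linear [OF bounded_clinear_bounded_linear [OF R] this], of v]
    have sum: "((\<lambda>e. cinner (R (cinner v e *\<^sub>C e)) v) has_sum cinner (R v) v) E"
      unfolding RP .
    have eq: "cinner (R (cinner v e *\<^sub>C e)) v = complex_of_real (norm (F e) * (cmod (cinner v e))\<^sup>2)"
      if "e \<in> E" for e
    proof -
      have "cinner (R (cinner v e *\<^sub>C e)) v = norm (F e) * (cinner v e * cinner e v)"
        by (simp add: bounded_clinear_scaleC [OF R] Re [OF that] cinner_scaleC_left cinner_scaleR_left)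
      also have "cinner v e * cinner e v = complex_of_real ((cmod (cinner v e))\<^sup>2)"
        by (metis cinner_commute complex_norm_square)
      finally show ?thesis by simp
    qed
    have "Re (cinner (R v) v) \<ge> 0"
      by (rule has_sum_nonneg [OF has_sum_bounded_linear [OF bounded_linear_Re sum]])
         (simp add: eq)
    moreover have "Im (cinner (R v) v) = 0"
    proof (rule has_sum_unique [OF has_sum_bounded_linear [OF bounded_linear_Im sum]])
      show "((\<lambda>e. Im (cinner (R (cinner v e *\<^sub>C e)) v)) has_sum 0) E"
        by (rule has_sum_0) (simp add: eq)
    qed
    ultimately show ?thesis
      by (simp add: complex_nonneg_Reals_iff)
  qed
  then have posR: "positive_op R"
    using R by (simp add: positive_op_def)
  have sF: "bounded_clinear (\<lambda>v. cadjoint F (F v))"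
    by (rule bounded_clinear_comp [OF bounded_clinear_cadjoint [OF F] F])
  have RR: "(\<lambda>v. R (R v)) = (\<lambda>v. cadjoint F (F v))"
  proof (rule bounded_clinear_eqI [OF bounded_clinear_comp [OF R R] sF basis])
    fix e assume "e \<in> E \<union> E'"
    then consider "e \<in> E" | "e \<in> E'" by blast
    then show "R (R e) = cadjoint F (F e)"
    proof cases
      case 1
      have "R (norm (F e) *\<^sub>R e) = norm (F e) *\<^sub>R R e"
        by (metis bounded_clinear_scaleC [OF R] scaleC_of_real)
      then show ?thesis
        by (simp add: Re [OF 1] eig [OF 1] power2_eq_square)
    next
      case 2
      then show ?thesis
        by (simp add: E'R E'F bounded_clinear_zero [OF R]
            bounded_clinear_zero [OF bounded_clinear_cadjoint [OF F]])
    qed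
  qed
  have abs: "op_abs F = R"
    unfolding op_abs_def
  proof (rule the_equality)
    show "positive_op R \<and> R \<circ> R = cadjoint F \<circ> F"
      using posR RR by (simp add: comp_def)
    fix R' assume R': "positive_op R' \<and> R' \<circ> R' = cadjoint F \<circ> F"
    then have pos: "positive_op R'" and sq: "\<And>v. R' (R' v) = cadjoint F (F v)"
      by (auto simp: fun_eq_iff)
    have lin: "bounded_clinear R'"
      using pos by (simp add: positive_op_def)
    show "R' = R"
    proof (rule bounded_clinear_eqI [OF lin R basis])
      fix e assume "e \<in> E \<union> E'"
      then consider "e \<in> E" | "e \<in> E'" by blast
      then show "R' e = R e"
      proof cases
        case 1
        then show ?thesis
          using positive_sqrt_eigenvector [OF pos, of e "norm (F e)"] nz by (simp add: sq eig Re)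
      next
        case 2
        have "cinner (R' e) (R' e) = cinner (R' (R' e)) e"
          by (simp add: positive_op_symmetric [OF pos])
        also have "\<dots> = 0"
          by (simp add: sq E'F [OF 2] bounded_clinear_zero [OF bounded_clinear_cadjoint [OF F]])
        finally show ?thesis
          using E'R [OF 2] by (simp add: cinner_self_eq_0)
      qed
    qed
  qed
  have FUR: "F = (\<lambda>v. U (R v))"
  proof (rule bounded_clinear_eqI [OF F bounded_clinear_comp [OF U R] basis])
    fix e assume "e \<in> E \<union> E'"
    then consider "e \<in> E" | "e \<in> E'" by blast
    then show "F e = U (R e)"
    proof cases
      case 1
      have "U (norm (F e) *\<^sub>R e) = norm (F e) *\<^sub>R U e"
        by (metis bounded_clinear_scaleC [OF U] scaleC_of_real)
      then show ?thesis
        using nz [OF 1] by (simp add: Re [OF 1] Ue [OF 1] u_def)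
    next
      case 2
      then show ?thesis
        by (simp add: E'R E'F bounded_clinear_zero [OF U])
    qed
  qed
  have polar: "polar_part F = U"
    unfolding polar_part_def abs
  proof (rule the_equality)
    show "partial_isometry U \<and> F = U \<circ> R \<and> ker U = ker F"
      using isoU FUR kerU kerP by (simp add: comp_def)
    fix V assume V: "partial_isometry V \<and> F = V \<circ> R \<and> ker V = ker F"
    then have lin: "bounded_clinear V" and VR: "\<And>v. V (R v) = F v" and kV: "ker V = ker F"
      by (auto simp: partial_isometry_def fun_eq_iff)
    show "V = U"
    proof (rule bounded_clinear_eqI [OF lin U basis])
      fix e assume "e \<in> E \<union> E'"
      then consider "e \<in> E" | "e \<in> E'" by blast
      then show "V e = U e"
      proof cases
        case 1
        have "V (norm (F e) *\<^sub>R e) = norm (F e) *\<^sub>R V e"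
          by (metis bounded_clinear_scaleC [OF lin] scaleC_of_real)
        then have "F e = norm (F e) *\<^sub>R V e"
          using VR [of e] by (simp add: Re [OF 1])
        then have "inverse (norm (F e)) *\<^sub>R F e = inverse (norm (F e)) *\<^sub>R norm (F e) *\<^sub>R V e"
          by simp
        then show ?thesis
          using nz [OF 1] by (simp add: Ue [OF 1] u_def)
      next
        case 2
        then have "e \<in> ker V"
          unfolding kV by (simp add: ker_def E'F)
        then show ?thesis
          using E'U [OF 2] by (simp add: ker_def)
      qed
    qed
  qed
  show "bounded_clinear (polar_part F)"
    unfolding polar by (rule U)
  show "polar_part F e = inverse (norm (F e)) *\<^sub>R F e" if "e \<in> E"
    using Ue [OF that] by (simp add: polar u_def)
  show "cadjoint (polar_part F) \<circ> polar_part F = P"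
    by (simp add: fun_eq_iff polar UstarU)
  show "norm (polar_part F v) = norm (P v)"
    by (simp add: polar normU)
qed

end

section \<open>The distance of a synthesis operator to partial isometries\<close>

text \<open>\<open>F\<close> stands for the synthesis operator of the given frame and \<open>X\<close> for that of a Parseval
  frame; \<open>isoX\<close> makes \<open>X\<close> a partial isometry with initial projection \<open>Q = X\<^sup>* X\<close>. \<open>P\<close> is
  the projection onto the orthogonal complement of the kernel of \<open>F\<close>, on which \<open>F\<close> is bounded
  below by \<open>a\<close>.\<close>

context
  fixes F X :: "'a::chilbert_space \<Rightarrow> 'b::chilbert_space" and P and a :: real
  assumes F: "bounded_clinear F" and X: "bounded_clinear X"
    and isoX: "\<And>v. X (cadjoint X (X v)) = X v"
    and close: "hs (\<lambda>v. F v - X v) < \<infinity>"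
    and P: "orthogonal_projection P" and kerP: "ker P = ker F"
    and a: "a > 0" "\<And>v. a * norm (P v) \<le> norm (F v)"
begin

abbreviation (input) "Q \<equiv> cadjoint X \<circ> X"

lemma initial_projection: "orthogonal_projection Q"
  using bounded_clinear_comp [OF bounded_clinear_cadjoint [OF X] X]
  by (simp add: orthogonal_projection_def comp_def isoX cinner_cadjoint_left [OF X]
      cinner_cadjoint [OF X, symmetric])

lemma norm_initial_projection: "norm (Q v) = norm (X v)"
proof -
  have "cinner (Q v) (Q v) = cinner (X v) (X v)"
    by (simp add: cinner_cadjoint_left [OF X] isoX)
  then have "(norm (Q v))\<^sup>2 = (norm (X v))\<^sup>2"
    unfolding cinner_self of_real_eq_iff .
  then show ?thesis by simp
qed

lemma F_complement: "F (v - P v) = 0"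
proof -
  have "v - P v \<in> ker P"
    by (simp add: ker_def bounded_clinear_diff [OF projection_linear [OF P]] projection_idem [OF P])
  then show ?thesis
    unfolding kerP by (simp add: ker_def)
qed

lemma X_complement: "X (v - Q v) = 0"
  by (simp add: bounded_clinear_diff [OF X] isoX)

lemma difference_linear: "bounded_clinear (\<lambda>v. F v - X v)"
  by (rule bounded_clinear_diff_op [OF F X])

lemma complement_linear:
  "bounded_clinear (\<lambda>v. v - P v)" "bounded_clinear (\<lambda>v. v - Q v)"
  by (intro bounded_clinear_diff_op bounded_clinear_ident projection_linear [OF P]
      projection_linear [OF initial_projection])+

text \<open>On the kernel of \<open>F\<close> the operator \<open>X\<close> agrees with \<open>X - F\<close>, and on the kernel of \<open>X\<close> the
  operator \<open>F\<close> agrees with \<open>F - X\<close>, where \<open>F\<close> dominates \<open>a P\<close>. So both off-diagonal parts of the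
  pair of projections are Hilbert--Schmidt.\<close>

lemma hs_Q_complement: "hs (\<lambda>v. Q (v - P v)) < \<infinity>"
proof (rule hs_finite_mono [OF hs_finite_right [OF complement_linear(1) difference_linear close]])
  show "norm (Q (v - P v)) \<le> 1 * norm (F (v - P v) - X (v - P v))" for v
    unfolding norm_initial_projection F_complement by simp
qed

lemma hs_P_complement: "hs (\<lambda>v. P (v - Q v)) < \<infinity>"
proof (rule hs_finite_mono [OF hs_finite_right [OF complement_linear(2) difference_linear close]])
  show "norm (P (v - Q v)) \<le> inverse a * norm (F (v - Q v) - X (v - Q v))" for v
    unfolding X_complement using a(1) a(2) [of "v - Q v"] by (simp add: field_simps)
qed

text \<open>In each identity the two operators are adjoint to each other.\<close>

lemma hs_residual_Q: "hs (\<lambda>v. Q v - P (Q v)) = hs (\<lambda>v. Q (v - P v))"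
  and hs_residual_P: "hs (\<lambda>v. P v - Q (P v)) = hs (\<lambda>v. P (v - Q v))"
proof -
  have gen: "hs (\<lambda>v. R v - S (R v)) = hs (\<lambda>v. R (v - S v))"
    if R: "orthogonal_projection R" and S: "orthogonal_projection S" for R S :: "'a \<Rightarrow> 'a"
  proof -
    have lin: "bounded_clinear (\<lambda>v. v - S v)"
      by (intro bounded_clinear_diff_op bounded_clinear_ident projection_linear [OF S])
    have 1: "bounded_clinear (\<lambda>v. R (v - S v))"
      by (rule bounded_clinear_comp [OF projection_linear [OF R] lin])
    have 2: "bounded_clinear (\<lambda>v. R v - S (R v))"
      by (rule bounded_clinear_comp [OF lin projection_linear [OF R]])
    have "cadjoint (\<lambda>v. R (v - S v)) = (\<lambda>v. R v - S (R v))"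
      by (rule cadjoint_eqI [OF 1 2])
         (simp add: projection_symmetric [OF R] projection_symmetric [OF S] cinner_diff_left
           cinner_diff_right bounded_clinear_diff [OF projection_linear [OF R]])
    then show ?thesis
      using hs_cadjoint [OF 1] by simp
  qed
  show "hs (\<lambda>v. Q v - P (Q v)) = hs (\<lambda>v. Q (v - P v))"
    by (rule gen [OF initial_projection P])
  show "hs (\<lambda>v. P v - Q (P v)) = hs (\<lambda>v. P (v - Q v))"
    by (rule gen [OF P initial_projection])
qed

text \<open>Consequently \<open>F\<^sup>* F - P = F\<^sup>* (F - X) + (F - X)\<^sup>* X + (Q - P)\<close> is Hilbert--Schmidt, and
  \<open>F\<^sup>* F\<close> can be diagonalised on the range of \<open>P\<close>.\<close>

lemma ex_frame_eigenbasis: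
  "\<exists>E. orthonormal_basis (range P) E \<and>
     (\<forall>e\<in>E. cadjoint F (F e) = ((norm (F e))\<^sup>2) *\<^sub>R e \<and> F e \<noteq> 0)"
proof -
  note linP = projection_linear [OF P]
  note aF = bounded_clinear_cadjoint [OF F] and aX = bounded_clinear_cadjoint [OF X]
    and aD = bounded_clinear_cadjoint [OF difference_linear]
  define C where "C v = cadjoint F (F v) - P v" for v
  have C: "bounded_clinear C"
    unfolding C_def by (rule bounded_clinear_diff_op [OF bounded_clinear_comp [OF aF F] linP])
  have cadD: "cadjoint (\<lambda>v. F v - X v) = (\<lambda>w. cadjoint F w - cadjoint X w)"
    by (rule cadjoint_eqI [OF difference_linear bounded_clinear_diff_op [OF aF aX]])
       (simp add: cinner_diff_left cinner_diff_right cinner_cadjoint [OF F] cinner_cadjoint [OF X])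
  have h1: "hs (\<lambda>v. cadjoint F (F v - X v)) < \<infinity>"
    by (rule hs_finite_left [OF aF close])
  have h2: "hs (\<lambda>v. cadjoint F (X v) - cadjoint X (X v)) < \<infinity>"
  proof -
    have "hs (cadjoint (\<lambda>v. F v - X v)) < \<infinity>"
      using close hs_cadjoint [OF difference_linear] by simp
    from hs_finite_right [OF X aD this] show ?thesis
      unfolding cadD .
  qed
  have h3: "hs (\<lambda>v. Q (v - P v) - (P v - Q (P v))) < \<infinity>"
    by (rule hs_finite_diff [OF hs_Q_complement]) (use hs_P_complement hs_residual_P in simp)
  have "C = (\<lambda>v. (cadjoint F (F v - X v) + (cadjoint F (X v) - cadjoint X (X v))) +
      (Q (v - P v) - (P v - Q (P v))))"
    unfolding C_def
    by (simp add: fun_eq_iff bounded_clinear_diff [OF aF] bounded_clinear_diff [OF aX]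
        bounded_clinear_diff [OF X])
  then have "hs C < \<infinity>"
    using hs_finite_add [OF hs_finite_add [OF h1 h2] h3] by simp
  moreover have "cinner (C x) y = cinner x (C y)" for x y
    by (simp add: C_def cinner_diff_left cinner_diff_right cinner_cadjoint_left [OF F]
        cinner_cadjoint [OF F, symmetric] projection_symmetric [OF P])
  moreover have "C x \<in> range P" for x
  proof -
    have "P (cadjoint F (F x)) = cadjoint F (F x)"
    proof (rule cinner_ext)
      fix z
      have "F (P z) = F z"
        using F_complement [of z] by (simp add: bounded_clinear_diff [OF F])
      then show "cinner (P (cadjoint F (F x))) z = cinner (cadjoint F (F x)) z"
        by (simp add: projection_symmetric [OF P] cinner_cadjoint_left [OF F])
    qed
    then show ?thesis
      unfolding projection_range_iff [OF P] C_def
      by (simp add: bounded_clinear_diff [OF linP] projection_idem [OF P])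
  qed
  ultimately obtain E where E: "orthonormal_basis (range P) E"
    and eig: "\<forall>e\<in>E. \<exists>\<mu>::real. C e = \<mu> *\<^sub>R e"
    using spectral_theorem [OF C _ _ csubspace_projection_range [OF P] closed_projection_range [OF P]]
    by meson
  have "cadjoint F (F e) = ((norm (F e))\<^sup>2) *\<^sub>R e \<and> F e \<noteq> 0" if e: "e \<in> E" for e
  proof
    have Pe: "P e = e"
      by (rule projection_fixes_basis [OF P E e])
    have norm_e: "norm e = 1"
      using E e by (auto simp: orthonormal_basis_def intro: orthonormal_norm)
    obtain \<mu> :: real where "C e = \<mu> *\<^sub>R e"
      using bspec [OF eig e] by blast
    then have \<mu>: "cadjoint F (F e) = (1 + \<mu>) *\<^sub>R e"
      by (simp add: C_def Pe scaleR_add_left algebra_simps)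
    have "cinner (F e) (F e) = cinner (cadjoint F (F e)) e"
      by (simp add: cinner_cadjoint_left [OF F])
    then have "complex_of_real ((norm (F e))\<^sup>2) = complex_of_real (1 + \<mu>)"
      unfolding \<mu> cinner_scaleR_left cinner_self norm_e by simp
    then have "(norm (F e))\<^sup>2 = 1 + \<mu>"
      unfolding of_real_eq_iff .
    then show "cadjoint F (F e) = ((norm (F e))\<^sup>2) *\<^sub>R e"
      using \<mu> by simp
    show "F e \<noteq> 0"
      using a(1) a(2) [of e] by (auto simp: Pe norm_e)
  qed
  with E show ?thesis by blast
qed

text \<open>For a unit eigenvector \<open>e\<close> of \<open>F\<^sup>* F\<close> in the range of \<open>P\<close>, with \<open>r = \<parallel>F e\<parallel>\<close>, expanding the
  squares gives
  \<open>\<parallel>F e - X e\<parallel>\<^sup>2 + \<parallel>e - Q e\<parallel>\<^sup>2 = \<parallel>F e - U e\<parallel>\<^sup>2 + r (\<parallel>U e - X e\<parallel>\<^sup>2 + \<parallel>e - Q e\<parallel>\<^sup>2)\<close>;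
  for a unit vector \<open>e\<close> in the kernel of \<open>F\<close> one has \<open>\<parallel>F e - X e\<parallel> = \<parallel>Q e\<parallel>\<close> and \<open>F e = U e = 0\<close>.
  Summation over a basis leaves the two correction terms \<open>\<Sum> \<parallel>e - Q e\<parallel>\<^sup>2\<close> and \<open>\<Sum> \<parallel>Q e\<parallel>\<^sup>2\<close>, whose
  difference is the index; they cancel when it vanishes.\<close>

theorem distance_identity:
  assumes index: "proj_index P Q = 0"
    and E: "orthonormal_basis (range P) E"
    and eig: "\<And>e. e \<in> E \<Longrightarrow> cadjoint F (F e) = ((norm (F e))\<^sup>2) *\<^sub>R e"
    and nz: "\<And>e. e \<in> E \<Longrightarrow> F e \<noteq> 0"
  defines "U \<equiv> polar_part F"
  shows "hs (\<lambda>v. F v - X v) = hs (\<lambda>v. F v - U v) +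
      (\<integral>\<^sup>+e. ennreal (norm (F e) * ((norm (U e - X e))\<^sup>2 + (norm (e - Q e))\<^sup>2)) \<partial>count_space E)"
    and "(\<integral>\<^sup>+e. ennreal ((norm (e - Q e))\<^sup>2) \<partial>count_space E) = hs (\<lambda>v. Q (v - P v))"
proof -
  have linQ: "bounded_clinear Q"
    by (rule projection_linear [OF initial_projection])
  have U: "bounded_clinear U" and Ue: "\<And>e. e \<in> E \<Longrightarrow> U e = inverse (norm (F e)) *\<^sub>R F e"
    and normU: "\<And>v. norm (U v) = norm (P v)"
    unfolding U_def using polar_part_eigenbasis [OF F P kerP E eig nz] by auto
  obtain E' where E': "orthonormal_basis (ker P) E'"
    using ex_orthonormal_basis [OF csubspace_ker [OF projection_linear [OF P]]] by blast
  note basis = orthonormal_basis_projection_Un [OF P E E']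
  have E'P: "P e = 0" and E'F: "F e = 0" if "e \<in> E'" for e
    using that E' kerP by (auto simp: orthonormal_basis_def ker_def)
  have E'U: "U e = 0" if "e \<in> E'" for e
    using normU [of e] E'P [OF that] by simp
  have finite: "hs (\<lambda>v. P v - Q (P v)) < \<infinity>" "hs (\<lambda>v. Q v - P (Q v)) < \<infinity>"
    using hs_P_complement hs_Q_complement unfolding hs_residual_Q hs_residual_P by auto
  have "cdim (ker Q \<inter> range P) = cdim (range Q \<inter> ker P)"
    using index by (simp add: proj_index_def)
  with projection_pair_trace_identity [OF P initial_projection finite]
  have "of_nat (cdim (range Q \<inter> ker P)) + hs (\<lambda>v. P v - Q (P v)) =
      of_nat (cdim (range Q \<inter> ker P)) + hs (\<lambda>v. Q v - P (Q v))"
    by (simp only: add.commute)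
  then have "hs (\<lambda>v. P v - Q (P v)) = hs (\<lambda>v. Q v - P (Q v))"
    unfolding ennreal_add_left_cancel by simp
  then have eq: "hs (\<lambda>v. P v - Q (P v)) = hs (\<lambda>v. Q (v - P v))"
    unfolding hs_residual_Q .
  have residual: "(\<integral>\<^sup>+e. ennreal ((norm (e - Q e))\<^sup>2) \<partial>count_space E) = hs (\<lambda>v. P v - Q (P v))"
    by (rule hs_projection [OF P complement_linear(2) E, symmetric])
  with eq show "(\<integral>\<^sup>+e. ennreal ((norm (e - Q e))\<^sup>2) \<partial>count_space E) = hs (\<lambda>v. Q (v - P v))"
    by simp
  have kernel: "(\<integral>\<^sup>+e. ennreal ((norm (F e - X e))\<^sup>2) \<partial>count_space E') = hs (\<lambda>v. Q (v - P v))"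
  proof -
    have "(\<integral>\<^sup>+e. ennreal ((norm (F e - X e))\<^sup>2) \<partial>count_space E') =
        (\<integral>\<^sup>+e. ennreal ((norm (Q e))\<^sup>2) \<partial>count_space E')"
      by (rule nn_integral_cong) (simp only: norm_initial_projection, simp add: E'F)
    also have "\<dots> = hs (\<lambda>v. Q (v - P v))"
      using E' unfolding orthogonal_projection_complement(2) [OF P, symmetric]
      by (rule hs_projection [OF orthogonal_projection_complement(1) [OF P] linQ, symmetric])
    finally show ?thesis .
  qed
  have pointwise: "(norm (F e - X e))\<^sup>2 + (norm (e - Q e))\<^sup>2 =
      (norm (F e - U e))\<^sup>2 + norm (F e) * ((norm (U e - X e))\<^sup>2 + (norm (e - Q e))\<^sup>2)"
    if e: "e \<in> E" for e
  proof -
    have norm_e: "norm e = 1"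
      using E e by (auto simp: orthonormal_basis_def intro: orthonormal_norm)
    have Fe: "F e = norm (F e) *\<^sub>R U e" and Ue1: "norm (U e) = 1"
      using nz [OF e] by (simp_all add: Ue [OF e])
    have 1: "(norm (e - Q e))\<^sup>2 = 1 - (norm (X e))\<^sup>2"
      using norm_projection_residual [OF initial_projection, of e]
      unfolding norm_initial_projection norm_e by simp
    have 2: "(norm (F e - X e))\<^sup>2 =
        (norm (F e))\<^sup>2 + (norm (X e))\<^sup>2 - 2 * norm (F e) * Re (cinner (U e) (X e))"
      unfolding norm_diff_square
      using arg_cong [OF Fe, of "\<lambda>y. Re (cinner y (X e))"] by (simp add: cinner_scaleR_left)
    have 3: "(norm (F e - U e))\<^sup>2 = (norm (F e) - 1)\<^sup>2"
    proof -
      have "F e - U e = (norm (F e) - 1) *\<^sub>R U e"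
        using Fe by (simp add: scaleR_diff_left)
      then show ?thesis
        by (simp add: Ue1)
    qed
    have 4: "(norm (U e - X e))\<^sup>2 = 1 + (norm (X e))\<^sup>2 - 2 * Re (cinner (U e) (X e))"
      unfolding norm_diff_square Ue1 by simp
    show ?thesis
      unfolding 1 2 3 4 by (simp add: algebra_simps power2_eq_square)
  qed
  have "hs (\<lambda>v. F v - X v) = (\<integral>\<^sup>+e. ennreal ((norm (F e - X e))\<^sup>2) \<partial>count_space E) +
      hs (\<lambda>v. Q (v - P v))"
    unfolding hs_eq [OF difference_linear basis(1)] nn_integral_count_space_Un [OF basis(2)] kernel ..
  also have "\<dots> = (\<integral>\<^sup>+e. ennreal ((norm (F e - X e))\<^sup>2) \<partial>count_space E) +
      (\<integral>\<^sup>+e. ennreal ((norm (e - Q e))\<^sup>2) \<partial>count_space E)"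
    unfolding residual eq ..
  also have "\<dots> = (\<integral>\<^sup>+e. ennreal ((norm (F e - X e))\<^sup>2 + (norm (e - Q e))\<^sup>2) \<partial>count_space E)"
    by (simp add: nn_integral_add)
  also have "\<dots> = (\<integral>\<^sup>+e. ennreal ((norm (F e - U e))\<^sup>2 +
      norm (F e) * ((norm (U e - X e))\<^sup>2 + (norm (e - Q e))\<^sup>2)) \<partial>count_space E)"
    using pointwise by (intro nn_integral_cong) simp
  also have "\<dots> = (\<integral>\<^sup>+e. ennreal ((norm (F e - U e))\<^sup>2) \<partial>count_space E) +
      (\<integral>\<^sup>+e. ennreal (norm (F e) * ((norm (U e - X e))\<^sup>2 + (norm (e - Q e))\<^sup>2)) \<partial>count_space E)"
    by (simp add: nn_integral_add)
  also have "(\<integral>\<^sup>+e. ennreal ((norm (F e - U e))\<^sup>2) \<partial>count_space E) = hs (\<lambda>v. F v - U v)"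
  proof -
    have "(\<integral>\<^sup>+e. ennreal ((norm (F e - U e))\<^sup>2) \<partial>count_space E') = (\<integral>\<^sup>+e. 0 \<partial>count_space E')"
      by (rule nn_integral_cong) (simp add: E'F E'U)
    then show ?thesis
      unfolding hs_eq [OF bounded_clinear_diff_op [OF F U] basis(1)]
        nn_integral_count_space_Un [OF basis(2)] by simp
  qed
  finally show "hs (\<lambda>v. F v - X v) = hs (\<lambda>v. F v - U v) +
      (\<integral>\<^sup>+e. ennreal (norm (F e) * ((norm (U e - X e))\<^sup>2 + (norm (e - Q e))\<^sup>2)) \<partial>count_space E)" .
qed

text \<open>The remainder in the distance identity is a sum of nonnegative terms weighted by \<open>\<parallel>F e\<parallel> > 0\<close>. If it
  vanishes, then \<open>X\<close> agrees with the polar part \<open>U\<close> on the range of \<open>P\<close>, and \<open>Q\<close> fixes this range. The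
  vanishing index turns the latter into \<open>Q (1 - P) = 0\<close>, so that \<open>X\<close> and \<open>U\<close> both vanish on the
  kernel of \<open>F\<close>.\<close>

theorem polar_part_closest:
  assumes index: "proj_index (cadjoint (polar_part F) \<circ> polar_part F) Q = 0"
  shows "bounded_clinear (polar_part F)"
    and "hs (\<lambda>v. F v - polar_part F v) \<le> hs (\<lambda>v. F v - X v)"
    and "hs (\<lambda>v. F v - polar_part F v) = hs (\<lambda>v. F v - X v) \<Longrightarrow> X = polar_part F"
proof -
  obtain E where E: "orthonormal_basis (range P) E"
    and eig: "\<And>e. e \<in> E \<Longrightarrow> cadjoint F (F e) = ((norm (F e))\<^sup>2) *\<^sub>R e"
    and nz: "\<And>e. e \<in> E \<Longrightarrow> F e \<noteq> 0"
    using ex_frame_eigenbasis by blast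
  note polar = polar_part_eigenbasis [OF F P kerP E eig nz]
  have "cadjoint (polar_part F) \<circ> polar_part F = P"
    by (rule polar(3))
  with index have "proj_index P Q = 0"
    by metis
  note distance = distance_identity [OF this E eig nz]
  let ?T = "\<integral>\<^sup>+e. ennreal (norm (F e) * ((norm (polar_part F e - X e))\<^sup>2 + (norm (e - Q e))\<^sup>2))
    \<partial>count_space E"
  have identity: "hs (\<lambda>v. F v - X v) = hs (\<lambda>v. F v - polar_part F v) + ?T"
    by (rule distance(1))
  have residual: "(\<integral>\<^sup>+e. ennreal ((norm (e - Q e))\<^sup>2) \<partial>count_space E) = hs (\<lambda>v. Q (v - P v))"
    by (rule distance(2))
  show lin: "bounded_clinear (polar_part F)"
    by (rule polar(1))
  show "hs (\<lambda>v. F v - polar_part F v) \<le> hs (\<lambda>v. F v - X v)"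
    unfolding identity by simp
  assume eq: "hs (\<lambda>v. F v - polar_part F v) = hs (\<lambda>v. F v - X v)"
  then have "hs (\<lambda>v. F v - polar_part F v) + ?T = hs (\<lambda>v. F v - polar_part F v) + 0"
    using identity by simp
  then have "?T = 0"
    using close eq unfolding ennreal_add_left_cancel by auto
  then have zero: "norm (F e) * ((norm (polar_part F e - X e))\<^sup>2 + (norm (e - Q e))\<^sup>2) = 0"
    if "e \<in> E" for e
    using that by (subst (asm) nn_integral_0_iff_AE) (auto simp: AE_count_space)
  have agree: "X e = polar_part F e" and fixed: "e - Q e = 0" if "e \<in> E" for e
    using zero [OF that] nz [OF that] by (auto simp: add_nonneg_eq_0_iff)
  have "hs (\<lambda>v. Q (v - P v)) = (\<integral>\<^sup>+e. 0 \<partial>count_space E)"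
    unfolding residual [symmetric] by (rule nn_integral_cong) (use fixed in simp)
  then have Q0: "hs (\<lambda>v. Q (v - P v)) = 0"
    by simp
  have off: "X (v - P v) = 0" for v
  proof -
    have "ennreal ((norm (Q (v - P v)))\<^sup>2) \<le> ennreal ((norm v)\<^sup>2) * hs (\<lambda>v. Q (v - P v))"
      by (rule norm_le_hs [OF bounded_clinear_comp [OF projection_linear [OF initial_projection]
            complement_linear(1)]])
    then have "norm (Q (v - P v)) = 0"
      unfolding Q0 by simp
    then show ?thesis
      unfolding norm_initial_projection by simp
  qed
  obtain E' where E': "orthonormal_basis (ker P) E'"
    using ex_orthonormal_basis [OF csubspace_ker [OF projection_linear [OF P]]] by blast
  show "X = polar_part F"
  proof (rule bounded_clinear_eqI [OF X lin orthonormal_basis_projection_Un(1) [OF P E E']])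
    fix e assume "e \<in> E \<union> E'"
    then consider "e \<in> E" | "e \<in> E'" by blast
    then show "X e = polar_part F e"
    proof cases
      case 2
      then have "P e = 0"
        using E' by (auto simp: orthonormal_basis_def ker_def)
      then show ?thesis
        using off [of e] polar(4) [of e] by simp
    qed (rule agree)
  qed
qed

end

section \<open>Synthesis operators of frames\<close>

lemma cinner_ell2_basis: "cinner x (ell2_basis i) = ell2_coord x i"
proof -
  have "(\<lambda>j. ell2_coord x j * cnj (ell2_coord (ell2_basis i) j)) =
      (\<lambda>j. if j = i then ell2_coord x i else 0)"
    by (auto simp: ell2_coord_basis)
  then show ?thesis
    unfolding cinner_ell2_def using sums_single [of i "\<lambda>_. ell2_coord x i"]
    by (simp add: sums_iff)
qed

lemma inj_ell2_basis: "inj ell2_basis"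
  by (rule injI) (metis ell2_coord_basis zero_neq_one)

lemma orthonormal_basis_ell2: "orthonormal_basis UNIV (range ell2_basis)"
proof -
  have "orthonormal (range ell2_basis)"
    by (auto simp: orthonormal_def cinner_ell2_basis ell2_coord_basis dest: injD [OF inj_ell2_basis])
  moreover have "v = 0" if "\<forall>e\<in>range ell2_basis. cinner v e = 0" for v
    using that by (intro ell2_eqI) (simp add: cinner_ell2_basis ell2_coord_0)
  ultimately show ?thesis
    by (simp add: orthonormal_basis_def)
qed

lemma hs_ell2:
  fixes T :: "ell2 \<Rightarrow> 'h::chilbert_space"
  assumes "bounded_clinear T"
  shows "hs T = (\<Sum>i. ennreal ((norm (T (ell2_basis i)))\<^sup>2))"
  unfolding hs_eq [OF assms orthonormal_basis_ell2]
    nn_integral_bij_count_space [OF inj_on_imp_bij_betw [OF inj_ell2_basis], symmetric]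
    nn_integral_count_space_nat ..

text \<open>The upper frame bound, tested on \<open>y = \<Sum> c i f i\<close> itself, gives the bound on finite
  combinations from which the synthesis operator is built.\<close>

lemma frame_combination_bound:
  fixes f :: "nat \<Rightarrow> 'h::chilbert_space"
  assumes frame: "frame_with_bounds A B K f" and "B \<ge> 0" and J: "finite J"
  shows "(norm (\<Sum>i\<in>J. c i *\<^sub>C f i))\<^sup>2 \<le> B * (\<Sum>i\<in>J. (cmod (c i))\<^sup>2)"
proof -
  define y where "y = (\<Sum>i\<in>J. c i *\<^sub>C f i)"
  define q where "q = (\<Sum>i\<in>J. (cmod (c i))\<^sup>2)"
  have "y \<in> K"
    unfolding y_def using frame
    by (intro complex_vector.subspace_sum complex_vector.subspace_scale)
       (auto simp: frame_with_bounds_def)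
  then have sum: "summable (\<lambda>i. (cmod (cinner y (f i)))\<^sup>2)"
    and le: "(\<Sum>i. (cmod (cinner y (f i)))\<^sup>2) \<le> B * (norm y)\<^sup>2"
    using frame by (auto simp: frame_with_bounds_def)
  have fin: "(\<Sum>i\<in>J. (cmod (cinner (f i) y))\<^sup>2) \<le> B * (norm y)\<^sup>2"
    using sum_le_suminf [OF sum J] le by (simp add: cmod_cinner_commute [of _ y])
  have "complex_of_real ((norm y)\<^sup>2) = (\<Sum>i\<in>J. c i * cinner (f i) y)"
    unfolding cinner_self [symmetric] by (subst (1) y_def) (simp add: cinner_sum_left cinner_scaleC_left)
  then have "(norm y)\<^sup>2 = cmod (\<Sum>i\<in>J. c i * cinner (f i) y)"
    by (metis norm_of_real abs_of_nonneg zero_le_power2)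
  also have "\<dots> \<le> (\<Sum>i\<in>J. cmod (c i) * cmod (cinner (f i) y))"
    by (rule order_trans [OF norm_sum]) (simp add: norm_mult)
  also have "\<dots> \<le> L2_set (\<lambda>i. cmod (c i)) J * L2_set (\<lambda>i. cmod (cinner (f i) y)) J"
    using L2_set_mult_ineq [of "\<lambda>i. cmod (c i)" "\<lambda>i. cmod (cinner (f i) y)" J] by simp
  also have "\<dots> \<le> sqrt q * sqrt (B * (norm y)\<^sup>2)"
    unfolding L2_set_def q_def using fin
    by (intro mult_left_mono real_sqrt_le_mono) (auto intro: sum_nonneg)
  also have "\<dots> = sqrt (B * q) * norm y"
    by (simp add: real_sqrt_mult)
  finally have "norm y * norm y \<le> sqrt (B * q) * norm y"
    by (simp add: power2_eq_square)
  moreover have q: "q \<ge> 0"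
    unfolding q_def by (intro sum_nonneg) simp
  ultimately have "norm y \<le> sqrt (B * q)"
    using \<open>B \<ge> 0\<close> by (cases "norm y = 0") (auto dest: mult_right_le_imp_le)
  then have "(norm y)\<^sup>2 \<le> (sqrt (B * q))\<^sup>2"
    by (intro power_mono) auto
  then show ?thesis
    using q \<open>B \<ge> 0\<close> by (simp add: y_def q_def)
qed

lemma synthesis_frame:
  fixes f :: "nat \<Rightarrow> 'h::chilbert_space"
  assumes frame: "frame_with_bounds A B K f" and B: "B \<ge> 0"
  shows "bounded_clinear (synthesis f)" and "synthesis f (ell2_basis i) = f i"
    and "synthesis f v \<in> K" and "(norm (synthesis f v))\<^sup>2 \<le> B * (norm v)\<^sup>2"
proof -
  let ?g = "\<lambda>e. f (inv ell2_basis e)"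
  have on: "orthonormal (range ell2_basis)"
    using orthonormal_basis_ell2 by (simp add: orthonormal_basis_def)
  have "(norm (\<Sum>e\<in>G. c e *\<^sub>C ?g e))\<^sup>2 \<le> B * (\<Sum>e\<in>G. (cmod (c e))\<^sup>2)"
    if G: "finite G" "G \<subseteq> range ell2_basis" for G c
  proof -
    obtain J where J: "finite J" "G = ell2_basis ` J"
      using finite_subset_image [OF G] by blast
    have inj: "inj_on ell2_basis J"
      using inj_ell2_basis by (rule inj_on_subset) simp
    show ?thesis
      using frame_combination_bound [OF frame B J(1), of "\<lambda>i. c (ell2_basis i)"]
      by (simp add: J(2) sum.reindex [OF inj] inv_f_f [OF inj_ell2_basis])
  qed
  from ex_combination_operator [OF on B this]
  obtain T where T: "bounded_clinear T"
    and T_sum: "\<And>v. ((\<lambda>e. cinner v e *\<^sub>C ?g e) has_sum T v) (range ell2_basis)"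
    and T_basis: "\<forall>e\<in>range ell2_basis. T e = ?g e"
    and T_norm: "\<And>v. (norm (T v))\<^sup>2 \<le> B * (norm v)\<^sup>2"
    by blast
  have Te: "T (ell2_basis i) = f i" for i
    using T_basis by (simp add: inv_f_f [OF inj_ell2_basis])
  have eq: "synthesis f = T"
    unfolding synthesis_def
  proof (rule the_equality)
    fix S assume S: "bounded_clinear S \<and> (\<forall>i. S (ell2_basis i) = f i)"
    then have lin: "bounded_clinear S" by blast
    show "S = T"
      by (rule bounded_clinear_eqI [OF lin T orthonormal_basis_ell2]) (use S Te in auto)
  qed (use T Te in blast)
  show "bounded_clinear (synthesis f)" "synthesis f (ell2_basis i) = f i"
    "(norm (synthesis f v))\<^sup>2 \<le> B * (norm v)\<^sup>2"
    unfolding eq by (fact T Te T_norm)+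
  have K: "csubspace K" "closed K" "range f \<subseteq> K"
    using frame by (auto simp: frame_with_bounds_def)
  show "synthesis f v \<in> K"
    unfolding eq
  proof (rule Lim_in_closed_set [OF K(2)])
    show "((\<lambda>G. \<Sum>e\<in>G. cinner v e *\<^sub>C ?g e) \<longlongrightarrow> T v) (finite_subsets_at_top (range ell2_basis))"
      using T_sum [of v] unfolding has_sum_def .
    show "\<forall>\<^sub>F G in finite_subsets_at_top (range ell2_basis). (\<Sum>e\<in>G. cinner v e *\<^sub>C ?g e) \<in> K"
    proof (rule eventually_finite_subsets_at_top_weakI)
      show "(\<Sum>e\<in>G. cinner v e *\<^sub>C ?g e) \<in> K" for G
        using K(3) by (intro complex_vector.subspace_sum [OF K(1)] complex_vector.subspace_scale [OF K(1)])
          auto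
    qed
  qed simp
qed

lemma norm_analysis_frame:
  fixes f :: "nat \<Rightarrow> 'h::chilbert_space"
  assumes frame: "frame_with_bounds A B K f" and B: "B \<ge> 0"
  shows "(norm (cadjoint (synthesis f) y))\<^sup>2 = (\<Sum>i. (cmod (cinner y (f i)))\<^sup>2)"
proof -
  have "ell2_coord (cadjoint (synthesis f) y) i = cinner y (f i)" for i
    unfolding cinner_ell2_basis [symmetric]
    by (simp add: cinner_cadjoint_left [OF synthesis_frame(1) [OF frame B]] synthesis_frame(2) [OF frame B])
  then show ?thesis
    by (simp add: ell2_norm_square)
qed

lemma csubspace_closure:
  fixes N :: "'a::complex_inner set"
  assumes N: "csubspace N"
  shows "csubspace (closure N)"
  unfolding complex_vector.subspace_def
proof (intro conjI ballI allI)
  show "0 \<in> closure N"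
    using complex_vector.subspace_0 [OF N] closure_subset by blast
next
  fix x y assume "x \<in> closure N" "y \<in> closure N"
  then obtain u v where u: "\<And>n. u n \<in> N" "u \<longlonglongrightarrow> x" and v: "\<And>n. v n \<in> N" "v \<longlonglongrightarrow> y"
    unfolding closure_sequential by blast
  have "(\<lambda>n. u n + v n) \<longlonglongrightarrow> x + y"
    by (intro tendsto_add u v)
  moreover have "u n + v n \<in> N" for n
    using u v by (intro complex_vector.subspace_add [OF N])
  ultimately show "x + y \<in> closure N"
    unfolding closure_sequential by (intro exI [of _ "\<lambda>n. u n + v n"]) simp
next
  fix c x assume "x \<in> closure N"
  then obtain u where u: "\<And>n. u n \<in> N" "u \<longlonglongrightarrow> x"
    unfolding closure_sequential by blast
  have "(\<lambda>n. c *\<^sub>C u n) \<longlonglongrightarrow> c *\<^sub>C x"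
    by (rule bounded_linear.tendsto [OF bounded_linear_scaleC u(2)])
  moreover have "c *\<^sub>C u n \<in> N" for n
    using u by (intro complex_vector.subspace_scale [OF N])
  ultimately show "c *\<^sub>C x \<in> closure N"
    unfolding closure_sequential by (intro exI [of _ "\<lambda>n. c *\<^sub>C u n"]) simp
qed

text \<open>The lower frame bound speaks about the analysis operator \<open>F\<^sup>*\<close> on \<open>K\<close>. It passes to the synthesis
  operator on the orthogonal complement of its kernel because the vectors \<open>F\<^sup>* y\<close> with
  \<open>y \<in> K\<close> are dense there, and \<open>\<parallel>F F\<^sup>* y\<parallel> \<parallel>y\<parallel> \<ge> \<parallel>F\<^sup>* y\<parallel>\<^sup>2\<close>.\<close>

lemma synthesis_lower_bound:
  fixes f :: "nat \<Rightarrow> 'h::chilbert_space"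
  assumes frame: "frame_with_bounds A B K f" and B: "B \<ge> 0" and A: "A > 0"
    and w: "\<And>z. synthesis f z = 0 \<Longrightarrow> cinner w z = 0"
  shows "sqrt A * norm w \<le> norm (synthesis f w)"
proof -
  let ?F = "synthesis f" and ?N = "closure (cadjoint (synthesis f) ` K)"
  note F = synthesis_frame(1) [OF frame B]
  note aF = bounded_clinear_cadjoint [OF F]
  have K: "csubspace K"
    using frame by (simp add: frame_with_bounds_def)
  have image: "sqrt A * norm (cadjoint ?F y) \<le> norm (?F (cadjoint ?F y))" if y: "y \<in> K" for y
  proof (cases "y = 0")
    case False
    have "A * (norm y)\<^sup>2 \<le> (norm (cadjoint ?F y))\<^sup>2"
      unfolding norm_analysis_frame [OF frame B] using frame y by (simp add: frame_with_bounds_def)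
    then have "(sqrt A * norm y)\<^sup>2 \<le> (norm (cadjoint ?F y))\<^sup>2"
      using A by (simp add: power_mult_distrib)
    then have low: "sqrt A * norm y \<le> norm (cadjoint ?F y)"
      by (rule power2_le_imp_le) simp
    have "complex_of_real ((norm (cadjoint ?F y))\<^sup>2) = cinner (?F (cadjoint ?F y)) y"
      unfolding cinner_self [symmetric] cinner_cadjoint [OF F] ..
    then have "(norm (cadjoint ?F y))\<^sup>2 = cmod (cinner (?F (cadjoint ?F y)) y)"
      by (metis norm_of_real abs_of_nonneg zero_le_power2)
    also have "\<dots> \<le> norm (?F (cadjoint ?F y)) * norm y"
      by (rule cmod_cinner_le)
    finally have "norm (cadjoint ?F y) * norm (cadjoint ?F y) \<le> norm (?F (cadjoint ?F y)) * norm y"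
      by (simp add: power2_eq_square)
    moreover have "sqrt A * norm y * norm (cadjoint ?F y) \<le> norm (cadjoint ?F y) * norm (cadjoint ?F y)"
      by (rule mult_right_mono [OF low]) simp
    ultimately have "sqrt A * norm (cadjoint ?F y) * norm y \<le> norm (?F (cadjoint ?F y)) * norm y"
      by (simp add: ac_simps)
    then show ?thesis
      using False by simp
  qed (simp add: bounded_clinear_zero [OF aF] bounded_clinear_zero [OF F])
  have "csubspace (cadjoint ?F ` K)"
    unfolding complex_vector.subspace_def
  proof (intro conjI ballI allI)
    show "0 \<in> cadjoint ?F ` K"
      using complex_vector.subspace_0 [OF K] bounded_clinear_zero [OF aF] by (metis image_eqI)
  next
    fix x y assume "x \<in> cadjoint ?F ` K" "y \<in> cadjoint ?F ` K"
    then obtain u v where "u \<in> K" "v \<in> K" "x = cadjoint ?F u" "y = cadjoint ?F v"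
      by blast
    then show "x + y \<in> cadjoint ?F ` K"
      using complex_vector.subspace_add [OF K]
      by (intro image_eqI [of _ _ "u + v"]) (simp_all add: bounded_clinear_add [OF aF])
  next
    fix c x assume "x \<in> cadjoint ?F ` K"
    then obtain u where "u \<in> K" "x = cadjoint ?F u"
      by blast
    then show "c *\<^sub>C x \<in> cadjoint ?F ` K"
      using complex_vector.subspace_scale [OF K]
      by (intro image_eqI [of _ _ "c *\<^sub>C u"]) (simp_all add: bounded_clinear_scaleC [OF aF])
  qed
  then have N: "csubspace ?N" "closed ?N"
    by (simp_all add: csubspace_closure)
  obtain G where G: "orthonormal_basis ?N G"
    using ex_orthonormal_basis [OF N(1)] by blast
  then have on: "orthonormal G" and sub: "G \<subseteq> ?N"
    by (auto simp: orthonormal_basis_def)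
  define r where "r = w - orth_proj G w"
  have r_perp: "cinner n r = 0" if "n \<in> ?N" for n
    using cinner_orth_proj_residual [OF on, of n w] orth_proj_fixes [OF N G that]
    by (simp add: r_def)
  have "?F r = 0"
  proof -
    have "cinner (?F r) (?F r) = cinner r (cadjoint ?F (?F r))"
      by (rule cinner_cadjoint [OF F])
    also have "\<dots> = 0"
    proof -
      have "cadjoint ?F (?F r) \<in> ?N"
        using synthesis_frame(3) [OF frame B] closure_subset by blast
      then show ?thesis
        using r_perp cinner_eq_0_commute by blast
    qed
    finally show ?thesis
      by (simp add: cinner_self_eq_0)
  qed
  then have "cinner w r = 0"
    by (rule w)
  moreover have "cinner (orth_proj G w) r = 0"
    by (intro r_perp orth_proj_in_closed [OF on N sub])
  ultimately have "cinner r r = 0"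
    by (simp add: cinner_diff_left r_def)
  then have "r = 0"
    by (simp add: cinner_self_eq_0)
  then have "w \<in> ?N"
    using orth_proj_in_closed [OF on N sub, of w] by (simp add: r_def)
  moreover have "?N \<subseteq> {v. sqrt A * norm v \<le> norm (?F v)}"
  proof (rule closure_minimal)
    show "closed {v. sqrt A * norm v \<le> norm (?F v)}"
      by (intro closed_Collect_le continuous_intros bounded_clinear_continuous [OF F])
  qed (use image in blast)
  ultimately show ?thesis by blast
qed

text \<open>A Parseval frame has \<open>\<parallel>X\<^sup>* y\<parallel> = \<parallel>y\<parallel>\<close> on \<open>L\<close> and \<open>\<parallel>X\<parallel> \<le> 1\<close>, so
  \<open>\<parallel>X X\<^sup>* y - y\<parallel>\<^sup>2 = \<parallel>X X\<^sup>* y\<parallel>\<^sup>2 - \<parallel>y\<parallel>\<^sup>2 \<le> 0\<close> there.\<close>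

lemma parseval_frame_synthesis:
  fixes x :: "nat \<Rightarrow> 'h::chilbert_space"
  assumes x: "parseval_frame_in L x"
  shows "synthesis x (cadjoint (synthesis x) (synthesis x v)) = synthesis x v"
proof -
  let ?X = "synthesis x" and ?y = "synthesis x v"
  have frame: "frame_with_bounds 1 1 L x"
    using x by (simp add: parseval_frame_in_def)
  note X = synthesis_frame(1) [OF frame zero_le_one]
  have "?y \<in> L"
    by (rule synthesis_frame(3) [OF frame zero_le_one])
  then have norm: "(norm (cadjoint ?X ?y))\<^sup>2 = (norm ?y)\<^sup>2"
    unfolding norm_analysis_frame [OF frame zero_le_one] using frame
    by (auto simp: frame_with_bounds_def intro: antisym)
  have "Re (cinner (?X (cadjoint ?X ?y)) ?y) = (norm (cadjoint ?X ?y))\<^sup>2"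
    unfolding cinner_cadjoint [OF X] cinner_self by simp
  moreover have "(norm (?X (cadjoint ?X ?y)))\<^sup>2 \<le> (norm (cadjoint ?X ?y))\<^sup>2"
    using synthesis_frame(4) [OF frame zero_le_one, of "cadjoint ?X ?y"] by simp
  ultimately have "(norm (?X (cadjoint ?X ?y) - ?y))\<^sup>2 \<le> 0"
    unfolding norm_diff_square using norm by simp
  then show ?thesis by simp
qed

theorem theorem4p6:
  fixes f :: "nat \<Rightarrow> 'h::chilbert_space" and K :: "'h set"
  assumes "infinite_cdim TYPE('h)"
    and "separable_space (euclidean :: 'h topology)"
    and "frame_in K f"
    and "\<exists>x L. parseval_frame_in L x \<and> quadratically_close f x"
  shows "\<forall>x \<in> close_parseval_frames_index 0 f.
      (\<Sum>i. ennreal ((norm (f i - canonical_parseval f i))\<^sup>2)) \<le> (\<Sum>i. ennreal ((norm (f i - x i))\<^sup>2)) \<and>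
      ((\<Sum>i. ennreal ((norm (f i - canonical_parseval f i))\<^sup>2)) = (\<Sum>i. ennreal ((norm (f i - x i))\<^sup>2))
        \<longleftrightarrow> x = canonical_parseval f)"
proof
  fix x assume "x \<in> close_parseval_frames_index 0 f"
  then obtain L where x: "parseval_frame_in L x" and qc: "quadratically_close f x"
    and index: "proj_index (cadjoint (polar_part (synthesis f)) \<circ> polar_part (synthesis f))
      (cadjoint (synthesis x) \<circ> synthesis x) = 0"
    by (auto simp: close_parseval_frames_index_def close_parseval_frames_def Let_def)
  obtain A B where A: "A > 0" and "B > 0" and frame: "frame_with_bounds A B K f"
    using assms(3) by (auto simp: frame_in_def)
  then have B: "B \<ge> 0" by simp
  have frame_x: "frame_with_bounds 1 1 L x"
    using x by (simp add: parseval_frame_in_def)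
  let ?F = "synthesis f" and ?X = "synthesis x"
  let ?U = "polar_part ?F"
  note F = synthesis_frame(1,2) [OF frame B] and X = synthesis_frame(1,2) [OF frame_x zero_le_one]
  have sum_x: "hs (\<lambda>v. ?F v - ?X v) = (\<Sum>i. ennreal ((norm (f i - x i))\<^sup>2))"
    unfolding hs_ell2 [OF bounded_clinear_diff_op [OF F(1) X(1)]] F(2) X(2) ..
  have close: "hs (\<lambda>v. ?F v - ?X v) < \<infinity>"
    using qc unfolding sum_x quadratically_close_def by (simp add: ennreal_suminf_neq_top less_top)
  obtain P where P: "orthogonal_projection P" and kerP: "ker P = ker ?F"
    using ex_orthogonal_projection [OF csubspace_ker [OF F(1)] closed_ker [OF F(1)]] by blast
  have lower: "sqrt A * norm (P v) \<le> norm (?F v)" for v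
  proof -
    have "sqrt A * norm (P v) \<le> norm (?F (P v))"
    proof (rule synthesis_lower_bound [OF frame B A])
      fix z assume "?F z = 0"
      then have "z \<in> ker P"
        unfolding kerP by (simp add: ker_def)
      then show "cinner (P v) z = 0"
        by (simp add: projection_symmetric [OF P] ker_def)
    qed
    moreover have "v - P v \<in> ker ?F"
      unfolding kerP [symmetric]
      by (simp add: ker_def bounded_clinear_diff [OF projection_linear [OF P]] projection_idem [OF P])
    ultimately show ?thesis
      by (simp add: ker_def bounded_clinear_diff [OF F(1)])
  qed
  note closest = polar_part_closest [OF F(1) X(1) parseval_frame_synthesis [OF x] close P kerP _ lower index]
  have U: "bounded_clinear ?U"
    by (rule closest(1)) (simp add: A)
  have sum_u: "hs (\<lambda>v. ?F v - ?U v) = (\<Sum>i. ennreal ((norm (f i - canonical_parseval f i))\<^sup>2))"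
    unfolding hs_ell2 [OF bounded_clinear_diff_op [OF F(1) U]] F(2) canonical_parseval_def ..
  have "x = canonical_parseval f" if "hs (\<lambda>v. ?F v - ?U v) = hs (\<lambda>v. ?F v - ?X v)"
  proof
    have "?X = ?U"
      by (rule closest(3) [OF _ that]) (simp add: A)
    then show "x i = canonical_parseval f i" for i
      using X(2) [of i] by (simp add: canonical_parseval_def)
  qed
  moreover have "hs (\<lambda>v. ?F v - ?U v) \<le> hs (\<lambda>v. ?F v - ?X v)"
    by (rule closest(2)) (simp add: A)
  ultimately show "(\<Sum>i. ennreal ((norm (f i - canonical_parseval f i))\<^sup>2)) \<le> (\<Sum>i. ennreal ((norm (f i - x i))\<^sup>2)) \<and>
      ((\<Sum>i. ennreal ((norm (f i - canonical_parseval f i))\<^sup>2)) = (\<Sum>i. ennreal ((norm (f i - x i))\<^sup>2))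
        \<longleftrightarrow> x = canonical_parseval f)"
    unfolding sum_x sum_u by blast
qed

end
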